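(* Let $\Omega$, $\mathcal O$, $g$, $\Omega_n$, $\mathcal O_n$, $\mathbf g_n$, $\delta_n$, $\eta$, $h>0$ be as in the context, and let the kernel, domain and data assumptions stated there hold. Let $\mathbf u_n:\Omega_n\to\mathbb R$ solve the graph infinity Laplacian equation with labels $\mathbf g_n$ on $\mathcal O_n$, let $u:\overline\Omega\to\mathbb R$ be an absolutely minimizing Lipschitz extension of $g$, and let $u_n=\mathbf u_n\circ\pi_n:\overline\Omega\to\mathbb R$ be the piecewise constant extension of $\mathbf u_n$. Let the scaling assumption stated in the context hold for $(\delta_n,h,\varepsilon)$, with $\varepsilon=\left(\frac{\phi(h)}{h}\right)^{1/4}$ in part 1 and $\varepsilon=\left(\frac{\phi(h)}{h}\right)^{1/2}$ in part 2. Then we have the following convergence rates: 1. For $\phi(h)^{5/9}\gtrsim h\gtrsim\delta_n^{5/9}$ it holds $$\sup_{\Omega_n}|u-\mathbf u_n|=\sup_{\overline\Omega}|u-u_n|\lesssim\left(\frac{\phi(h)}{h}\right)^{1/4}.$$ 2. If $\inf_{\overline\Omega}|\nabla u|>0$, then for $\phi(h)^{3/5}\gtrsim h\gtrsim\delta_n^{3/5}$ it holds $$\sup_{\Omega_n}|u-\mathbf u_n|=\sup_{\overline\Omega}|u-u_n|\lesssim\left(\frac{\phi(h)}{h}\right)^{1/2}.$$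
   Context: Notation: $a\vee b=\max\{a,b\}$, $|\cdot|$ is the Euclidean norm, $a\lesssim b$ means $a\le C\,b$ for a universal constant $C>0$, possibly depending on the kernel $\eta$ or the label function $g$, and $a\gtrsim b$ means $b\lesssim a$. Domain. $\Omega\subset\mathbb R^d$ is an open bounded domain, and $d_\Omega(x,y)=\inf\{\int_0^1|\dot\xi(t)|\,dt:\ \xi\in C^1([0,1];\overline\Omega),\ \xi(0)=x,\ \xi(1)=y\}$ for $x,y\in\overline\Omega$. Relatively open, connected, and relative boundary $\partial^{\mathrm{rel}}$ refer to the metric space $(\overline\Omega,d_\Omega)$. Domain assumption: there exist $\phi:[0,\infty)\to[0,\infty)$ with $\lim_{h\downarrow0}\phi(h)/h=0$ and $r_\Omega>0$ such that $d_\Omega(x,y)\le|x-y|+\phi(|x-y|)$ for all $x,y\in\Omega$ with $|x-y|\le r_\Omega$. For $h>0$ set $\sigma_\phi(h)=\sup_{0<s\le h}\phi(s)/s$. Labels and point clouds. $\mathcal O\subset\overline\Omega$ is closed, $\Omega_{\mathcal O}=\overline\Omega\setminus\mathcal O$, and $g:\mathcal O\to\mathbb R$ is the labelling function. For $n\in\mathbb N$, $\Omega_n\subset\overline\Omega$ is a (finite) point cloud, $\mathcal O_n\subset\Omega_n$ is the set of labelled vertices, and $\mathbf g_n:\mathcal O_n\to\mathbb R$. With the Hausdorff distance $d_H(A,B)=\sup_{x\in A}\inf_{y\in B}|x-y|\vee\sup_{x\in B}\inf_{y\in A}|x-y|$, the graph resolution is $\delta_n=d_H(\Omega_n,\overline\Omega)\vee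 d_H(\mathcal O_n,\mathcal O)$. Closest point projections: $\pi_n(x)\in\operatorname{argmin}_{\mathbf x\in\Omega_n}|x-\mathbf x|$ for $x\in\overline\Omega$, and $\pi_{\mathcal O_n}(z)\in\operatorname{argmin}_{\mathbf z\in\mathcal O_n}|z-\mathbf z|$ for $z\in\mathcal O$. Kernel assumption: $\eta:(0,\infty)\to[0,\infty)$ is nonincreasing with $\operatorname{supp}\eta\subset[0,1]$, $\sigma_\eta:=\sup_{t>0}t\eta(t)\in(0,\infty)$, and there exists $t_0\in(0,1]$ (chosen as the largest number with this property) with $\sigma_\eta=t_0\eta(t_0)$. For the graph length scale $h>0$ set $\eta_h(t)=\frac1{\sigma_\eta h}\eta(t/h)$, with the convention $\eta(0)\cdot0:=0$. Graph. Weights on $\Omega_n$: $\mathbf w_n(\mathbf x,\mathbf y)=\eta_h(|\mathbf x-\mathbf y|)$ for $\mathbf x\ne\mathbf y$ and $0$ for $\mathbf x=\mathbf y$. Graph distance: $\mathbf d_n(\mathbf x,\mathbf x)=0$ and, for $\mathbf x\ne\mathbf y$, $\mathbf d_n(\mathbf x,\mathbf y)=\min\{\sum_{i=1}^N\mathbf w_n(\mathbf x_{i-1},\mathbf x_i)^{-1}\}$ over all $N\in\mathbb N$ and sequences $(\mathbf x_i)_{i=0}^N$ in $\Omega_n$ with $\mathbf x_0=\mathbf x$, $\mathbf x_N=\mathbf y$ (with $0^{-1}=\infty$). For $A\subset\Omega_n$, $\operatorname{Lip}_n(\mathbf v;A)=\max_{\mathbf x\neq\mathbf y\in A}|\mathbf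 v(\mathbf x)-\mathbf v(\mathbf y)|/\mathbf d_n(\mathbf x,\mathbf y)$. Graph infinity Laplacian equation: $\min_{\mathbf y\in\Omega_n}\eta_h(|\mathbf x-\mathbf y|)(\mathbf u_n(\mathbf y)-\mathbf u_n(\mathbf x))+\max_{\mathbf y\in\Omega_n}\eta_h(|\mathbf x-\mathbf y|)(\mathbf u_n(\mathbf y)-\mathbf u_n(\mathbf x))=0$ for $\mathbf x\in\Omega_n\setminus\mathcal O_n$, and $\mathbf u_n=\mathbf g_n$ on $\mathcal O_n$. Absolutely minimizing Lipschitz extension. For $A\subset\overline\Omega$, $\operatorname{Lip}_\Omega(u;A)=\sup_{x\ne y\in A}|u(x)-u(y)|/d_\Omega(x,y)$. A function $u\in C(\overline\Omega)$ is an absolutely minimizing Lipschitz extension of $g$ if $u=g$ on $\mathcal O$ and $\operatorname{Lip}_\Omega(u;\overline V)=\operatorname{Lip}_\Omega(u;\partial^{\mathrm{rel}}V)$ for all relatively open and connected subsets $V\subset\Omega_{\mathcal O}$. Data assumption: $\sup_{n\in\mathbb N}\operatorname{Lip}_n(\mathbf g_n;\mathcal O_n)<\infty$, $\operatorname{Lip}_\Omega(g;\mathcal O)<\infty$, and there exists a constant $C>0$ such that $|\mathbf g_n(\pi_{\mathcal O_n}(z))-g(z)|\le C\delta_n$ for all $z\in\mathcal O$. Scaling assumption on $(\delta_n,h,\varepsilon)$: $h\le r_\Omega$, $\ \frac h\varepsilon<\frac12$, and $\sigma_\phi(h)+\frac{\delta_n}h\le\frac{t_0}{4+2\sigma_\phi(h)}\left(1-2\frac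 h\varepsilon\right)$.
   Formalization: The equality of the two suprema fails in general (e.g. u(x)=x on (0,1)); proved instead: sup over Ω_n ≤ sup over closure of Ω ≤ sup over Ω_n + Cδ_n, with the stated rate for the larger. Label sets are nonempty; |∇u| is the local slope. *)

theory Defs
  imports "HOL-Analysis.Analysis"
begin

section \<open>The continuum domain\<close>

definition C1_path_in ::
  "'a::euclidean_space set \<Rightarrow> 'a \<Rightarrow> 'a \<Rightarrow> (real \<Rightarrow> 'a) \<Rightarrow> (real \<Rightarrow> 'a) \<Rightarrow> bool" where
  "C1_path_in S x y \<xi> \<xi>' \<longleftrightarrow>
     (\<forall>t\<in>{0..1}. (\<xi> has_vector_derivative \<xi>' t) (at t within {0..1})) \<and>
     continuous_on {0..1} \<xi>' \<and> \<xi> ` {0..1} \<subseteq> S \<and> \<xi> 0 = x \<and> \<xi> 1 = y"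

text \<open>The geodesic distance takes values in \<^typ>\<open>ennreal\<close>, so that points which cannot be joined
  have distance \<open>\<infinity>\<close>.\<close>

definition geodist :: "'a::euclidean_space set \<Rightarrow> 'a \<Rightarrow> 'a \<Rightarrow> ennreal" where
  "geodist \<Omega> x y =
     Inf {ennreal (integral {0..1} (\<lambda>t. norm (\<xi>' t))) | \<xi> \<xi>'. C1_path_in (closure \<Omega>) x y \<xi> \<xi>'}"

definition domain_assumption ::
  "'a::euclidean_space set \<Rightarrow> (real \<Rightarrow> real) \<Rightarrow> real \<Rightarrow> bool" where
  "domain_assumption \<Omega> \<phi> r \<longleftrightarrow>
     (\<forall>t\<ge>0. \<phi> t \<ge> 0) \<and> ((\<lambda>h. \<phi> h / h) \<longlongrightarrow> 0) (at_right 0) \<and> r > 0 \<and>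
     (\<forall>x\<in>\<Omega>. \<forall>y\<in>\<Omega>. norm (x - y) \<le> r \<longrightarrow>
        geodist \<Omega> x y \<le> ennreal (norm (x - y) + \<phi> (norm (x - y))))"

definition sigma_phi :: "(real \<Rightarrow> real) \<Rightarrow> real \<Rightarrow> real" where
  "sigma_phi \<phi> h = (SUP s\<in>{0<..h}. \<phi> s / s)"

definition geotop :: "'a::euclidean_space set \<Rightarrow> 'a topology" where
  "geotop \<Omega> = topology (\<lambda>U. U \<subseteq> closure \<Omega> \<and>
     (\<forall>x\<in>U. \<exists>r>0. \<forall>y\<in>closure \<Omega>. geodist \<Omega> x y < r \<longrightarrow> y \<in> U))"

lemma openin_geotop:
  "openin (geotop \<Omega>) U \<longleftrightarrow> U \<subseteq> closure \<Omega> \<and>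
     (\<forall>x\<in>U. \<exists>r>0. \<forall>y\<in>closure \<Omega>. geodist \<Omega> x y < r \<longrightarrow> y \<in> U)"
proof -
  let ?P = "\<lambda>U. U \<subseteq> closure \<Omega> \<and>
     (\<forall>x\<in>U. \<exists>r>0. \<forall>y\<in>closure \<Omega>. geodist \<Omega> x y < r \<longrightarrow> y \<in> U)"
  have "istopology ?P"
    unfolding istopology_def
  proof (intro conjI allI impI)
    fix S T assume S: "?P S" and T: "?P T"
    show "S \<inter> T \<subseteq> closure \<Omega>" using S by blast
    show "\<forall>x\<in>S \<inter> T. \<exists>r>0. \<forall>y\<in>closure \<Omega>. geodist \<Omega> x y < r \<longrightarrow> y \<in> S \<inter> T"
    proof
      fix x assume x: "x \<in> S \<inter> T"
      from S x obtain r where r: "r > 0" "\<forall>y\<in>closure \<Omega>. geodist \<Omega> x y < r \<longrightarrow> y \<in> S" by blast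
      from T x obtain q where q: "q > 0" "\<forall>y\<in>closure \<Omega>. geodist \<Omega> x y < q \<longrightarrow> y \<in> T" by blast
      show "\<exists>r>0. \<forall>y\<in>closure \<Omega>. geodist \<Omega> x y < r \<longrightarrow> y \<in> S \<inter> T"
        using r q by (intro exI[of _ "min r q"]) auto
    qed
  next
    fix \<K> assume K: "\<forall>V\<in>\<K>. ?P V"
    show "\<Union>\<K> \<subseteq> closure \<Omega>" using K by blast
    show "\<forall>x\<in>\<Union>\<K>. \<exists>r>0. \<forall>y\<in>closure \<Omega>. geodist \<Omega> x y < r \<longrightarrow> y \<in> \<Union>\<K>"
    proof
      fix x assume "x \<in> \<Union>\<K>"
      then obtain V where V: "V \<in> \<K>" "x \<in> V" by blast
      with K obtain r where "r > 0" "\<forall>y\<in>closure \<Omega>. geodist \<Omega> x y < r \<longrightarrow> y \<in> V" by blast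
      with V show "\<exists>r>0. \<forall>y\<in>closure \<Omega>. geodist \<Omega> x y < r \<longrightarrow> y \<in> \<Union>\<K>" by blast
    qed
  qed
  then show ?thesis unfolding geotop_def by (simp add: topology_inverse')
qed


section \<open>Absolutely minimizing Lipschitz extensions\<close>

text \<open>Difference quotients are taken in \<^typ>\<open>ennreal\<close>: an empty supremum is \<open>0\<close>, and pairs at
  infinite distance contribute \<open>0\<close>.\<close>

definition Lip_const :: "('a \<Rightarrow> 'a \<Rightarrow> ennreal) \<Rightarrow> ('a \<Rightarrow> real) \<Rightarrow> 'a set \<Rightarrow> ennreal" where
  "Lip_const d v A = (SUP (x, y)\<in>{(x, y). x \<in> A \<and> y \<in> A \<and> x \<noteq> y}. ennreal \<bar>v x - v y\<bar> / d x y)"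

definition is_AMLE ::
  "'a::euclidean_space set \<Rightarrow> 'a set \<Rightarrow> ('a \<Rightarrow> real) \<Rightarrow> ('a \<Rightarrow> real) \<Rightarrow> bool" where
  "is_AMLE \<Omega> \<O> g u \<longleftrightarrow>
     continuous_on (closure \<Omega>) u \<and> (\<forall>z\<in>\<O>. u z = g z) \<and>
     (\<forall>V. openin (geotop \<Omega>) V \<and> connectedin (geotop \<Omega>) V \<and> V \<subseteq> closure \<Omega> - \<O> \<longrightarrow>
        Lip_const (geodist \<Omega>) u (geotop \<Omega> closure_of V) =
        Lip_const (geodist \<Omega>) u (geotop \<Omega> frontier_of V))"

text \<open>The function \<open>u\<close> is merely continuous on \<^term>\<open>closure \<Omega>\<close> and has no classical gradient on the
  boundary and on the label set, in general.  The quantity \<open>\<bar>\<nabla>u\<bar>\<close> is therefore the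
  local slope, which is defined everywhere on \<^term>\<open>closure \<Omega>\<close> and equals the norm of the gradient
  at interior points of differentiability.\<close>

definition local_slope :: "'a::euclidean_space set \<Rightarrow> ('a \<Rightarrow> real) \<Rightarrow> 'a \<Rightarrow> ereal" where
  "local_slope \<Omega> u x =
     Limsup (at x within closure \<Omega>) (\<lambda>y. ereal (\<bar>u y - u x\<bar> / norm (y - x)))"

lemma local_slope_eq_norm_gradient:
  assumes \<Omega>: "open \<Omega>" "x \<in> \<Omega>" and G: "(u has_derivative (\<lambda>v. G \<bullet> v)) (at x)"
  shows "local_slope \<Omega> u x = ereal (norm G)"
proof -
  have F: "at x within closure \<Omega> = at x"
    using \<Omega> by (meson at_within_interior closure_subset interior_maximal subsetD)
  have small: "eventually (\<lambda>y. \<bar>u y - u x - G \<bullet> (y - x)\<bar> \<le> e * norm (y - x)) (at x)"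
    if e: "e > 0" for e
  proof -
    obtain d where d: "d > 0"
      "\<And>y. norm (y - x) < d \<Longrightarrow> norm (u y - u x - G \<bullet> (y - x)) \<le> e * norm (y - x)"
      using G e unfolding has_derivative_at_alt by blast
    show ?thesis unfolding eventually_at using d by (auto simp: dist_norm)
  qed
  have "Limsup (at x) (\<lambda>y. ereal (\<bar>u y - u x\<bar> / norm (y - x))) \<le> ereal (norm G)"
  proof (rule ereal_le_epsilon2)
    fix e :: real assume e: "e > 0"
      have "eventually (\<lambda>y. ereal (\<bar>u y - u x\<bar> / norm (y - x)) \<le> ereal (norm G + e)) (at x)"
        using small[OF e] eventually_neq_at_within[of x x UNIV]
      proof eventually_elim
        case (elim y)
        have "\<bar>u y - u x\<bar> \<le> \<bar>G \<bullet> (y - x)\<bar> + e * norm (y - x)" using elim by linarith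
        also have "\<dots> \<le> norm G * norm (y - x) + e * norm (y - x)"
          by (simp add: Cauchy_Schwarz_ineq2)
        finally show ?case using elim by (simp add: divide_simps algebra_simps)
      qed
      then show "Limsup (at x) (\<lambda>y. ereal (\<bar>u y - u x\<bar> / norm (y - x))) \<le> ereal (norm G) + ereal e"
        by (simp add: Limsup_bounded)
  qed
  moreover have "ereal (norm G) \<le> Limsup (at x) (\<lambda>y. ereal (\<bar>u y - u x\<bar> / norm (y - x)))"
  proof (cases "G = 0")
    case True
    have "eventually (\<lambda>y. (0::ereal) \<le> ereal (\<bar>u y - u x\<bar> / norm (y - x))) (at x)" by simp
    then have "(0::ereal) \<le> Liminf (at x) (\<lambda>y. ereal (\<bar>u y - u x\<bar> / norm (y - x)))"
      by (rule Liminf_bounded)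
    also have "\<dots> \<le> Limsup (at x) (\<lambda>y. ereal (\<bar>u y - u x\<bar> / norm (y - x)))"
      by (rule Liminf_le_Limsup) (simp add: trivial_limit_at)
    finally show ?thesis using True by (simp add: zero_ereal_def)
  next
    case False
    let ?p = "\<lambda>t::real. x + t *\<^sub>R G"
    have lim: "filterlim ?p (at x) (at_right 0)"
      unfolding filterlim_at
    proof
      show "\<forall>\<^sub>F t in at_right 0. ?p t \<in> UNIV \<and> ?p t \<noteq> x"
        using False by (auto simp: eventually_at_filter)
      have "(?p \<longlongrightarrow> x + 0 *\<^sub>R G) (at_right 0)" by (intro tendsto_intros)
      then show "(?p \<longlongrightarrow> x) (at_right 0)" by simp
    qed
    show ?thesis
    proof (rule ereal_le_epsilon2)
      fix e :: real assume e: "e > 0"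
      have ev: "eventually (\<lambda>t. \<bar>u (?p t) - u x - G \<bullet> (?p t - x)\<bar> \<le> e * norm (?p t - x)) (at_right 0)"
        using lim small[OF e] by (auto simp: filterlim_iff)
      have "eventually (\<lambda>t. ereal (norm G - e) \<le> ereal (\<bar>u (?p t) - u x\<bar> / norm (?p t - x))) (at_right 0)"
        using ev eventually_at_right_less[of 0]
      proof eventually_elim
        case (elim t)
        have "G \<bullet> (?p t - x) = norm G * norm (?p t - x)"
          using elim by (simp add: power2_norm_eq_inner[symmetric] power2_eq_square)
        then have "(norm G - e) * norm (?p t - x) \<le> \<bar>u (?p t) - u x\<bar>"
          using elim by (simp add: algebra_simps)
        moreover have "norm (?p t - x) > 0" using elim False by simp
        ultimately show ?case by (simp add: pos_le_divide_eq)
      qed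
      then have "ereal (norm G - e) \<le> Liminf (at_right 0) (\<lambda>t. ereal (\<bar>u (?p t) - u x\<bar> / norm (?p t - x)))"
        by (rule Liminf_bounded)
      also have "\<dots> \<le> Limsup (at_right 0) (\<lambda>t. ereal (\<bar>u (?p t) - u x\<bar> / norm (?p t - x)))"
        by (rule Liminf_le_Limsup) simp
      also have "\<dots> \<le> Limsup (filtermap ?p (at_right 0)) (\<lambda>y. ereal (\<bar>u y - u x\<bar> / norm (y - x)))"
        by (rule Limsup_filtermap_ge)
      also have "\<dots> \<le> Limsup (at x) (\<lambda>y. ereal (\<bar>u y - u x\<bar> / norm (y - x)))"
        unfolding Limsup_def
        by (rule INF_superset_mono) (use lim in \<open>auto simp: filterlim_def le_filter_def\<close>)
      finally show "ereal (norm G) \<le> Limsup (at x) (\<lambda>y. ereal (\<bar>u y - u x\<bar> / norm (y - x))) + ereal e"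
        by (cases "Limsup (at x) (\<lambda>y. ereal (\<bar>u y - u x\<bar> / norm (y - x)))") auto
    qed
  qed
  ultimately show ?thesis unfolding local_slope_def F by (rule antisym)
qed


section \<open>Kernel and graph\<close>

definition sigma_eta :: "(real \<Rightarrow> real) \<Rightarrow> real" where
  "sigma_eta \<eta> = (SUP t\<in>{0<..}. t * \<eta> t)"

definition kernel_assumption :: "(real \<Rightarrow> real) \<Rightarrow> real \<Rightarrow> bool" where
  "kernel_assumption \<eta> t\<^sub>0 \<longleftrightarrow>
     (\<forall>t>0. \<eta> t \<ge> 0) \<and> antimono_on {0<..} \<eta> \<and> (\<forall>t>1. \<eta> t = 0) \<and>
     bdd_above ((\<lambda>t. t * \<eta> t) ` {0<..}) \<and> sigma_eta \<eta> > 0 \<and>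
     t\<^sub>0 \<in> {0<..1} \<and> sigma_eta \<eta> = t\<^sub>0 * \<eta> t\<^sub>0 \<and>
     (\<forall>t\<in>{0<..1}. sigma_eta \<eta> = t * \<eta> t \<longrightarrow> t \<le> t\<^sub>0)"

definition eta_scaled :: "(real \<Rightarrow> real) \<Rightarrow> real \<Rightarrow> real \<Rightarrow> real" where
  "eta_scaled \<eta> h t = 1 / (sigma_eta \<eta> * h) * \<eta> (t / h)"

definition weight :: "(real \<Rightarrow> real) \<Rightarrow> real \<Rightarrow> 'a::euclidean_space \<Rightarrow> 'a \<Rightarrow> real" where
  "weight \<eta> h x y = (if x = y then 0 else eta_scaled \<eta> h (norm (x - y)))"

text \<open>In \<^typ>\<open>ennreal\<close> one has \<open>inverse 0 = \<infinity>\<close>, so non-edges have infinite length.\<close>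

definition graphdist ::
  "(real \<Rightarrow> real) \<Rightarrow> real \<Rightarrow> 'a::euclidean_space set \<Rightarrow> 'a \<Rightarrow> 'a \<Rightarrow> ennreal" where
  "graphdist \<eta> h X x y = (if x = y then 0 else
     Inf {(\<Sum>i=1..N. inverse (ennreal (weight \<eta> h (p (i - 1)) (p i)))) | (N::nat) p.
            (\<forall>i\<le>N. p i \<in> X) \<and> p 0 = x \<and> p N = y})"

definition hausdorff_dist :: "'a::euclidean_space set \<Rightarrow> 'a set \<Rightarrow> real" where
  "hausdorff_dist A B =
     max (SUP x\<in>A. INF y\<in>B. norm (x - y)) (SUP x\<in>B. INF y\<in>A. norm (x - y))"

text \<open>\<open>X\<close> is the point cloud and \<open>L\<close> the set of labelled vertices.\<close>

definition resolution ::
  "'a::euclidean_space set \<Rightarrow> 'a set \<Rightarrow> 'a set \<Rightarrow> 'a set \<Rightarrow> real" where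
  "resolution \<Omega> \<O> X L = max (hausdorff_dist X (closure \<Omega>)) (hausdorff_dist L \<O>)"

definition closest_point_projection ::
  "'a::euclidean_space set \<Rightarrow> 'a set \<Rightarrow> ('a \<Rightarrow> 'a) \<Rightarrow> bool" where
  "closest_point_projection S X \<pi> \<longleftrightarrow>
     (\<forall>x\<in>S. is_arg_min (\<lambda>y. norm (x - y)) (\<lambda>y. y \<in> X) (\<pi> x))"

text \<open>The summand for \<open>y = x\<close> vanishes whatever the value \<open>\<eta> 0\<close> is, in accordance with the
  convention \<open>\<eta> 0 \<cdot> 0 = 0\<close>.\<close>

definition solves_graph_inf_laplace ::
  "(real \<Rightarrow> real) \<Rightarrow> real \<Rightarrow> 'a::euclidean_space set \<Rightarrow> 'a set \<Rightarrow> ('a \<Rightarrow> real) \<Rightarrow> ('a \<Rightarrow> real) \<Rightarrow> bool"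
where
  "solves_graph_inf_laplace \<eta> h X L gX v \<longleftrightarrow>
     (\<forall>x\<in>X - L. Min ((\<lambda>y. eta_scaled \<eta> h (norm (x - y)) * (v y - v x)) ` X)
               + Max ((\<lambda>y. eta_scaled \<eta> h (norm (x - y)) * (v y - v x)) ` X) = 0) \<and>
     (\<forall>x\<in>L. v x = gX x)"


section \<open>Data and scaling\<close>

text \<open>Bounds \<open>M\<close> and \<open>K\<close> for the two quantities that are required to be finite are parameters,
  since the constants in the convergence rates depend on them.\<close>

definition data_assumption ::
  "'a::euclidean_space set \<Rightarrow> 'a set \<Rightarrow> ('a \<Rightarrow> real) \<Rightarrow> (real \<Rightarrow> real) \<Rightarrow> real \<Rightarrow>
   (nat \<Rightarrow> 'a set) \<Rightarrow> (nat \<Rightarrow> 'a set) \<Rightarrow> (nat \<Rightarrow> 'a \<Rightarrow> real) \<Rightarrow> (nat \<Rightarrow> 'a \<Rightarrow> 'a) \<Rightarrow>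
   real \<Rightarrow> real \<Rightarrow> bool" where
  "data_assumption \<Omega> \<O> g \<eta> h X L gX \<pi>L M K \<longleftrightarrow>
     (SUP n. Lip_const (graphdist \<eta> h (X n)) (gX n) (L n)) \<le> ennreal M \<and>
     Lip_const (geodist \<Omega>) g \<O> < \<infinity> \<and>
     (\<forall>n. \<forall>z\<in>\<O>. \<bar>gX n (\<pi>L n z) - g z\<bar> \<le> K * resolution \<Omega> \<O> (X n) (L n))"

text \<open>The requirement \<^const>\<open>bdd_above\<close> says \<open>\<sigma>\<^sub>\<phi>(h) < \<infinity>\<close>; without it the inequality fails.\<close>

definition scaling_assumption ::
  "(real \<Rightarrow> real) \<Rightarrow> real \<Rightarrow> real \<Rightarrow> real \<Rightarrow> real \<Rightarrow> real \<Rightarrow> bool" where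
  "scaling_assumption \<phi> r t\<^sub>0 \<delta> h \<epsilon> \<longleftrightarrow>
     h \<le> r \<and> h / \<epsilon> < 1 / 2 \<and> bdd_above ((\<lambda>s. \<phi> s / s) ` {0<..h}) \<and>
     sigma_phi \<phi> h + \<delta> / h \<le> t\<^sub>0 / (4 + 2 * sigma_phi \<phi> h) * (1 - 2 * (h / \<epsilon>))"

definition graph_setting ::
  "'a::euclidean_space set \<Rightarrow> 'a set \<Rightarrow> ('a \<Rightarrow> real) \<Rightarrow> (real \<Rightarrow> real) \<Rightarrow> real \<Rightarrow>
   (nat \<Rightarrow> 'a set) \<Rightarrow> (nat \<Rightarrow> 'a set) \<Rightarrow> (nat \<Rightarrow> 'a \<Rightarrow> real) \<Rightarrow>
   (nat \<Rightarrow> 'a \<Rightarrow> 'a) \<Rightarrow> (nat \<Rightarrow> 'a \<Rightarrow> 'a) \<Rightarrow> (nat \<Rightarrow> 'a \<Rightarrow> real) \<Rightarrow> real \<Rightarrow> real \<Rightarrow> bool"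
where
  "graph_setting \<Omega> \<O> g \<eta> h X L gX \<pi> \<pi>L uX M K \<longleftrightarrow>
     h > 0 \<and>
     (\<forall>n. finite (X n) \<and> X n \<subseteq> closure \<Omega> \<and> L n \<noteq> {} \<and> L n \<subseteq> X n) \<and>
     (\<forall>n. closest_point_projection (closure \<Omega>) (X n) (\<pi> n) \<and>
          closest_point_projection \<O> (L n) (\<pi>L n)) \<and>
     data_assumption \<Omega> \<O> g \<eta> h X L gX \<pi>L M K \<and>
     (\<forall>n. solves_graph_inf_laplace \<eta> h (X n) (L n) (gX n) (uX n))"

end

theory Submission
  imports Defs "HOL-Complex_Analysis.Great_Picard"
begin

text \<open>Write \<open>\<tau> = \<phi> h / h\<close>.  On the closure of \<open>\<Omega>\<close> the geodesic distance \<open>d\<close> is a genuine geodesic metric, comparable to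
the Euclidean one with a constant \<open>A\<close> depending on \<open>\<Omega>\<close> only, and the graph distance agrees with it up to a
relative error of order \<open>\<tau>\<close> and an additive error of order \<open>h\<close>.  The upper bound follows a geodesic with hops of
length at most \<open>t\<^sub>0 h\<close> (\<open>graphdist_upper\<close>).  The lower bound is the delicate one: hops may have any length up to
\<open>h\<close>, and at lengths below \<open>h\<close> the quotient \<open>\<phi> s / s\<close> may be much larger than \<open>\<tau>\<close>.  It is recovered from the pairs at
distance exactly \<open>h\<close>: they force every subarc of length \<open>h/2\<close> of a long geodesic to be straight up to an error
\<open>2 \<phi> h\<close>, and the parallelogram law turns this into straightness on the scale \<open>4 h\<close> (\<open>geodesic_excess\<close>,
\<open>chain_length\<close>).

The limit problem enters through comparison with cones, a consequence of the absolutely minimizing property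
(\<open>cone_comparison_above\<close>).  It makes \<open>r \<mapsto> max u\<close> over the ball of radius \<open>r\<close> convex, so that the min-ball function
\<open>w x = min {u y | d x y \<le> \<epsilon>}\<close> satisfies \<open>sup w + inf w \<le> 2 w x\<close> on balls of radius \<open>\<epsilon>\<close>
(\<open>min_ball_supersolution\<close>).  The graph solution satisfies comparison with graph cones
(\<open>graph_cone_comparison\<close>); by the comparison of distances its max-ball function \<open>v\<close> satisfies the reverse inequality
up to an error of order \<open>\<epsilon> \<tau> + h\<close> (\<open>max_ball_subsolution\<close>).

If \<open>w\<close> drops by at least \<open>\<theta>\<close> within every ball, replacing \<open>w\<close> by a concave function of \<open>w\<close> with second derivative
\<open>-\<kappa>\<close> makes the inequality for \<open>w\<close> strict by \<open>\<kappa> \<theta>\<^sup>2 / 4\<close>.  Once this exceeds the error, \<open>v - w\<close> has no interior maximum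
(\<open>nonlocal_comparison\<close>), and next to the labels \<open>v - w\<close> is of order \<open>\<epsilon>\<close>.  The price is an error of order \<open>\<kappa>\<close>.

If \<open>\<bar>\<nabla>u\<bar>\<close> is bounded below, the drop is \<open>\<theta> = \<alpha> \<epsilon>\<close> (\<open>min_ball_slope\<close>) and the error is of order
\<open>\<epsilon> + (\<epsilon> \<tau> + h) / \<epsilon>\<^sup>2\<close>.  In general \<open>w\<close> is first raised by \<open>O(\<epsilon>)\<close> to a supersolution with drop \<open>\<theta> = \<epsilon>\<^sup>2\<close>
(\<open>slope_patching\<close>), and the error is of order \<open>\<epsilon> + (\<epsilon> \<tau> + h) / \<epsilon>\<^sup>4\<close>.  With \<open>\<tau> = \<epsilon>\<^sup>2\<close>, respectively \<open>\<tau> = \<epsilon>\<^sup>4\<close>, the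
assumed relations between \<open>h\<close>, \<open>\<delta>\<close> and \<open>\<phi> h\<close> say \<open>h \<le> C \<epsilon>\<^sup>3\<close>, respectively \<open>h \<le> C \<epsilon>\<^sup>5\<close>, and \<open>\<delta> \<le> C \<phi> h\<close>
(\<open>rate_exponents\<close>), and both errors are of order \<open>\<epsilon>\<close>.  The other inequality is the same statement for \<open>-u\<close> and
the negated graph solution.\<close>

section \<open>Curves and the geodesic distance\<close>

lemma C1_path_inD:
  assumes "C1_path_in S x y \<xi> \<xi>'"
  shows "\<And>t. t \<in> {0..1} \<Longrightarrow> (\<xi> has_vector_derivative \<xi>' t) (at t within {0..1})"
    "continuous_on {0..1} \<xi>'" "\<And>t. t \<in> {0..1} \<Longrightarrow> \<xi> t \<in> S" "\<xi> 0 = x" "\<xi> 1 = y"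
  using assms unfolding C1_path_in_def by auto

lemma geodist_le:
  "C1_path_in (closure \<Omega>) x y \<xi> \<xi>' \<Longrightarrow> integral {0..1} (\<lambda>t. norm (\<xi>' t)) \<le> l \<Longrightarrow> geodist \<Omega> x y \<le> ennreal l"
  unfolding geodist_def by (rule order_trans[OF Inf_lower ennreal_leI]) auto

lemma geodist_lessE:
  assumes "geodist \<Omega> x y < ennreal l"
  obtains \<xi> \<xi>' where "C1_path_in (closure \<Omega>) x y \<xi> \<xi>'" "integral {0..1} (\<lambda>t. norm (\<xi>' t)) < l"
proof -
  obtain \<xi> \<xi>' where p: "C1_path_in (closure \<Omega>) x y \<xi> \<xi>'" "ennreal (integral {0..1} (\<lambda>t. norm (\<xi>' t))) < ennreal l"
    using assms unfolding geodist_def Inf_less_iff by blast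
  have "integral {0..1} (\<lambda>t. norm (\<xi>' t)) < l"
  proof (rule ccontr)
    assume "\<not> ?thesis"
    then have "ennreal l \<le> ennreal (integral {0..1} (\<lambda>t. norm (\<xi>' t)))" by (intro ennreal_leI) simp
    then show False using p(2) by simp
  qed
  then show ?thesis using that p(1) by blast
qed

lemma C1_path_chord:
  assumes "C1_path_in S x y \<xi> \<xi>'" and st: "0 \<le> s" "s \<le> t" "t \<le> 1"
  shows "norm (\<xi> t - \<xi> s) \<le> integral {s..t} (\<lambda>t. norm (\<xi>' t))"
proof -
  note C = C1_path_inD[OF assms(1)]
  have int: "(\<xi>' has_integral (\<xi> t - \<xi> s)) {s..t}"
  proof (rule fundamental_theorem_of_calculus[OF st(2)])
    fix r assume "r \<in> {s..t}"
    then have "r \<in> {0..1}" using st by simp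
    from C(1)[OF this] show "(\<xi> has_vector_derivative \<xi>' r) (at r within {s..t})"
      by (rule has_vector_derivative_within_subset) (use st in auto)
  qed
  have "continuous_on {s..t} \<xi>'" using C(2) by (rule continuous_on_subset) (use st in auto)
  then have "norm (integral {s..t} \<xi>') \<le> integral {s..t} (\<lambda>t. norm (\<xi>' t))"
    by (intro integral_norm_bound_integral integrable_continuous_real continuous_on_norm) auto
  then show ?thesis using integral_unique[OF int] by simp
qed

lemma norm_le_geodist: "ennreal (norm (x - y)) \<le> geodist \<Omega> x y"
proof (rule ccontr)
  assume "\<not> ?thesis"
  then have "geodist \<Omega> x y < ennreal (norm (x - y))" by simp
  then obtain \<xi> \<xi>' where p: "C1_path_in (closure \<Omega>) x y \<xi> \<xi>'" "integral {0..1} (\<lambda>t. norm (\<xi>' t)) < norm (x - y)"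
    by (rule geodist_lessE)
  show False using C1_path_chord[OF p(1), of 0 1] p(2) C1_path_inD(4,5)[OF p(1)]
    by (simp add: norm_minus_commute)
qed

lemma geodist_refl: "x \<in> closure \<Omega> \<Longrightarrow> geodist \<Omega> x x = 0"
  using geodist_le[of \<Omega> x x "\<lambda>_. x" "\<lambda>_. 0" 0] by (auto simp: C1_path_in_def)

lemma geodist_subpath:
  assumes p: "C1_path_in (closure \<Omega>) x y \<xi> \<xi>'" and st: "0 \<le> s" "s \<le> t" "t \<le> 1"
  shows "geodist \<Omega> (\<xi> s) (\<xi> t) \<le> ennreal (integral {s..t} (\<lambda>t. norm (\<xi>' t)))"
proof (rule geodist_le)
  note C = C1_path_inD[OF p]
  let ?a = "\<lambda>\<tau>. s + (t - s) * \<tau>"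
  have a: "?a \<tau> \<in> {s..t}" if "\<tau> \<in> {0..1}" for \<tau>
  proof -
    have "(t - s) * \<tau> \<le> (t - s) * 1" using that st by (intro mult_left_mono) auto
    moreover have "0 \<le> (t - s) * \<tau>" using that st by simp
    ultimately show ?thesis by simp
  qed
  have a': "?a \<tau> \<in> {0..1}" if "\<tau> \<in> {0..1}" for \<tau>
    using a[OF that] st by simp
  have da: "(?a has_vector_derivative (t - s)) (at \<tau> within {0..1})" for \<tau>
    by (auto intro!: derivative_eq_intros)
  show "C1_path_in (closure \<Omega>) (\<xi> s) (\<xi> t) (\<lambda>\<tau>. \<xi> (?a \<tau>)) (\<lambda>\<tau>. (t - s) *\<^sub>R \<xi>' (?a \<tau>))"
    unfolding C1_path_in_def
  proof (intro conjI ballI)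
    fix \<tau> :: real assume \<tau>: "\<tau> \<in> {0..1}"
    have "?a ` {0..1} \<subseteq> {0..1}" using a' by blast
    then have "(\<xi> has_vector_derivative \<xi>' (?a \<tau>)) (at (?a \<tau>) within ?a ` {0..1})"
      by (rule has_vector_derivative_within_subset[OF C(1)[OF a'[OF \<tau>]]])
    from vector_diff_chain_within[OF da this]
    show "((\<lambda>\<tau>. \<xi> (?a \<tau>)) has_vector_derivative (t - s) *\<^sub>R \<xi>' (?a \<tau>)) (at \<tau> within {0..1})"
      by (simp add: o_def)
  next
    have "continuous_on {0..1} (\<lambda>\<tau>. \<xi>' (?a \<tau>))"
      by (rule continuous_on_compose2[OF C(2)], intro continuous_intros, use a' in blast)
    then show "continuous_on {0..1} (\<lambda>\<tau>. (t - s) *\<^sub>R \<xi>' (?a \<tau>))"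
      by (intro continuous_intros)
    show "(\<lambda>\<tau>. \<xi> (?a \<tau>)) ` {0..1} \<subseteq> closure \<Omega>" using a' C(3) by blast
  qed simp_all
  define L where "L u = integral {s..u} (\<lambda>t. norm (\<xi>' t))" for u
  have cn: "continuous_on {s..t} (\<lambda>t. norm (\<xi>' t))"
    by (intro continuous_on_norm continuous_on_subset[OF C(2)]) (use st in auto)
  have "((\<lambda>\<tau>. norm ((t - s) *\<^sub>R \<xi>' (?a \<tau>))) has_integral (L \<circ> ?a) 1 - (L \<circ> ?a) 0) {0..1}"
  proof (rule fundamental_theorem_of_calculus)
    fix \<tau> :: real assume \<tau>: "\<tau> \<in> {0..1}"
    have "(L has_vector_derivative norm (\<xi>' (?a \<tau>))) (at (?a \<tau>) within {s..t})"
      unfolding L_def by (intro integral_has_vector_derivative cn a \<tau>)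
    then have "(L has_vector_derivative norm (\<xi>' (?a \<tau>))) (at (?a \<tau>) within ?a ` {0..1})"
      by (rule has_vector_derivative_within_subset) (use a in auto)
    from vector_diff_chain_within[OF da this]
    show "(L \<circ> ?a has_vector_derivative norm ((t - s) *\<^sub>R \<xi>' (?a \<tau>))) (at \<tau> within {0..1})"
      using st by simp
  qed simp
  from integral_unique[OF this]
  show "integral {0..1} (\<lambda>\<tau>. norm ((t - s) *\<^sub>R \<xi>' (?a \<tau>))) \<le> integral {s..t} (\<lambda>t. norm (\<xi>' t))"
    by (simp add: L_def)
qed

text \<open>The arc length is perturbed by a linear term with slope \<open>c\<close> before it is inverted, which makes its inverse \<open>g\<close>
differentiable even where the curve stops; \<open>c\<close> is the slack between the length of the curve and \<open>l\<close>, so that the speed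
of \<open>\<xi> \<circ> g\<close> stays below \<open>l\<close>.\<close>

lemma arclength_reparametrization:
  assumes "geodist \<Omega> x y < ennreal l"
  obtains \<xi> \<xi>' g c where "C1_path_in (closure \<Omega>) x y \<xi> \<xi>'" "c > 0"
    "\<And>\<tau>. \<tau> \<in> {0..1} \<Longrightarrow> g \<tau> \<in> {0..1::real}" "g 0 = 0" "g 1 = 1" "continuous_on {0..1} g"
    "\<And>\<tau>. \<tau> \<in> {0<..<1} \<Longrightarrow> g \<tau> \<in> {0<..<1}"
    "\<And>\<tau>. \<tau> \<in> {0<..<1} \<Longrightarrow> (g has_real_derivative l / (norm (\<xi>' (g \<tau>)) + c)) (at \<tau>)"
    "\<And>\<sigma> \<tau>. 0 \<le> \<sigma> \<Longrightarrow> \<sigma> \<le> \<tau> \<Longrightarrow> \<tau> \<le> 1 \<Longrightarrow>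
       geodist \<Omega> (\<xi> (g \<sigma>)) (\<xi> (g \<tau>)) \<le> ennreal (l * (\<tau> - \<sigma>))"
proof -
  obtain \<xi> \<xi>' where p: "C1_path_in (closure \<Omega>) x y \<xi> \<xi>'" "integral {0..1} (\<lambda>t. norm (\<xi>' t)) < l"
    using assms by (rule geodist_lessE)
  note C = C1_path_inD[OF p(1)]
  define c where "c = l - integral {0..1} (\<lambda>t. norm (\<xi>' t))"
  have c: "c > 0" using p(2) by (simp add: c_def)
  have cn: "continuous_on {0..1} (\<lambda>t. norm (\<xi>' t))" by (intro continuous_on_norm C)
  have int: "(\<lambda>t. norm (\<xi>' t)) integrable_on {a..b}" if "0 \<le> a" "b \<le> 1" for a b
    by (intro integrable_continuous_real continuous_on_subset[OF cn]) (use that in auto)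
  have "0 \<le> integral {0..1} (\<lambda>t. norm (\<xi>' t))" by (intro integral_nonneg int) auto
  then have l: "l > 0" using c by (simp add: c_def)
  define s where "s t = (integral {0..t} (\<lambda>t. norm (\<xi>' t)) + c * t) / l" for t
  have s01: "s 0 = 0" "s 1 = 1" using l by (simp_all add: s_def c_def)
  have s_diff: "l * (s b - s a) = integral {a..b} (\<lambda>t. norm (\<xi>' t)) + c * (b - a)"
    if "0 \<le> a" "a \<le> b" "b \<le> 1" for a b
  proof -
    have "integral {0..a} (\<lambda>t. norm (\<xi>' t)) + integral {a..b} (\<lambda>t. norm (\<xi>' t)) = integral {0..b} (\<lambda>t. norm (\<xi>' t))"
      using that by (intro Henstock_Kurzweil_Integration.integral_combine int) auto
    moreover have ls: "l * s t = integral {0..t} (\<lambda>t. norm (\<xi>' t)) + c * t" for t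
      using l by (simp add: s_def)
    ultimately show ?thesis using ls[of a] ls[of b] unfolding right_diff_distrib by linarith
  qed
  have s_less: "s a < s b" if "0 \<le> a" "a < b" "b \<le> 1" for a b
  proof -
    have "0 \<le> integral {a..b} (\<lambda>t. norm (\<xi>' t))" using that by (intro integral_nonneg int) auto
    moreover have "c * (b - a) > 0" using c that by simp
    ultimately have "l * (s b - s a) > 0" using s_diff[of a b] that by simp
    then show ?thesis using l by (simp add: zero_less_mult_iff)
  qed
  have ds: "(s has_real_derivative (norm (\<xi>' t) + c) / l) (at t within {0..1})" if "t \<in> {0..1}" for t
  proof -
    have "((\<lambda>t. integral {0..t} (\<lambda>t. norm (\<xi>' t))) has_real_derivative norm (\<xi>' t)) (at t within {0..1})"
      by (rule integral_has_real_derivative[OF cn that])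
    from DERIV_cdivide[OF DERIV_add[OF this DERIV_cmult_Id], of c l]
    show ?thesis unfolding s_def .
  qed
  have s_cont: "continuous_on {0..1} s"
    by (rule DERIV_continuous_on[OF ds])
  have s_inj: "a = b" if "a \<in> {0..1}" "b \<in> {0..1}" "s a = s b" for a b
    using s_less[of a b] s_less[of b a] that by (cases a b rule: linorder_cases) auto
  have "\<exists>t\<in>{0..1}. s t = \<tau>" if "\<tau> \<in> {0..1}" for \<tau>
    using IVT'[of s 0 \<tau> 1] s_cont s01 that by auto
  then obtain g where g: "\<And>\<tau>. \<tau> \<in> {0..1} \<Longrightarrow> g \<tau> \<in> {0..1} \<and> s (g \<tau>) = \<tau>" by metis
  have g_s: "g (s t) = t" if "t \<in> {0..1}" for t
  proof -
    have "s t \<in> {0..1}" using s_less[of 0 t] s_less[of t 1] that s01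
      by (cases "t = 0"; cases "t = 1") (auto simp: less_imp_le)
    then show ?thesis using g[of "s t"] s_inj that by blast
  qed
  have s_img: "s ` {0..1} = {0..1}"
  proof
    show "s ` {0..1} \<subseteq> {0..1}"
    proof
      fix \<tau> assume "\<tau> \<in> s ` {0..1}"
      then obtain t where t: "t \<in> {0..1}" "\<tau> = s t" by blast
      then show "\<tau> \<in> {0..1}" using s_less[of 0 t] s_less[of t 1] s01
        by (cases "t = 0"; cases "t = 1") (auto simp: less_imp_le)
    qed
    show "{0..1} \<subseteq> s ` {0..1}"
    proof
      fix \<tau> :: real assume "\<tau> \<in> {0..1}"
      then show "\<tau> \<in> s ` {0..1}" using g[of \<tau>] by (metis imageI)
    qed
  qed
  have g_cont: "continuous_on {0..1} g"
    using continuous_on_inv[OF s_cont, of g] g_s s_img by auto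
  have g01: "g 0 = 0" "g 1 = 1" using g_s[of 0] g_s[of 1] s01 by auto
  have g_int: "g \<tau> \<in> {0<..<1}" if "\<tau> \<in> {0<..<1}" for \<tau>
  proof -
    have "g \<tau> \<in> {0..1}" "s (g \<tau>) = \<tau>" using g[of \<tau>] that by auto
    moreover have "g \<tau> \<noteq> 0" "g \<tau> \<noteq> 1" using calculation s01 that by auto
    ultimately show ?thesis by auto
  qed
  have dg: "(g has_real_derivative l / (norm (\<xi>' (g \<tau>)) + c)) (at \<tau>)" if \<tau>: "\<tau> \<in> {0<..<1}" for \<tau>
  proof -
    have "DERIV g \<tau> :> inverse ((norm (\<xi>' (g \<tau>)) + c) / l)"
    proof (rule DERIV_inverse_function[where a = 0 and b = 1])
      show "DERIV s (g \<tau>) :> (norm (\<xi>' (g \<tau>)) + c) / l"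
        using ds[of "g \<tau>"] g_int[OF \<tau>] by (simp add: at_within_Icc_at)
      have "norm (\<xi>' (g \<tau>)) + c > 0" using c by (simp add: add_nonneg_pos)
      then show "(norm (\<xi>' (g \<tau>)) + c) / l \<noteq> 0" using l by simp
      show "isCont g \<tau>" using g_cont \<tau> by (simp add: continuous_on_interior)
      show "s (g \<sigma>) = \<sigma>" if "0 < \<sigma>" "\<sigma> < 1" for \<sigma> using g[of \<sigma>] that by simp
    qed (use \<tau> in auto)
    then show ?thesis by simp
  qed
  have dist: "geodist \<Omega> (\<xi> (g \<sigma>)) (\<xi> (g \<tau>)) \<le> ennreal (l * (\<tau> - \<sigma>))"
    if "0 \<le> \<sigma>" "\<sigma> \<le> \<tau>" "\<tau> \<le> 1" for \<sigma> \<tau>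
  proof -
    have G: "g \<sigma> \<in> {0..1}" "g \<tau> \<in> {0..1}" "s (g \<sigma>) = \<sigma>" "s (g \<tau>) = \<tau>" using g[of \<sigma>] g[of \<tau>] that by auto
    have le: "g \<sigma> \<le> g \<tau>"
    proof (rule ccontr)
      assume "\<not> ?thesis"
      then have "s (g \<tau>) < s (g \<sigma>)" using G by (intro s_less) auto
      then show False using G that by simp
    qed
    have "geodist \<Omega> (\<xi> (g \<sigma>)) (\<xi> (g \<tau>)) \<le> ennreal (integral {g \<sigma>..g \<tau>} (\<lambda>t. norm (\<xi>' t)))"
      using geodist_subpath[OF p(1)] G le by simp
    also have "\<dots> \<le> ennreal (l * (\<tau> - \<sigma>))"
      using s_diff[of "g \<sigma>" "g \<tau>"] G le c by (intro ennreal_leI) simp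
    finally show ?thesis .
  qed
  show ?thesis
    by (rule that[OF p(1) c _ g01 g_cont g_int dg dist]) (use g in blast)
qed

lemma geodist_lipschitz_path:
  assumes "geodist \<Omega> x y < ennreal l"
  obtains \<omega> where "\<omega> 0 = x" "\<omega> 1 = y" "\<And>t. t \<in> {0..1} \<Longrightarrow> \<omega> t \<in> closure \<Omega>"
    "\<And>s t. 0 \<le> s \<Longrightarrow> s \<le> t \<Longrightarrow> t \<le> 1 \<Longrightarrow> geodist \<Omega> (\<omega> s) (\<omega> t) \<le> ennreal (l * (t - s))"
proof (rule arclength_reparametrization[OF assms])
  fix \<xi> \<xi>' g c
  assume g: "C1_path_in (closure \<Omega>) x y \<xi> \<xi>'" "c > 0"
    "\<And>\<tau>. \<tau> \<in> {0..1} \<Longrightarrow> g \<tau> \<in> {0..1::real}" "g 0 = 0" "g 1 = 1" "continuous_on {0..1} g"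
    "\<And>\<tau>. \<tau> \<in> {0<..<1} \<Longrightarrow> g \<tau> \<in> {0<..<1}"
    "\<And>\<tau>. \<tau> \<in> {0<..<1} \<Longrightarrow> (g has_real_derivative l / (norm (\<xi>' (g \<tau>)) + c)) (at \<tau>)"
    "\<And>\<sigma> \<tau>. 0 \<le> \<sigma> \<Longrightarrow> \<sigma> \<le> \<tau> \<Longrightarrow> \<tau> \<le> 1 \<Longrightarrow>
       geodist \<Omega> (\<xi> (g \<sigma>)) (\<xi> (g \<tau>)) \<le> ennreal (l * (\<tau> - \<sigma>))"
  show thesis
    by (rule that[of "\<xi> \<circ> g"]) (use g(3-5,9) C1_path_inD[OF g(1)] in \<open>simp_all add: o_def\<close>)
qed

text \<open>Curves that start and end at rest can be glued without losing \<open>C\<^sup>1\<close> regularity.  The bound on the speed is \<open>l\<close> times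
the derivative of the smooth step \<open>3 t\<^sup>2 - 2 t\<^sup>3\<close>, which has integral \<open>1\<close> and vanishes at both ends.\<close>

definition resting_path ::
  "'a::euclidean_space set \<Rightarrow> 'a \<Rightarrow> 'a \<Rightarrow> real \<Rightarrow> (real \<Rightarrow> 'a) \<Rightarrow> (real \<Rightarrow> 'a) \<Rightarrow> bool" where
  "resting_path S x y l \<zeta> \<zeta>' \<longleftrightarrow>
     (\<forall>t. (\<zeta> has_vector_derivative \<zeta>' t) (at t)) \<and> continuous_on UNIV \<zeta>' \<and>
     (\<forall>t\<le>0. \<zeta> t = x) \<and> (\<forall>t\<ge>1. \<zeta> t = y) \<and> range \<zeta> \<subseteq> S \<and>
     (\<forall>t. norm (\<zeta>' t) \<le> l * max 0 (6 * t * (1 - t)))"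

lemma has_vector_derivative_zero_quadratic:
  assumes "\<And>t. norm (f t - f a) \<le> C * (t - a)\<^sup>2"
  shows "(f has_vector_derivative 0) (at (a::real))"
  unfolding has_vector_derivative_def has_derivative_at_alt
proof (intro conjI allI impI)
  show "bounded_linear (\<lambda>x::real. x *\<^sub>R (0::'a))" by (simp add: bounded_linear_zero)
  fix e :: real assume e: "e > 0"
  show "\<exists>d>0. \<forall>t. norm (t - a) < d \<longrightarrow> norm (f t - f a - (t - a) *\<^sub>R 0) \<le> e * norm (t - a)"
  proof (intro exI[of _ "e / (\<bar>C\<bar> + 1)"] conjI allI impI)
    show "e / (\<bar>C\<bar> + 1) > 0" using e by (simp add: add_nonneg_pos)
    fix t assume t: "norm (t - a) < e / (\<bar>C\<bar> + 1)"
    have pos: "\<bar>C\<bar> + 1 > 0" by (simp add: add_nonneg_pos)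
    have "norm (f t - f a) \<le> C * (t - a)\<^sup>2" by (rule assms)
    also have "\<dots> \<le> (\<bar>C\<bar> + 1) * (t - a)\<^sup>2" by (intro mult_right_mono) auto
    also have "\<dots> = ((\<bar>C\<bar> + 1) * \<bar>t - a\<bar>) * \<bar>t - a\<bar>" by (simp add: power2_eq_square)
    also have "\<dots> \<le> e * \<bar>t - a\<bar>"
      using t pos by (intro mult_right_mono) (auto simp: pos_less_divide_eq mult.commute)
    finally show "norm (f t - f a - (t - a) *\<^sub>R 0) \<le> e * norm (t - a)" by simp
  qed
qed

text \<open>Compose a reparametrization of almost constant speed with the smooth step.  At the end points differentiability
follows from the quadratic behaviour of the step, without any knowledge of the derivative of the reparametrization.\<close>

lemma resting_path_exists:
  assumes "geodist \<Omega> x y < ennreal l"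
  obtains \<zeta> \<zeta>' where "resting_path (closure \<Omega>) x y l \<zeta> \<zeta>'"
proof (rule arclength_reparametrization[OF assms])
  fix \<xi> \<xi>' g c
  assume g: "C1_path_in (closure \<Omega>) x y \<xi> \<xi>'" "c > 0"
    "\<And>\<tau>. \<tau> \<in> {0..1} \<Longrightarrow> g \<tau> \<in> {0..1::real}" "g 0 = 0" "g 1 = 1" "continuous_on {0..1} g"
    "\<And>\<tau>. \<tau> \<in> {0<..<1} \<Longrightarrow> g \<tau> \<in> {0<..<1}"
    "\<And>\<tau>. \<tau> \<in> {0<..<1} \<Longrightarrow> (g has_real_derivative l / (norm (\<xi>' (g \<tau>)) + c)) (at \<tau>)"
    "\<And>\<sigma> \<tau>. 0 \<le> \<sigma> \<Longrightarrow> \<sigma> \<le> \<tau> \<Longrightarrow> \<tau> \<le> 1 \<Longrightarrow>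
       geodist \<Omega> (\<xi> (g \<sigma>)) (\<xi> (g \<tau>)) \<le> ennreal (l * (\<tau> - \<sigma>))"
  note C = C1_path_inD[OF g(1)]
  have l: "l > 0" using assms by (cases "l > 0") (auto simp: ennreal_neg)
  define p where "p t = t\<^sup>2 * (3 - 2 * t)" for t :: real
  have p_sym: "1 - p t = p (1 - t)" for t by (simp add: p_def power2_eq_square algebra_simps)
  have p_nn: "0 \<le> p t" "p t \<le> 3 * t\<^sup>2" if "0 \<le> t" "t \<le> 1" for t
  proof -
    show "0 \<le> p t" using that by (simp add: p_def)
    have "t\<^sup>2 * (3 - 2 * t) \<le> t\<^sup>2 * 3" using that by (intro mult_left_mono) auto
    then show "p t \<le> 3 * t\<^sup>2" by (simp add: p_def)
  qed
  have p_le1: "p t \<le> 1" if "0 \<le> t" "t \<le> 1" for t using p_nn(1)[of "1 - t"] p_sym[of t] that by simp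
  have p_pos: "0 < p t" "p t < 1" if "0 < t" "t < 1" for t
  proof -
    have "0 < p t" if "0 < t" "t < 1" for t using that by (simp add: p_def)
    from this[of t] this[of "1 - t"] show "0 < p t" "p t < 1" using that p_sym[of t] by simp_all
  qed
  have dp: "(p has_real_derivative 6 * t * (1 - t)) (at t)" for t
    unfolding p_def by (auto intro!: derivative_eq_intros simp: power2_eq_square algebra_simps)
  define cl where "cl t = max 0 (min 1 t)" for t :: real
  have cl: "0 \<le> cl t" "cl t \<le> 1" for t by (auto simp: cl_def)
  define \<zeta> where "\<zeta> t = \<xi> (g (p (cl t)))" for t
  define q where "q t = l / (norm (\<xi>' (g (p t))) + c) * (6 * t * (1 - t))" for t
  define \<zeta>' where "\<zeta>' t = (if t \<in> {0<..<1} then q t *\<^sub>R \<xi>' (g (p t)) else 0)" for t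
  have lip: "norm (\<xi> (g \<tau>) - \<xi> (g \<sigma>)) \<le> l * (\<tau> - \<sigma>)" if "0 \<le> \<sigma>" "\<sigma> \<le> \<tau>" "\<tau> \<le> 1" for \<sigma> \<tau>
  proof -
    have "ennreal (norm (\<xi> (g \<sigma>) - \<xi> (g \<tau>))) \<le> ennreal (l * (\<tau> - \<sigma>))"
      using norm_le_geodist g(9)[OF that] order_trans by blast
    then show ?thesis using that l by (simp add: norm_minus_commute)
  qed
  have z0: "\<zeta> t = x" if "t \<le> 0" for t using that g C by (simp add: \<zeta>_def cl_def p_def)
  have z1: "\<zeta> t = y" if "t \<ge> 1" for t using that g C by (simp add: \<zeta>_def cl_def p_def)
  have start: "norm (\<zeta> t - \<zeta> a) \<le> 3 * l * (t - a)\<^sup>2" if "a \<le> 0" for a t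
  proof -
    have "norm (\<xi> (g (p (cl t))) - \<xi> (g 0)) \<le> l * (p (cl t) - 0)"
      using p_nn(1)[OF cl] p_le1[OF cl] by (intro lip) auto
    also have "\<dots> \<le> l * (3 * (cl t)\<^sup>2)" using p_nn(2)[OF cl] l by (intro mult_left_mono) auto
    also have "\<dots> \<le> l * (3 * (t - a)\<^sup>2)"
    proof -
      have "cl t \<le> \<bar>t - a\<bar>" using that by (auto simp: cl_def)
      then have "(cl t)\<^sup>2 \<le> \<bar>t - a\<bar>\<^sup>2" using cl by (intro power_mono) auto
      then show ?thesis using l by simp
    qed
    finally show ?thesis using z0[OF that] g(4) C(4) by (simp add: \<zeta>_def)
  qed
  have stop: "norm (\<zeta> t - \<zeta> a) \<le> 3 * l * (t - a)\<^sup>2" if "a \<ge> 1" for a t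
  proof -
    have "norm (\<xi> (g 1) - \<xi> (g (p (cl t)))) \<le> l * (1 - p (cl t))"
      using p_nn(1)[OF cl] p_le1[OF cl] by (intro lip) auto
    also have "\<dots> \<le> l * (3 * (1 - cl t)\<^sup>2)"
      using p_nn(2)[of "1 - cl t"] p_sym[of "cl t"] cl[of t] l by (intro mult_left_mono) auto
    also have "\<dots> \<le> l * (3 * (t - a)\<^sup>2)"
    proof -
      have "1 - cl t \<le> \<bar>t - a\<bar>" using that by (auto simp: cl_def)
      then have "(1 - cl t)\<^sup>2 \<le> \<bar>t - a\<bar>\<^sup>2" using cl by (intro power_mono) auto
      then show ?thesis using l by simp
    qed
    finally show ?thesis using z1[OF that] g(5) C(5) by (simp add: \<zeta>_def norm_minus_commute)
  qed
  have inner: "(\<zeta> has_vector_derivative \<zeta>' t) (at t)" if t: "t \<in> {0<..<1}" for t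
  proof -
    have pt: "p t \<in> {0<..<1}" using p_pos t by simp
    have "((\<lambda>t. g (p t)) has_real_derivative q t) (at t)"
      using DERIV_chain2[OF g(8)[OF pt] dp] by (simp add: q_def)
    then have 1: "((\<lambda>t. g (p t)) has_vector_derivative q t) (at t)"
      by (simp add: has_real_derivative_iff_has_vector_derivative)
    have gp: "g (p t) \<in> {0<..<1}" using g(7)[OF pt] .
    have 2: "(\<xi> has_vector_derivative \<xi>' (g (p t))) (at (g (p t)))"
      using C(1)[of "g (p t)"] gp by (simp add: at_within_Icc_at)
    have "((\<xi> \<circ> (\<lambda>t. g (p t))) has_vector_derivative q t *\<^sub>R \<xi>' (g (p t))) (at t)"
      by (rule vector_diff_chain_at[OF 1 2])
    then have "(\<zeta> has_vector_derivative q t *\<^sub>R \<xi>' (g (p t))) (at t)"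
      by (rule has_vector_derivative_transform_within_open[where S = "{0<..<1}"])
         (use t in \<open>auto simp: \<zeta>_def cl_def\<close>)
    then show ?thesis using t by (simp add: \<zeta>'_def)
  qed
  have bound: "norm (\<zeta>' t) \<le> l * max 0 (6 * t * (1 - t))" for t
  proof (cases "t \<in> {0<..<1}")
    case True
    have nn: "0 \<le> 6 * t * (1 - t)" using True by simp
    have pos: "norm (\<xi>' (g (p t))) + c > 0" using g(2) by (simp add: add_nonneg_pos)
    have "norm (\<xi>' (g (p t))) / (norm (\<xi>' (g (p t))) + c) \<le> 1" using pos g(2) by (simp add: pos_divide_le_eq)
    then have "l * (6 * t * (1 - t)) * (norm (\<xi>' (g (p t))) / (norm (\<xi>' (g (p t))) + c)) \<le> l * (6 * t * (1 - t)) * 1"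
      using l nn by (intro mult_left_mono) auto
    moreover have "norm (\<zeta>' t) = l * (6 * t * (1 - t)) * (norm (\<xi>' (g (p t))) / (norm (\<xi>' (g (p t))) + c))"
      using True l nn pos by (simp add: \<zeta>'_def q_def abs_mult)
    ultimately show ?thesis using nn by simp
  next
    case False
    then have "\<zeta>' t = 0" unfolding \<zeta>'_def by (rule if_not_P)
    then show ?thesis using l by simp
  qed
  have cont: "isCont \<zeta>' t" for t
  proof (cases "t \<in> {0<..<1}")
    case True
    have co: "continuous_on {0<..<1} (\<lambda>t. \<xi>' (g (p t)))"
    proof -
      have p01: "continuous_on {0<..<1} p" unfolding p_def by (intro continuous_intros)
      have "continuous_on {0<..<1} (\<lambda>t. g (p t))"
        by (rule continuous_on_compose2[OF g(6) p01]) (use p_pos in \<open>auto simp: less_imp_le\<close>)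
      moreover have "(\<lambda>t. g (p t)) ` {0<..<1} \<subseteq> {0..1}" using g(3) p_pos by (force simp: less_imp_le)
      ultimately show ?thesis by (rule continuous_on_compose2[OF C(2)])
    qed
    have ne: "norm (\<xi>' (g (p t))) + c \<noteq> 0" for t using g(2) by (metis add_nonneg_pos norm_ge_zero less_irrefl)
    have "continuous_on {0<..<1} (\<lambda>t. q t *\<^sub>R \<xi>' (g (p t)))"
      unfolding q_def using co ne by (intro continuous_intros) auto
    then have "continuous_on {0<..<1} \<zeta>'" by (rule continuous_on_eq) (simp add: \<zeta>'_def)
    then show ?thesis using True by (simp add: continuous_on_eq_continuous_at)
  next
    case False
    have "((\<lambda>s. l * max 0 (6 * s * (1 - s))) \<longlongrightarrow> l * max 0 (6 * t * (1 - t))) (at t)" by (intro tendsto_intros)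
    moreover have "6 * t * (1 - t) \<le> 0"
    proof (cases "t \<le> 0")
      case True
      then show ?thesis by (simp add: mult_nonpos_nonneg)
    next
      case f: False
      then have "1 \<le> t" using False by auto
      then show ?thesis by (simp add: mult_nonneg_nonpos)
    qed
    ultimately have "((\<lambda>s. l * max 0 (6 * s * (1 - s))) \<longlongrightarrow> 0) (at t)" by simp
    then have "(\<zeta>' \<longlongrightarrow> 0) (at t)" by (rule Lim_null_comparison[rotated]) (simp add: bound)
    moreover have "\<zeta>' t = 0" unfolding \<zeta>'_def using False by (rule if_not_P)
    ultimately show ?thesis by (simp add: isCont_def)
  qed
  have "(\<zeta> has_vector_derivative \<zeta>' t) (at t)" for t
  proof (cases "t \<in> {0<..<1}")
    case False
    then have "t \<le> 0 \<or> t \<ge> 1" by auto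
    then have "(\<zeta> has_vector_derivative 0) (at t)"
      using has_vector_derivative_zero_quadratic[of \<zeta> t "3 * l"] start[of t] stop[of t] by blast
    moreover have "\<zeta>' t = 0" unfolding \<zeta>'_def using False by (rule if_not_P)
    ultimately show ?thesis by simp
  qed (rule inner)
  moreover have "range \<zeta> \<subseteq> closure \<Omega>"
  proof
    fix z assume "z \<in> range \<zeta>"
    then obtain t where "z = \<zeta> t" by blast
    then show "z \<in> closure \<Omega>" using C(3)[OF g(3)[of "p (cl t)"]] p_nn(1)[OF cl] p_le1[OF cl] by (simp add: \<zeta>_def)
  qed
  moreover have "continuous_on UNIV \<zeta>'" using cont by (simp add: continuous_at_imp_continuous_on)
  ultimately show thesis using that[of \<zeta> \<zeta>'] z0 z1 bound unfolding resting_path_def by blast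
qed

lemma resting_pathD:
  assumes "resting_path S x y l \<zeta> \<zeta>'"
  shows "\<And>t. (\<zeta> has_vector_derivative \<zeta>' t) (at t)" "\<And>A. continuous_on A \<zeta>'"
    "\<And>t. t \<le> 0 \<Longrightarrow> \<zeta> t = x" "\<And>t. t \<ge> 1 \<Longrightarrow> \<zeta> t = y" "\<And>t. \<zeta> t \<in> S"
    "\<And>t. norm (\<zeta>' t) \<le> l * max 0 (6 * t * (1 - t))"
  using assms unfolding resting_path_def by (auto intro: continuous_on_subset)

lemma resting_path_reverse:
  assumes "resting_path (closure \<Omega>) x y l \<zeta> \<zeta>'"
  shows "geodist \<Omega> y x \<le> ennreal l"
proof (rule geodist_le)
  note R = resting_pathD[OF assms]
  show "C1_path_in (closure \<Omega>) y x (\<lambda>t. \<zeta> (1 - t)) (\<lambda>t. - \<zeta>' (1 - t))"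
    unfolding C1_path_in_def
  proof (intro conjI ballI)
    fix t :: real
    have "((\<lambda>t. 1 - t) has_vector_derivative (-1)) (at t within {0..1})"
      by (auto intro!: derivative_eq_intros)
    from vector_diff_chain_within[OF this has_vector_derivative_at_within[OF R(1)]]
    show "((\<lambda>t. \<zeta> (1 - t)) has_vector_derivative - \<zeta>' (1 - t)) (at t within {0..1})" by (simp add: o_def)
    show "continuous_on {0..1} (\<lambda>t. - \<zeta>' (1 - t))"
      by (intro continuous_intros continuous_on_compose2[OF R(2)[of UNIV]]) auto
  qed (use R in auto)
  have "integral {0..1} (\<lambda>t. norm (- \<zeta>' (1 - t))) \<le> integral {0..1} (\<lambda>t. l * (6 * t * (1 - t)))"
  proof (rule integral_le)
    show "(\<lambda>t. norm (- \<zeta>' (1 - t))) integrable_on {0..1}"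
      by (intro integrable_continuous_real continuous_intros continuous_on_compose2[OF R(2)[of UNIV]]) auto
    show "(\<lambda>t. l * (6 * t * (1 - t))) integrable_on {0..1}"
      by (intro integrable_continuous_real continuous_intros)
    fix t :: real assume "t \<in> {0..1}"
    then have "0 \<le> 6 * (1 - t) * t" by simp
    then show "norm (- \<zeta>' (1 - t)) \<le> l * (6 * t * (1 - t))" using R(6)[of "1 - t"] by (simp add: mult.commute mult.left_commute)
  qed
  also have "((\<lambda>t. l * (6 * t * (1 - t))) has_integral l * (3 * 1\<^sup>2 - 2 * 1 ^ 3) - l * (3 * 0\<^sup>2 - 2 * 0 ^ 3)) {0..1::real}"
    by (intro fundamental_theorem_of_calculus)
       (auto simp: has_real_derivative_iff_has_vector_derivative[symmetric] power2_eq_square algebra_simps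
         intro!: derivative_eq_intros)
  from integral_unique[OF this] have "integral {0..1} (\<lambda>t. l * (6 * t * (1 - t))) = l" by simp
  finally show "integral {0..1} (\<lambda>t. norm (- \<zeta>' (1 - t))) \<le> l" .
qed

lemma geodist_sym: "geodist \<Omega> x y = geodist \<Omega> y x"
proof -
  have "geodist \<Omega> y x \<le> geodist \<Omega> x y" for x y
  proof (rule ennreal_le_epsilon)
    fix e :: real assume e: "0 < e" and fin: "geodist \<Omega> x y < top"
    then obtain m where m: "m \<ge> 0" "geodist \<Omega> x y = ennreal m" by (cases "geodist \<Omega> x y") auto
    then have "geodist \<Omega> x y < ennreal (m + e)" using e by (simp add: ennreal_less_iff)
    then obtain \<zeta> \<zeta>' where "resting_path (closure \<Omega>) x y (m + e) \<zeta> \<zeta>'" by (rule resting_path_exists)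
    from resting_path_reverse[OF this] show "geodist \<Omega> y x \<le> geodist \<Omega> x y + ennreal e"
      using m e by (simp add: ennreal_plus)
  qed
  then show ?thesis by (intro antisym)
qed

text \<open>The two curves are added rather than pasted: each of them is constant outside its own half of the time interval, so the
sum is \<open>C\<^sup>1\<close> without a case distinction at the junction.\<close>

lemma resting_path_concat:
  assumes "resting_path (closure \<Omega>) x y l \<zeta> \<zeta>'" "resting_path (closure \<Omega>) y z m \<omega> \<omega>'"
  shows "geodist \<Omega> x z \<le> ennreal (l + m)"
proof (rule geodist_le)
  note R = resting_pathD[OF assms(1)] and Q = resting_pathD[OF assms(2)]
  define f where "f t = \<zeta> (2 * t) + \<omega> (2 * t - 1) - y" for t
  define f' where "f' t = 2 *\<^sub>R \<zeta>' (2 * t) + 2 *\<^sub>R \<omega>' (2 * t - 1)" for t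
  have f1: "f t = \<zeta> (2 * t)" if "t \<le> 1 / 2" for t using that Q(3) by (simp add: f_def)
  have f2: "f t = \<omega> (2 * t - 1)" if "t \<ge> 1 / 2" for t using that R(4) by (simp add: f_def)
  have zero: "\<zeta>' t = 0" "\<omega>' t = 0" if "t \<le> 0 \<or> t \<ge> 1" for t
  proof -
    have "6 * t * (1 - t) \<le> 0" using that by (auto simp: mult_nonpos_nonneg mult_nonneg_nonpos)
    then show "\<zeta>' t = 0" "\<omega>' t = 0" using R(6)[of t] Q(6)[of t] by simp_all
  qed
  have df: "(f has_vector_derivative f' t) (at t)" for t
  proof -
    have "((\<lambda>t. 2 * t) has_vector_derivative 2) (at t)" "((\<lambda>t. 2 * t - 1) has_vector_derivative 2) (at t)"
      by (auto intro!: derivative_eq_intros)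
    note d = this
    have "((\<lambda>t. \<zeta> (2 * t) + \<omega> (2 * t - 1)) has_vector_derivative f' t) (at t)"
      using has_vector_derivative_add[OF vector_diff_chain_at[OF d(1) R(1)] vector_diff_chain_at[OF d(2) Q(1)]]
      unfolding f'_def o_def .
    from has_vector_derivative_diff[OF this has_vector_derivative_const[of y]]
    show ?thesis unfolding f_def by simp
  qed
  have cf: "continuous_on A f'" for A
  proof -
    have "continuous_on A (\<lambda>t. \<zeta>' (2 * t))"
      by (rule continuous_on_compose2[OF R(2)[of UNIV]], intro continuous_intros, simp)
    moreover have "continuous_on A (\<lambda>t. \<omega>' (2 * t - 1))"
      by (rule continuous_on_compose2[OF Q(2)[of UNIV]], intro continuous_intros, simp)
    ultimately show ?thesis unfolding f'_def by (intro continuous_on_add continuous_on_scaleR continuous_on_const)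
  qed
  show "C1_path_in (closure \<Omega>) x z f f'"
    unfolding C1_path_in_def
  proof (intro conjI ballI)
    show "(f has_vector_derivative f' t) (at t within {0..1})" for t
      by (rule has_vector_derivative_at_within[OF df])
    show "continuous_on {0..1} f'" by (rule cf)
    show "f ` {0..1} \<subseteq> closure \<Omega>"
    proof
      fix w assume "w \<in> f ` {0..1}"
      then obtain t where "w = f t" by blast
      then show "w \<in> closure \<Omega>" using f1[of t] f2[of t] R(5) Q(5) by (cases "t \<le> 1 / 2") auto
    qed
    show "f 0 = x" using f1[of 0] R(3) by simp
    show "f 1 = z" using f2[of 1] Q(4) by simp
  qed
  have int: "(\<lambda>t. norm (f' t)) integrable_on A" if "A = {a..b}" for A a b
    unfolding that by (intro integrable_continuous_real continuous_on_norm cf)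
  have poly: "((\<lambda>t. c * (12 * (2 * t - e) * (1 - (2 * t - e)))) has_integral
      c * (3 * (2 * b - e)\<^sup>2 - 2 * (2 * b - e) ^ 3) - c * (3 * (2 * a - e)\<^sup>2 - 2 * (2 * a - e) ^ 3)) {a..b}"
    if "a \<le> b" for a b c e :: real
  proof (rule fundamental_theorem_of_calculus[OF that])
    fix t :: real
    have "((\<lambda>t. c * (3 * (2 * t - e)\<^sup>2 - 2 * (2 * t - e) ^ 3)) has_real_derivative
       c * (3 * (2 * (2 * t - e) * 2) - 2 * (3 * (2 * t - e)\<^sup>2 * 2))) (at t within {a..b})"
      by (auto intro!: derivative_eq_intros)
    moreover have "3 * (2 * r * 2) - 2 * (3 * r\<^sup>2 * 2) = 12 * r * (1 - r)" for r :: real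
      by (simp add: power2_eq_square right_diff_distrib)
    ultimately show "((\<lambda>t. c * (3 * (2 * t - e)\<^sup>2 - 2 * (2 * t - e) ^ 3)) has_vector_derivative
       c * (12 * (2 * t - e) * (1 - (2 * t - e)))) (at t within {a..b})"
      by (simp only: has_real_derivative_iff_has_vector_derivative)
  qed
  have "integral {0..1/2} (\<lambda>t. norm (f' t)) \<le> l"
  proof -
    have "integral {0..1/2} (\<lambda>t. norm (f' t)) \<le> l * (3 * (2 * (1/2) - 0)\<^sup>2 - 2 * (2 * (1/2) - 0) ^ 3) - l * (3 * (2 * 0 - 0)\<^sup>2 - 2 * (2 * 0 - 0) ^ 3)"
    proof (rule has_integral_le[OF integrable_integral[OF int[OF refl]] poly])
      fix t :: real assume t: "t \<in> {0..1/2}"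
      then have "0 \<le> 6 * (2 * t) * (1 - 2 * t)" by simp
      then have "norm (\<zeta>' (2 * t)) \<le> l * (6 * (2 * t) * (1 - 2 * t))" using R(6)[of "2 * t"] by simp
      moreover have "f' t = 2 *\<^sub>R \<zeta>' (2 * t)" using zero(2)[of "2 * t - 1"] t by (simp add: f'_def)
      ultimately show "norm (f' t) \<le> l * (12 * (2 * t - 0) * (1 - (2 * t - 0)))" by simp
    qed simp
    then show ?thesis by simp
  qed
  moreover have "integral {1/2..1} (\<lambda>t. norm (f' t)) \<le> m"
  proof -
    have "integral {1/2..1} (\<lambda>t. norm (f' t)) \<le> m * (3 * (2 * 1 - 1)\<^sup>2 - 2 * (2 * 1 - 1) ^ 3) - m * (3 * (2 * (1/2) - 1)\<^sup>2 - 2 * (2 * (1/2) - 1) ^ 3)"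
    proof (rule has_integral_le[OF integrable_integral[OF int[OF refl]] poly])
      fix t :: real assume t: "t \<in> {1/2..1}"
      then have "0 \<le> 6 * (2 * t - 1) * (1 - (2 * t - 1))" by simp
      then have w: "norm (\<omega>' (2 * t - 1)) \<le> m * (6 * (2 * t - 1) * (1 - (2 * t - 1)))"
        using Q(6)[of "2 * t - 1"] by simp
      have "f' t = 2 *\<^sub>R \<omega>' (2 * t - 1)" using zero(1)[of "2 * t"] t by (simp add: f'_def)
      then have "norm (f' t) = 2 * norm (\<omega>' (2 * t - 1))" by simp
      also have "\<dots> \<le> 2 * (m * (6 * (2 * t - 1) * (1 - (2 * t - 1))))" using w by (rule mult_left_mono) simp
      also have "2 * (m * (6 * r * (1 - r))) = m * (12 * r * (1 - r))" for r by simp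
      finally show "norm (f' t) \<le> m * (12 * (2 * t - 1) * (1 - (2 * t - 1)))" .
    qed simp
    then show ?thesis by simp
  qed
  moreover have "integral {0..1/2} (\<lambda>t. norm (f' t)) + integral {1/2..1} (\<lambda>t. norm (f' t)) = integral {0..1} (\<lambda>t. norm (f' t))"
    by (intro Henstock_Kurzweil_Integration.integral_combine int) auto
  ultimately show "integral {0..1} (\<lambda>t. norm (f' t)) \<le> l + m" by linarith
qed

lemma geodist_triangle: "geodist \<Omega> x z \<le> geodist \<Omega> x y + geodist \<Omega> y z"
proof (rule ennreal_le_epsilon)
  fix e :: real assume e: "0 < e" and fin: "geodist \<Omega> x y + geodist \<Omega> y z < top"
  then obtain m n where m: "m \<ge> 0" "geodist \<Omega> x y = ennreal m" "n \<ge> 0" "geodist \<Omega> y z = ennreal n"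
    by (cases "geodist \<Omega> x y"; cases "geodist \<Omega> y z") auto
  have "geodist \<Omega> x y < ennreal (m + e / 2)" "geodist \<Omega> y z < ennreal (n + e / 2)"
    using e m by (simp_all add: ennreal_less_iff)
  then obtain \<zeta> \<zeta>' \<omega> \<omega>' where "resting_path (closure \<Omega>) x y (m + e / 2) \<zeta> \<zeta>'"
    "resting_path (closure \<Omega>) y z (n + e / 2) \<omega> \<omega>'"
    using resting_path_exists by meson
  then have "geodist \<Omega> x z \<le> ennreal (m + e / 2 + (n + e / 2))" by (rule resting_path_concat)
  also have "m + e / 2 + (n + e / 2) = m + n + e" by simp
  finally show "geodist \<Omega> x z \<le> geodist \<Omega> x y + geodist \<Omega> y z + ennreal e" using m e by (simp add: ennreal_plus)
qed

text \<open>Infinitely many curves are run through on the intervals between \<open>1 - 2 powr -k\<close> and \<open>1 - 2 powr -(k + 1)\<close>.  The lengths decay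
like \<open>4 powr -k\<close>, faster than the intervals shrink, so the series of derivatives converges uniformly and the
limit curve is \<open>C\<^sup>1\<close> up to its end point \<open>z\<close>.\<close>

lemma geodist_limit:
  assumes x: "\<And>k. geodist \<Omega> (x k) (x (Suc k)) < ennreal (\<kappa> * (1 / 4) ^ k)" and \<kappa>: "\<kappa> > 0"
    and lim: "x \<longlonglongrightarrow> z" and cl: "x 0 \<in> closure \<Omega>"
  shows "geodist \<Omega> (x 0) z \<le> ennreal (6 * \<kappa>)"
proof -
  have "\<exists>\<zeta> \<zeta>'. resting_path (closure \<Omega>) (x k) (x (Suc k)) (\<kappa> * (1 / 4) ^ k) \<zeta> \<zeta>'" for k
    using resting_path_exists[OF x[of k]] by blast
  then obtain \<zeta> \<zeta>' where R: "\<And>k. resting_path (closure \<Omega>) (x k) (x (Suc k)) (\<kappa> * (1 / 4) ^ k) (\<zeta> k) (\<zeta>' k)"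
    by metis
  note R = resting_pathD[OF R]
  define a :: "nat \<Rightarrow> real" where "a k = 1 - (1 / 2) ^ k" for k
  define w where "w k = (2::real) ^ Suc k" for k
  have w: "w k > 0" "w k * (1 / 2) ^ Suc k = 1" for k by (simp_all add: w_def power_one_over)
  define \<tau> where "\<tau> k t = w k * (t - a k)" for k t
  have \<tau>0: "\<tau> k t \<le> 0" if "t \<le> a k" for k t
    unfolding \<tau>_def using that w(1)[of k] by (intro mult_nonneg_nonpos) auto
  have \<tau>1: "\<tau> k t \<ge> 1" if "t \<ge> a (Suc k)" for k t
  proof -
    have "a (Suc k) - a k = (1 / 2) ^ Suc k" by (simp add: a_def)
    then have "w k * (1 / 2) ^ Suc k \<le> w k * (t - a k)" using that w(1)[of k] by (intro mult_left_mono) auto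
    then show ?thesis using w(2)[of k] by (simp add: \<tau>_def)
  qed
  define f where "f k t = \<zeta> k (\<tau> k t) - x k" for k t
  define f' where "f' k t = w k *\<^sub>R \<zeta>' k (\<tau> k t)" for k t
  have df: "(f k has_vector_derivative f' k t) (at t)" for k t
  proof -
    have "(\<tau> k has_vector_derivative w k) (at t)"
      unfolding \<tau>_def by (auto intro!: derivative_eq_intros)
    from vector_diff_chain_at[OF this R(1)]
    have "((\<lambda>t. \<zeta> k (\<tau> k t)) has_vector_derivative f' k t) (at t)" unfolding f'_def o_def .
    from has_vector_derivative_diff[OF this has_vector_derivative_const[of "x k"]]
    show ?thesis unfolding f_def by simp
  qed
  have cf': "continuous_on UNIV (f' k)" for k
  proof -
    have "continuous_on UNIV (\<lambda>t. \<zeta>' k (\<tau> k t))"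
      by (rule continuous_on_compose2[OF R(2)[of UNIV]], unfold \<tau>_def, intro continuous_intros, simp)
    then show ?thesis unfolding f'_def by (intro continuous_intros)
  qed
  have bf': "norm (f' k t) \<le> 3 * \<kappa> * (1 / 2) ^ k" for k t
  proof -
    have six: "6 * s * (1 - s) \<le> 3 / 2" for s :: real
      using zero_le_power2[of "2 * s - 1"] by (simp add: power2_eq_square algebra_simps)
    have "max 0 (6 * \<tau> k t * (1 - \<tau> k t)) \<le> 3 / 2" by (rule max.boundedI[OF _ six]) simp
    then have "\<kappa> * (1 / 4) ^ k * max 0 (6 * \<tau> k t * (1 - \<tau> k t)) \<le> \<kappa> * (1 / 4) ^ k * (3 / 2)"
      using \<kappa> by (intro mult_left_mono) auto
    then have "norm (\<zeta>' k (\<tau> k t)) \<le> \<kappa> * (1 / 4) ^ k * (3 / 2)" using R(6) order_trans by blast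
    then have "w k * norm (\<zeta>' k (\<tau> k t)) \<le> w k * (\<kappa> * (1 / 4) ^ k * (3 / 2))"
      using w(1)[of k] by (intro mult_left_mono) auto
    also have "\<dots> = 3 * \<kappa> * (2 ^ k * (1 / 4) ^ k)" by (simp add: w_def)
    also have "(2::real) ^ k * (1 / 4) ^ k = (1 / 2) ^ k" by (simp flip: power_mult_distrib)
    finally show ?thesis using w(1)[of k] by (simp add: f'_def)
  qed
  define G where "G t = (\<Sum>k. f' k t)" for t
  have sm: "summable (\<lambda>k. 3 * \<kappa> * (1 / 2) ^ k :: real)" by (intro summable_mult summable_geometric) simp
  have ul: "uniform_limit UNIV (\<lambda>n t. \<Sum>k<n. f' k t) G sequentially"
    unfolding G_def by (rule Weierstrass_m_test[OF bf' sm])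
  have cG: "continuous_on UNIV G"
    by (rule uniform_limit_theorem[OF _ ul]) (auto intro!: always_eventually continuous_on_sum cf')
  have bG: "norm (G t) \<le> 6 * \<kappa>" for t
  proof -
    have "norm (G t) \<le> (\<Sum>k. 3 * \<kappa> * (1 / 2) ^ k)"
      unfolding G_def by (rule norm_suminf_le[OF bf' sm])
    also have "\<dots> = 3 * \<kappa> * (1 / (1 - 1 / 2))" by (subst suminf_mult) (auto simp: suminf_geometric)
    finally show ?thesis by simp
  qed
  have f0: "f k 0 = 0" for k
    using \<tau>0[of 0 k] R(3)[of "\<tau> k 0" k] by (simp add: f_def a_def power_le_one)
  have "\<exists>g. \<forall>t\<in>UNIV. (\<lambda>n. f n t) sums g t \<and> (g has_derivative (\<lambda>h. h *\<^sub>R G t)) (at t within UNIV)"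
  proof (rule has_derivative_series[where f' = "\<lambda>n t h. h *\<^sub>R f' n t" and x = 0 and l = 0])
    show "(f n has_derivative (\<lambda>h. h *\<^sub>R f' n t)) (at t within UNIV)" for n t
      using df[of n t] by (simp add: has_vector_derivative_def)
    fix e :: real assume e: "e > 0"
    from uniform_limitD[OF ul e]
    show "\<forall>\<^sub>F n in sequentially. \<forall>t\<in>UNIV. \<forall>h. norm ((\<Sum>i<n. h *\<^sub>R f' i t) - h *\<^sub>R G t) \<le> e * norm h"
    proof eventually_elim
      case (elim n)
      show ?case
      proof (intro ballI allI)
        fix t h :: real
        have "norm ((\<Sum>i<n. h *\<^sub>R f' i t) - h *\<^sub>R G t) = \<bar>h\<bar> * norm ((\<Sum>i<n. f' i t) - G t)"
          by (simp flip: scaleR_sum_right scaleR_diff_right)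
        also have "\<dots> \<le> \<bar>h\<bar> * e" using elim[rule_format, of t] by (intro mult_left_mono) (auto simp: dist_norm)
        finally show "norm ((\<Sum>i<n. h *\<^sub>R f' i t) - h *\<^sub>R G t) \<le> e * norm h" by (simp add: mult.commute)
      qed
    qed
  qed (auto simp: f0)
  then obtain g where g: "\<And>t. (\<lambda>n. f n t) sums g t" "\<And>t. (g has_vector_derivative G t) (at t)"
    unfolding has_vector_derivative_def by auto
  have part: "x 0 + (\<Sum>k<n. f k t) \<in> closure \<Omega> \<and> (a n \<le> t \<longrightarrow> x 0 + (\<Sum>k<n. f k t) = x n)" for n t
  proof (induction n)
    case (Suc n)
    have an: "a n < a (Suc n)" by (simp add: a_def)
    show ?case
    proof (cases "t \<le> a n")
      case True
      then have "f n t = 0" using \<tau>0[of t n] R(3) by (simp add: f_def)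
      moreover have "x 0 + (\<Sum>k<Suc n. f k t) = x (Suc n)" if "a (Suc n) \<le> t"
        using that True an by linarith
      ultimately show ?thesis using Suc by simp
    next
      case False
      then have "x 0 + (\<Sum>k<n. f k t) = x n" using Suc by simp
      then have eq: "x 0 + (\<Sum>k<Suc n. f k t) = \<zeta> n (\<tau> n t)" by (simp add: f_def algebra_simps)
      then show ?thesis using R(5)[of n "\<tau> n t"] R(4)[of "\<tau> n t" n] \<tau>1[of n t] by metis
    qed
  qed (use cl in simp)
  have g0: "g 0 = 0" using g(1)[of 0] f0 sums_unique2[of "\<lambda>n. f n 0" "g 0" 0] by simp
  have g1: "g 1 = z - x 0"
  proof -
    have "f k 1 = x (Suc k) - x k" for k using \<tau>1[of k 1] R(4)[of "\<tau> k 1" k] by (simp add: f_def a_def)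
    then have "(\<lambda>n. x (Suc n) - x n) sums g 1" using g(1)[of 1] by simp
    moreover have "(\<lambda>n. x (Suc n) - x n) sums (z - x 0)" by (rule telescope_sums[OF lim])
    ultimately show ?thesis by (rule sums_unique2)
  qed
  show ?thesis
  proof (rule geodist_le)
    show "C1_path_in (closure \<Omega>) (x 0) z (\<lambda>t. x 0 + g t) G"
      unfolding C1_path_in_def
    proof (intro conjI ballI)
      fix t :: real
      show "((\<lambda>t. x 0 + g t) has_vector_derivative G t) (at t within {0..1})"
        using has_vector_derivative_add[OF has_vector_derivative_const[of "x 0"] has_vector_derivative_at_within[OF g(2)]]
        by simp
    next
      show "continuous_on {0..1} G" using cG by (rule continuous_on_subset) simp
      show "(\<lambda>t. x 0 + g t) ` {0..1} \<subseteq> closure \<Omega>"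
      proof
        fix y assume "y \<in> (\<lambda>t. x 0 + g t) ` {0..1}"
        then obtain t where y: "y = x 0 + g t" by blast
        have "(\<lambda>n. x 0 + (\<Sum>k<n. f k t)) \<longlonglongrightarrow> y"
          unfolding y using g(1)[of t] by (intro tendsto_intros) (simp add: sums_def)
        moreover have "x 0 + (\<Sum>k<n. f k t) \<in> closure \<Omega>" for n using part by blast
        ultimately show "y \<in> closure \<Omega>" by (metis (no_types, lifting) closed_sequentially closed_closure)
      qed
    qed (use g0 g1 in auto)
    have "norm (integral {0..1} (\<lambda>t. norm (G t))) \<le> integral {0..1} (\<lambda>t::real. 6 * \<kappa>)"
    proof (rule integral_norm_bound_integral)
      show "(\<lambda>t. norm (G t)) integrable_on {0..1}"
        by (intro integrable_continuous_real continuous_on_norm continuous_on_subset[OF cG]) simp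
      show "norm (norm (G t)) \<le> 6 * \<kappa>" for t using bG[of t] by simp
    qed (rule integrable_const_ivl)
    then show "integral {0..1} (\<lambda>t. norm (G t)) \<le> 6 * \<kappa>" by simp
  qed
qed

lemma domain_local:
  assumes "domain_assumption \<Omega> \<phi> r"
  obtains r1 where "r1 > 0" "\<And>x y. x \<in> \<Omega> \<Longrightarrow> y \<in> \<Omega> \<Longrightarrow> norm (x - y) \<le> r1 \<Longrightarrow> geodist \<Omega> x y \<le> ennreal (2 * norm (x - y))"
proof -
  note A = assms[unfolded domain_assumption_def]
  have "\<forall>\<^sub>F h in at_right 0. \<phi> h / h < 1" using A by (intro order_tendstoD(2)[of _ 0]) auto
  then obtain b where b: "b > 0" "\<And>h. 0 < h \<Longrightarrow> h < b \<Longrightarrow> \<phi> h / h < 1"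
    by (auto simp: eventually_at_right_field)
  \<comment> \<open>Half of \<open>b\<close>, since the bound on the quotient holds strictly below \<open>b\<close> only.\<close>
  define r1 where "r1 = min r (b / 2)"
  have r1: "r1 > 0" "r1 \<le> r" "r1 < b" using A b by (auto simp: r1_def)
  show ?thesis
  proof (rule that[OF r1(1)])
    fix x y assume xy: "x \<in> \<Omega>" "y \<in> \<Omega>" "norm (x - y) \<le> r1"
    show "geodist \<Omega> x y \<le> ennreal (2 * norm (x - y))"
    proof (cases "x = y")
      case True
      then show ?thesis using geodist_refl[of x \<Omega>] xy closure_subset by auto
    next
      case False
      then have "\<phi> (norm (x - y)) / norm (x - y) < 1" using b(2)[of "norm (x - y)"] xy r1 by simp
      then have "\<phi> (norm (x - y)) \<le> norm (x - y)" using False by simp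
      then have "ennreal (norm (x - y) + \<phi> (norm (x - y))) \<le> ennreal (2 * norm (x - y))" by (intro ennreal_leI) simp
      moreover have "geodist \<Omega> x y \<le> ennreal (norm (x - y) + \<phi> (norm (x - y)))" using A xy r1 by auto
      ultimately show ?thesis by (rule order_trans[rotated])
    qed
  qed
qed

text \<open>The domain assumption speaks about points of \<open>\<Omega>\<close> only; boundary points are reached as limits of points of \<open>\<Omega>\<close> that
approach them geometrically.\<close>

lemma geodist_to_boundary:
  assumes loc: "\<And>x y. x \<in> \<Omega> \<Longrightarrow> y \<in> \<Omega> \<Longrightarrow> norm (x - y) \<le> r \<Longrightarrow> geodist \<Omega> x y \<le> ennreal (2 * norm (x - y))"
    and x: "x \<in> closure \<Omega>" and c: "0 < c" "c \<le> r / 2"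
  shows "\<exists>z\<in>\<Omega>. norm (z - x) \<le> c \<and> geodist \<Omega> z x \<le> ennreal (30 * c)"
proof -
  have "\<exists>z\<in>\<Omega>. norm (z - x) < c * (1 / 4) ^ k" for k :: nat
    using x c(1) unfolding closure_approachable by (simp add: dist_norm)
  then obtain X where X: "\<And>k. X k \<in> \<Omega>" "\<And>k. norm (X k - x) < c * (1 / 4) ^ k" by metis
  have "geodist \<Omega> (X k) (X (Suc k)) < ennreal (5 * c * (1 / 4) ^ k)" for k
  proof -
    have "norm (X k - X (Suc k)) \<le> norm (X k - x) + norm (x - X (Suc k))" by (rule norm_diff_triangle_le) auto
    also have "\<dots> \<le> c * (1 / 4) ^ k + c * (1 / 4) ^ Suc k" using X(2)[of k] X(2)[of "Suc k"] by (simp add: norm_minus_commute)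
    also have "\<dots> \<le> 2 * (c * (1 / 4) ^ k)" using c(1) by simp
    finally have n: "norm (X k - X (Suc k)) \<le> 2 * (c * (1 / 4) ^ k)" .
    have "c * (1 / 4) ^ k \<le> c * 1" using c(1) by (intro mult_left_mono power_le_one) auto
    then have "norm (X k - X (Suc k)) \<le> r" using n c(2) by simp
    then have "geodist \<Omega> (X k) (X (Suc k)) \<le> ennreal (2 * norm (X k - X (Suc k)))" by (intro loc X)
    also have "\<dots> < ennreal (5 * c * (1 / 4) ^ k)"
    proof (rule ennreal_lessI)
      have pos: "c * (1 / 4) ^ k > 0" using c(1) by simp
      then show "0 < 5 * c * (1 / 4) ^ k" by simp
      have "2 * norm (X k - X (Suc k)) \<le> 2 * (2 * (c * (1 / 4) ^ k))" using n by simp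
      also have "\<dots> < 5 * (c * (1 / 4) ^ k)" using pos by linarith
      finally show "2 * norm (X k - X (Suc k)) < 5 * c * (1 / 4) ^ k" by (simp only: mult.assoc)
    qed
    finally show ?thesis .
  qed
  moreover have "X \<longlonglongrightarrow> x"
  proof (rule LIM_zero_cancel, rule Lim_null_comparison)
    show "\<forall>\<^sub>F k in sequentially. norm (X k - x) \<le> c * (1 / 4) ^ k" using X(2) by (simp add: less_imp_le)
    have "(\<lambda>k. c * (1 / 4) ^ k) \<longlonglongrightarrow> c * 0" by (intro tendsto_intros LIMSEQ_realpow_zero) auto
    then show "(\<lambda>k. c * (1 / 4) ^ k) \<longlonglongrightarrow> 0" by simp
  qed
  ultimately have "geodist \<Omega> (X 0) x \<le> ennreal (6 * (5 * c))"
    using c(1) X(1) closure_subset by (intro geodist_limit) auto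
  then show ?thesis using X(1)[of 0] X(2)[of 0] by (intro bexI[of _ "X 0"]) auto
qed

lemma geodist_local:
  assumes loc: "\<And>x y. x \<in> \<Omega> \<Longrightarrow> y \<in> \<Omega> \<Longrightarrow> norm (x - y) \<le> r \<Longrightarrow> geodist \<Omega> x y \<le> ennreal (2 * norm (x - y))"
    and x: "x \<in> closure \<Omega>" "y \<in> closure \<Omega>" "norm (x - y) < r"
  shows "geodist \<Omega> x y \<le> ennreal (2 * norm (x - y))"
proof (rule ennreal_le_epsilon)
  fix e :: real assume e: "0 < e"
  define c where "c = min (e / 64) ((r - norm (x - y)) / 2)"
  have "c \<le> e / 64" "c \<le> (r - norm (x - y)) / 2" unfolding c_def by (rule min.cobounded1, rule min.cobounded2)
  then have c: "c > 0" "64 * c \<le> e" "2 * c \<le> r - norm (x - y)" using e x(3) by (auto simp: c_def)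
  have cr: "c \<le> r / 2" using c norm_ge_zero[of "x - y"] by linarith
  obtain p where p: "p \<in> \<Omega>" "norm (p - x) \<le> c" "geodist \<Omega> p x \<le> ennreal (30 * c)"
    using geodist_to_boundary[OF loc x(1) c(1) cr] by blast
  obtain q where q: "q \<in> \<Omega>" "norm (q - y) \<le> c" "geodist \<Omega> q y \<le> ennreal (30 * c)"
    using geodist_to_boundary[OF loc x(2) c(1) cr] by blast
  have n: "norm (p - q) \<le> norm (x - y) + 2 * c"
    using norm_diff_triangle_ineq[of p "- x" q "- y"] norm_triangle_ineq[of "p - x" "x - y"]
      norm_triangle_ineq[of "p - y" "y - q"] p(2) q(2) by (simp add: norm_minus_commute)
  have "geodist \<Omega> x y \<le> geodist \<Omega> x p + (geodist \<Omega> p q + geodist \<Omega> q y)"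
    by (intro order_trans[OF geodist_triangle[of \<Omega> x y p]] add_left_mono geodist_triangle)
  also have "\<dots> \<le> ennreal (30 * c) + (ennreal (2 * (norm (x - y) + 2 * c)) + ennreal (30 * c))"
  proof (intro add_mono)
    show "geodist \<Omega> x p \<le> ennreal (30 * c)" using p(3) by (simp add: geodist_sym)
    have "geodist \<Omega> p q \<le> ennreal (2 * norm (p - q))" using n c by (intro loc p q) simp
    also have "\<dots> \<le> ennreal (2 * (norm (x - y) + 2 * c))" using n by (intro ennreal_leI) simp
    finally show "geodist \<Omega> p q \<le> ennreal (2 * (norm (x - y) + 2 * c))" .
  qed (rule q)
  also have "\<dots> = ennreal (30 * c + (2 * (norm (x - y) + 2 * c) + 30 * c))"
  proof -
    have add3: "ennreal a + (ennreal b + ennreal d) = ennreal (a + (b + d))" if "0 \<le> a" "0 \<le> b" "0 \<le> d" for a b d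
      using that by (simp add: ennreal_plus)
    show ?thesis by (rule add3) (use c(1) in auto)
  qed
  also have "\<dots> \<le> ennreal (2 * norm (x - y) + e)" using c(2) by (intro ennreal_leI) simp
  also have "\<dots> = ennreal (2 * norm (x - y)) + ennreal e" using e by (simp add: ennreal_plus)
  finally show "geodist \<Omega> x y \<le> ennreal (2 * norm (x - y)) + ennreal e" .
qed

text \<open>Being at finite distance is an equivalence relation with open classes, and the closure of \<open>\<Omega>\<close> is connected.\<close>

lemma geodist_finite:
  assumes loc: "\<And>x y. x \<in> closure \<Omega> \<Longrightarrow> y \<in> closure \<Omega> \<Longrightarrow> norm (x - y) < r \<Longrightarrow> geodist \<Omega> x y \<le> ennreal (2 * norm (x - y))"
    and r: "r > 0" and con: "connected \<Omega>" and xy: "x \<in> closure \<Omega>" "y \<in> closure \<Omega>"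
  shows "geodist \<Omega> x y < top"
proof (rule connected_equivalence_relation[OF connected_imp_connected_closure[OF con] xy, where R = "\<lambda>x y. geodist \<Omega> x y < top"])
  show "geodist \<Omega> b a < top" if "geodist \<Omega> a b < top" for a b using that by (simp add: geodist_sym)
  show "geodist \<Omega> a c < top" if "geodist \<Omega> a b < top" "geodist \<Omega> b c < top" for a b c
    using geodist_triangle[of \<Omega> a c b] that by (meson ennreal_add_less_top order_le_less_trans)
  fix a assume a: "a \<in> closure \<Omega>"
  show "\<exists>T. openin (top_of_set (closure \<Omega>)) T \<and> a \<in> T \<and> (\<forall>x\<in>T. geodist \<Omega> a x < top)"
  proof (intro exI[of _ "closure \<Omega> \<inter> ball a r"] conjI ballI)
    fix z assume "z \<in> closure \<Omega> \<inter> ball a r"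
    then have "geodist \<Omega> a z \<le> ennreal (2 * norm (a - z))" using a by (intro loc) (auto simp: dist_norm)
    then show "geodist \<Omega> a z < top" using ennreal_less_top order_le_less_trans by blast
  qed (use a r in \<open>auto intro: openin_open_Int\<close>)
qed

section \<open>Geodesic spaces, absolutely minimizing functions and min-balls\<close>

text \<open>A compact set with a metric that is comparable to the Euclidean one and in which all points are joined by geodesics,
parametrized by arc length.  Topological notions refer to the Euclidean topology, which \<open>d\<close> induces as well.\<close>

locale geodesic_space =
  fixes M :: "'a::euclidean_space set" and d :: "'a \<Rightarrow> 'a \<Rightarrow> real" and A :: real
  assumes compact_M: "compact M" and A_ge_1: "A \<ge> 1"
    and norm_le_d: "\<And>x y. x \<in> M \<Longrightarrow> y \<in> M \<Longrightarrow> norm (x - y) \<le> d x y"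
    and d_le_norm: "\<And>x y. x \<in> M \<Longrightarrow> y \<in> M \<Longrightarrow> d x y \<le> A * norm (x - y)"
    and d_sym: "\<And>x y. x \<in> M \<Longrightarrow> y \<in> M \<Longrightarrow> d x y = d y x"
    and d_triangle: "\<And>x y z. x \<in> M \<Longrightarrow> y \<in> M \<Longrightarrow> z \<in> M \<Longrightarrow> d x z \<le> d x y + d y z"
    and geodesic: "\<And>x y. x \<in> M \<Longrightarrow> y \<in> M \<Longrightarrow> \<exists>\<gamma>. \<gamma> 0 = x \<and> \<gamma> (d x y) = y \<and>
      (\<forall>s\<in>{0..d x y}. \<gamma> s \<in> M) \<and>
      (\<forall>s\<in>{0..d x y}. \<forall>t\<in>{0..d x y}. d (\<gamma> s) (\<gamma> t) = \<bar>s - t\<bar>)"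
begin

definition is_geodesic :: "real \<Rightarrow> (real \<Rightarrow> 'a) \<Rightarrow> bool" where
  "is_geodesic D \<gamma> \<longleftrightarrow> (\<forall>s\<in>{0..D}. \<gamma> s \<in> M) \<and>
     (\<forall>s\<in>{0..D}. \<forall>t\<in>{0..D}. d (\<gamma> s) (\<gamma> t) = \<bar>s - t\<bar>)"

lemma d_refl: "x \<in> M \<Longrightarrow> d x x = 0"
  using norm_le_d[of x x] d_le_norm[of x x] by simp

lemma d_nonneg: "x \<in> M \<Longrightarrow> y \<in> M \<Longrightarrow> d x y \<ge> 0"
  using norm_le_d[of x y] norm_ge_zero[of "x - y"] by linarith

lemma d_eq_0: "x \<in> M \<Longrightarrow> y \<in> M \<Longrightarrow> d x y = 0 \<Longrightarrow> x = y"
  using norm_le_d[of x y] by simp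

lemma obtain_geodesic:
  assumes "x \<in> M" "y \<in> M"
  obtains \<gamma> where "is_geodesic (d x y) \<gamma>" "\<gamma> 0 = x" "\<gamma> (d x y) = y"
  using geodesic[OF assms] that unfolding is_geodesic_def by blast

lemma geodesic_in: "is_geodesic D \<gamma> \<Longrightarrow> 0 \<le> s \<Longrightarrow> s \<le> D \<Longrightarrow> \<gamma> s \<in> M"
  by (simp add: is_geodesic_def)

lemma geodesic_d: "is_geodesic D \<gamma> \<Longrightarrow> 0 \<le> s \<Longrightarrow> s \<le> D \<Longrightarrow> 0 \<le> t \<Longrightarrow> t \<le> D \<Longrightarrow> d (\<gamma> s) (\<gamma> t) = \<bar>s - t\<bar>"
  by (simp add: is_geodesic_def)

lemma geodesic_norm:
  assumes "is_geodesic D \<gamma>" "0 \<le> s" "s \<le> D" "0 \<le> t" "t \<le> D"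
  shows "norm (\<gamma> s - \<gamma> t) \<le> \<bar>s - t\<bar>"
  using norm_le_d[OF geodesic_in geodesic_in] geodesic_d assms by metis

lemma geodesic_continuous: "is_geodesic D \<gamma> \<Longrightarrow> continuous_on {0..D} \<gamma>"
proof (rule continuous_onI)
  fix s e :: real assume g: "is_geodesic D \<gamma>" and s: "s \<in> {0..D}" and e: "e > 0"
  show "\<exists>r>0. \<forall>t\<in>{0..D}. dist t s < r \<longrightarrow> dist (\<gamma> t) (\<gamma> s) \<le> e"
  proof (intro exI[of _ e] conjI ballI impI e)
    fix t assume "t \<in> {0..D}" "dist t s < e"
    then show "dist (\<gamma> t) (\<gamma> s) \<le> e" using geodesic_norm[OF g, of t s] s by (simp add: dist_norm)
  qed
qed

lemma intermediate_point:
  assumes x: "x \<in> M" "y \<in> M" and r: "0 \<le> r" "0 \<le> s" "d x y \<le> r + s"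
  obtains z where "z \<in> M" "d x z \<le> r" "d z y \<le> s"
proof -
  obtain \<gamma> where g: "is_geodesic (d x y) \<gamma>" "\<gamma> 0 = x" "\<gamma> (d x y) = y" using obtain_geodesic[OF x] .
  define t where "t = min r (d x y)"
  have t: "0 \<le> t" "t \<le> d x y" using r d_nonneg[OF x] by (auto simp: t_def)
  have "d x (\<gamma> t) = t" using geodesic_d[OF g(1), of 0 t] t g(2) d_nonneg[OF x] by simp
  moreover have "d (\<gamma> t) y = d x y - t" using geodesic_d[OF g(1), of t "d x y"] t g(3) by simp
  ultimately show ?thesis using that[of "\<gamma> t"] geodesic_in[OF g(1) t] r by (auto simp: t_def)
qed

lemma d_continuous: "x \<in> M \<Longrightarrow> continuous_on M (d x)"
proof (rule continuous_onI)
  fix y and e :: real assume x: "x \<in> M" and y: "y \<in> M" and e: "e > 0"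
  show "\<exists>r>0. \<forall>z\<in>M. dist z y < r \<longrightarrow> dist (d x z) (d x y) \<le> e"
  proof (intro exI[of _ "e / A"] conjI ballI impI)
    show "e / A > 0" using e A_ge_1 by simp
    fix z assume z: "z \<in> M" "dist z y < e / A"
    have "d z y \<le> A * norm (z - y)" using d_le_norm z y by blast
    also have "\<dots> \<le> e" using z A_ge_1 by (simp add: dist_norm field_simps)
    finally show "dist (d x z) (d x y) \<le> e"
      using d_triangle[OF x y z(1)] d_triangle[OF x z(1) y] d_sym[OF y z(1)] by (simp add: dist_real_def)
  qed
qed

definition geo_ball :: "'a \<Rightarrow> real \<Rightarrow> 'a set" where "geo_ball x r = {y \<in> M. d x y \<le> r}"

lemma compact_geo_ball: "x \<in> M \<Longrightarrow> compact (geo_ball x r)"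
proof -
  assume x: "x \<in> M"
  have "closedin (top_of_set M) (M \<inter> d x -` {..r})"
    by (intro continuous_closedin_preimage d_continuous x) auto
  moreover have "M \<inter> d x -` {..r} = geo_ball x r" by (auto simp: geo_ball_def)
  ultimately show ?thesis using compact_M by (metis closedin_compact)
qed

lemma geo_ball_self: "x \<in> M \<Longrightarrow> r \<ge> 0 \<Longrightarrow> x \<in> geo_ball x r" by (simp add: geo_ball_def d_refl)

lemma continuous_bounded:
  fixes u :: "'a \<Rightarrow> real"
  assumes "continuous_on M u" obtains Q where "\<And>x. x \<in> M \<Longrightarrow> \<bar>u x\<bar> \<le> Q"
  using compact_imp_bounded[OF compact_continuous_image[OF assms compact_M]]
  by (auto simp: bounded_iff)

lemma min_on_geo_ball:
  assumes "continuous_on M u" "x \<in> M" "r \<ge> 0"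
  obtains y where "y \<in> geo_ball x r" "\<And>z. z \<in> geo_ball x r \<Longrightarrow> u y \<le> (u z::real)"
proof -
  have "continuous_on (geo_ball x r) u" using assms(1) by (rule continuous_on_subset) (auto simp: geo_ball_def)
  then show ?thesis
    using continuous_attains_inf[OF compact_geo_ball[OF assms(2)], of r u] geo_ball_self[OF assms(2,3)] that by blast
qed

text \<open>The hypothesis \<open>exc\<close> is what is known at distance \<open>h\<close>: a curve that leaves the ball of radius \<open>h\<close> around its starting
point \<open>p\<close> passes a point whose geodesic distance from \<open>p\<close> exceeds \<open>h\<close> by at most \<open>F\<close> and whose Euclidean distance
from \<open>p\<close> is about \<open>h\<close>.  Applied to a geodesic this gives an arc of excess about \<open>F\<close> that contains the given half arc, and the
excess of an arc (its length minus its chord) bounds the excess of its subarcs.  The arc is sought forwards or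
backwards along \<open>\<gamma>\<close>; one of the two works because the end points of \<open>\<gamma>\<close> are at distance at least \<open>3 h\<close>.\<close>

lemma half_arc_excess:
  assumes g: "is_geodesic D \<gamma>" and D: "3 * h \<le> norm (\<gamma> 0 - \<gamma> D)" and h: "h > 0" and F: "F > 0"
    and exc: "\<And>p c a b \<kappa>. continuous_on {a..b} c \<Longrightarrow> c ` {a..b} \<subseteq> M \<Longrightarrow> a \<le> b \<Longrightarrow> c a = p \<Longrightarrow>
       h < norm (c b - p) \<Longrightarrow> \<kappa> > 0 \<Longrightarrow> \<exists>t\<in>{a..b::real}. d p (c t) \<le> h + F + \<kappa> \<and> h - \<kappa> \<le> norm (c t - p)"
    and s: "0 \<le> s" "s + h / 2 \<le> D"
  shows "h / 2 - norm (\<gamma> s - \<gamma> (s + h / 2)) \<le> 2 * F"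
proof -
  define \<kappa> where "\<kappa> = min (F / 2) (h / 2)"
  have \<kappa>: "\<kappa> > 0" "2 * \<kappa> \<le> F" "\<kappa> \<le> h / 2" using F h by (auto simp: \<kappa>_def)
  let ?s = "s + h / 2"
  show ?thesis
  proof (cases "h < norm (\<gamma> D - \<gamma> s)")
    case True
    have "\<exists>t\<in>{s..D}. d (\<gamma> s) (\<gamma> t) \<le> h + F + \<kappa> \<and> h - \<kappa> \<le> norm (\<gamma> t - \<gamma> s)"
    proof (rule exc)
      show "continuous_on {s..D} \<gamma>" using geodesic_continuous[OF g] s by (rule_tac continuous_on_subset) auto
      show "\<gamma> ` {s..D} \<subseteq> M" using geodesic_in[OF g] s by auto
    qed (use True s h \<kappa> in auto)
    then obtain t where t: "t \<in> {s..D}" "d (\<gamma> s) (\<gamma> t) \<le> h + F + \<kappa>" "h - \<kappa> \<le> norm (\<gamma> t - \<gamma> s)" by blast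
    have dt: "d (\<gamma> s) (\<gamma> t) = t - s" using geodesic_d[OF g, of s t] t s by simp
    have n1: "norm (\<gamma> t - \<gamma> s) \<le> t - s" using geodesic_norm[OF g, of t s] t s by simp
    then have n2: "norm (\<gamma> t - \<gamma> ?s) \<le> t - ?s" using geodesic_norm[OF g, of t ?s] t s h \<kappa> by simp
    have "norm (\<gamma> t - \<gamma> s) \<le> norm (\<gamma> t - \<gamma> ?s) + norm (\<gamma> s - \<gamma> ?s)"
      by (metis norm_triangle_sub norm_minus_commute norm_triangle_le_diff add.commute norm_diff_triangle_le order_refl)
    then show ?thesis using t(2,3) dt n2 \<kappa> by linarith
  next
    case False
    have "norm (\<gamma> 0 - \<gamma> D) \<le> norm (\<gamma> 0 - \<gamma> ?s) + norm (\<gamma> ?s - \<gamma> s) + norm (\<gamma> s - \<gamma> D)"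
      by (smt (verit) norm_diff_triangle_ineq norm_diff_triangle_le)
    moreover have "norm (\<gamma> ?s - \<gamma> s) \<le> h / 2" using geodesic_norm[OF g, of ?s s] s h by simp
    ultimately have far: "h < norm (\<gamma> 0 - \<gamma> ?s)" using False D h by (simp add: norm_minus_commute)
    let ?c = "\<lambda>t. \<gamma> (?s - t)"
    have "\<exists>t\<in>{0..?s}. d (\<gamma> ?s) (?c t) \<le> h + F + \<kappa> \<and> h - \<kappa> \<le> norm (?c t - \<gamma> ?s)"
    proof (rule exc)
      have "continuous_on {0..?s} (\<gamma> \<circ> (\<lambda>t. ?s - t))"
        by (intro continuous_on_compose continuous_intros continuous_on_subset[OF geodesic_continuous[OF g]])
           (use s in auto)
      then show "continuous_on {0..?s} ?c" by (simp add: o_def)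
      show "?c ` {0..?s} \<subseteq> M" using geodesic_in[OF g] s by auto
    qed (use far s h \<kappa> in auto)
    then obtain t where t: "t \<in> {0..?s}" "d (\<gamma> ?s) (?c t) \<le> h + F + \<kappa>" "h - \<kappa> \<le> norm (?c t - \<gamma> ?s)" by blast
    have dt: "d (\<gamma> ?s) (?c t) = t" using geodesic_d[OF g, of ?s "?s - t"] t s h by simp
    have n1: "norm (?c t - \<gamma> ?s) \<le> t" using geodesic_norm[OF g, of "?s - t" ?s] t s h by simp
    then have n2: "norm (?c t - \<gamma> s) \<le> t - h / 2" using geodesic_norm[OF g, of "?s - t" s] t s h \<kappa> by simp
    have "norm (?c t - \<gamma> ?s) \<le> norm (?c t - \<gamma> s) + norm (\<gamma> s - \<gamma> ?s)"
      by (rule norm_diff_triangle_le) auto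
    then show ?thesis using t(2,3) dt n2 \<kappa> by linarith
  qed
qed

text \<open>Cut the geodesic into \<open>m\<close> arcs of equal length \<open>a \<le> h/4\<close> with chords \<open>v i\<close>, where \<open>m\<close> is bounded in terms of \<open>A\<close>.
Two consecutive arcs form an arc of length at most \<open>h/2\<close>, so \<open>norm (v i + v (Suc i)) \<ge> 2 a - 2 F\<close>.  Since
\<open>norm (v i) \<le> a\<close>, the parallelogram law bounds \<open>norm (v (Suc i) - v i)\<close> by \<open>sqrt (8 a F)\<close>.
Hence all chords are close to \<open>v 0\<close>, and \<open>v i \<bullet> v 0 \<ge> a\<^sup>2 - O(a F)\<close>; summing over \<open>i\<close> yields the bound.\<close>

lemma geodesic_excess:
  assumes x: "x \<in> M" "y \<in> M" and n: "3 * h \<le> norm (x - y)" "norm (x - y) \<le> 4 * h" and h: "h > 0" and F: "F > 0"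
    and exc: "\<And>p c a b \<kappa>. continuous_on {a..b} c \<Longrightarrow> c ` {a..b} \<subseteq> M \<Longrightarrow> a \<le> b \<Longrightarrow> c a = p \<Longrightarrow>
       h < norm (c b - p) \<Longrightarrow> \<kappa> > 0 \<Longrightarrow> \<exists>t\<in>{a..b::real}. d p (c t) \<le> h + F + \<kappa> \<and> h - \<kappa> \<le> norm (c t - p)"
  shows "d x y \<le> norm (x - y) + (16 * A + 1) * (4 + 4 * (16 * A + 1)\<^sup>2) * F"
proof -
  define D where "D = d x y"
  obtain \<gamma> where g: "is_geodesic D \<gamma>" "\<gamma> 0 = x" "\<gamma> D = y" using obtain_geodesic[OF x] unfolding D_def .
  have D: "3 * h \<le> D" "D \<le> 4 * A * h"
  proof -
    show "3 * h \<le> D" using norm_le_d[OF x] n by (simp add: D_def)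
    have "A * norm (x - y) \<le> A * (4 * h)" using n(2) A_ge_1 by (intro mult_left_mono) auto
    then show "D \<le> 4 * A * h" using d_le_norm[OF x] by (simp add: D_def)
  qed
  have arc: "(t - s) - norm (\<gamma> s - \<gamma> t) \<le> 2 * F" if st: "0 \<le> s" "s \<le> t" "t \<le> D" "t - s \<le> h / 2" for s t
  proof -
    define r where "r = min s (D - h / 2)"
    have r: "0 \<le> r" "r \<le> s" "t \<le> r + h / 2" "r + h / 2 \<le> D" using st D h by (auto simp: r_def)
    have "norm (\<gamma> r - \<gamma> (r + h / 2)) \<le> norm (\<gamma> r - \<gamma> s) + norm (\<gamma> s - \<gamma> t) + norm (\<gamma> t - \<gamma> (r + h / 2))"
      by (smt (verit) norm_diff_triangle_ineq norm_diff_triangle_le)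
    moreover have "norm (\<gamma> r - \<gamma> s) \<le> s - r" using geodesic_norm[OF g(1), of r s] r st by simp
    moreover have "norm (\<gamma> t - \<gamma> (r + h / 2)) \<le> r + h / 2 - t"
      using geodesic_norm[OF g(1), of t "r + h / 2"] r st by simp
    moreover have "h / 2 - norm (\<gamma> r - \<gamma> (r + h / 2)) \<le> 2 * F"
      by (rule half_arc_excess[OF g(1) _ h F exc r(1,4)]) (use g n in auto)
    ultimately show ?thesis by linarith
  qed
  define m where "m = nat \<lceil>4 * D / h\<rceil>"
  have m_ge: "real m \<ge> 4 * D / h" unfolding m_def by (rule real_nat_ceiling_ge)
  have mpos: "real m > 0" using m_ge D h by (smt (verit) divide_pos_pos)
  have m_le: "real m \<le> 16 * A + 1"
  proof -
    have "real m \<le> 4 * D / h + 1" unfolding m_def using D h A_ge_1 by (simp add: of_nat_nat)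
    also have "4 * D / h \<le> 16 * A" using D h by (simp add: field_simps)
    finally show ?thesis by simp
  qed
  define a where "a = D / m"
  have a: "a > 0" "a \<le> h / 4" "real m * a = D"
    using D h mpos m_ge by (auto simp: a_def field_simps)
  have ia: "0 \<le> real i * a" "real i * a \<le> D" if "i \<le> m" for i
  proof -
    have "real i * a \<le> real m * a" using that a by (intro mult_right_mono) auto
    then show "0 \<le> real i * a" "real i * a \<le> D" using a by auto
  qed
  define v where "v i = \<gamma> (real (Suc i) * a) - \<gamma> (real i * a)" for i
  have v_le: "norm (v i) \<le> a" if "i < m" for i
    using geodesic_norm[OF g(1) ia ia, of "Suc i" i] that a by (simp add: v_def algebra_simps)
  have v_ge: "a - 2 * F \<le> norm (v i)" if "i < m" for i
    using arc[of "real i * a" "real (Suc i) * a"] ia[of "Suc i"] ia[of i] that a h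
    by (simp add: v_def algebra_simps norm_minus_commute)
  have vv_ge: "2 * a - 2 * F \<le> norm (v i + v (Suc i))" if "Suc i < m" for i
    using arc[of "real i * a" "real (Suc (Suc i)) * a"] ia[of "Suc (Suc i)"] ia[of i] that a h
    by (simp add: v_def algebra_simps norm_minus_commute)
  let ?K = "real m * (4 + 4 * (real m)\<^sup>2) * F"
  have "D \<le> norm (x - y) + ?K"
  proof (cases "a \<le> F")
    case True
    have "real m * a \<le> real m * F" using True by (intro mult_left_mono) auto
    also have "\<dots> \<le> real m * F * (4 + 4 * (real m)\<^sup>2)"
      using mult_left_mono[of 1 "4 + 4 * (real m)\<^sup>2" "real m * F"] F by simp
    also have "\<dots> = ?K" by (simp only: ac_simps)
    finally show ?thesis using a(3) by (simp add: add_increasing)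
  next
    case False
    have diff: "norm (v (Suc i) - v i) \<le> sqrt (8 * a * F)" if "Suc i < m" for i
    proof -
      have "(2 * a - 2 * F)\<^sup>2 \<le> (norm (v i + v (Suc i)))\<^sup>2" using vv_ge[OF that] False by (intro power_mono) auto
      moreover have "(norm (v i))\<^sup>2 \<le> a\<^sup>2" "(norm (v (Suc i)))\<^sup>2 \<le> a\<^sup>2"
        using v_le[of i] v_le[of "Suc i"] that by (auto intro!: power_mono)
      moreover have "(norm (v (Suc i) - v i))\<^sup>2 + (norm (v i + v (Suc i)))\<^sup>2 = 2 * (norm (v i))\<^sup>2 + 2 * (norm (v (Suc i)))\<^sup>2"
        by (simp add: power2_norm_eq_inner algebra_simps inner_commute)
      moreover have "(2 * a - 2 * F)\<^sup>2 = 4 * a\<^sup>2 - 8 * a * F + 4 * F\<^sup>2" by (simp add: power2_eq_square algebra_simps)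
      moreover have "4 * F\<^sup>2 \<ge> 0" by simp
      ultimately have "(norm (v (Suc i) - v i))\<^sup>2 \<le> 8 * a * F" by linarith
      then show ?thesis by (rule real_le_rsqrt)
    qed
    have diff0: "norm (v i - v 0) \<le> real i * sqrt (8 * a * F)" if "i < m" for i
      using that
    proof (induction i)
      case (Suc i)
      have "norm (v (Suc i) - v 0) \<le> norm (v (Suc i) - v i) + norm (v i - v 0)"
        by (rule norm_diff_triangle_ineq[of _ _ "v i" "v 0", simplified] norm_diff_triangle_le) auto
      then show ?case using Suc diff[of i] by (simp add: algebra_simps)
    qed simp
    have m0: "0 < m" using mpos by simp
    have sq: "a\<^sup>2 - 4 * a * F \<le> (norm (v i))\<^sup>2" if "i < m" for i
    proof (cases "a - 2 * F \<ge> 0")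
      case True
      then have "(a - 2 * F)\<^sup>2 \<le> (norm (v i))\<^sup>2" using v_ge[OF that] by (intro power_mono)
      moreover have "(a - 2 * F)\<^sup>2 = a\<^sup>2 - 4 * a * F + 4 * F\<^sup>2" by (simp add: power2_eq_square algebra_simps)
      moreover have "4 * F\<^sup>2 \<ge> 0" by simp
      ultimately show ?thesis by linarith
    next
      case False
      have "a\<^sup>2 - 4 * a * F = a * (a - 4 * F)" by (simp add: power2_eq_square algebra_simps)
      also have "\<dots> \<le> 0" using False a F by (intro mult_nonneg_nonpos) auto
      also have "0 \<le> (norm (v i))\<^sup>2" by simp
      finally show ?thesis .
    qed
    have inn: "a * (a - (4 + 4 * (real m)\<^sup>2) * F) \<le> v i \<bullet> v 0" if "i < m" for i
    proof -
      have "(norm (v i - v 0))\<^sup>2 \<le> (real i * sqrt (8 * a * F))\<^sup>2" using diff0[OF that] by (intro power_mono) auto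
      also have "\<dots> = (real i)\<^sup>2 * (8 * a * F)" using a F by (simp add: power_mult_distrib)
      also have "\<dots> \<le> (real m)\<^sup>2 * (8 * a * F)" using a F that by (intro mult_right_mono power_mono) auto
      finally have "(norm (v i - v 0))\<^sup>2 \<le> (real m)\<^sup>2 * (8 * a * F)" .
      moreover have "(norm (v i - v 0))\<^sup>2 = (norm (v i))\<^sup>2 + (norm (v 0))\<^sup>2 - 2 * (v i \<bullet> v 0)"
        by (simp add: power2_norm_eq_inner algebra_simps inner_commute)
      moreover have "a * (a - (4 + 4 * (real m)\<^sup>2) * F) = a\<^sup>2 - 4 * a * F - (real m)\<^sup>2 * (8 * a * F) / 2"
        by (simp add: power2_eq_square algebra_simps)
      ultimately show ?thesis using sq[OF that] sq[OF m0] by linarith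
    qed
    have tele: "(\<Sum>i<m. v i) = y - x"
    proof -
      have "(\<Sum>i<k. v i) = \<gamma> (real k * a) - \<gamma> 0" for k by (induction k) (auto simp: v_def)
      then show ?thesis using g a(3) by simp
    qed
    have "real m * (a * (a - (4 + 4 * (real m)\<^sup>2) * F)) = (\<Sum>i<m. a * (a - (4 + 4 * (real m)\<^sup>2) * F))" by simp
    also have "\<dots> \<le> (\<Sum>i<m. v i \<bullet> v 0)" using inn by (intro sum_mono) auto
    also have "\<dots> = (y - x) \<bullet> v 0" by (simp add: tele flip: inner_sum_left)
    also have "\<dots> \<le> norm (y - x) * norm (v 0)" by (rule norm_cauchy_schwarz)
    also have "\<dots> \<le> norm (y - x) * a" using v_le[OF m0] by (intro mult_left_mono) auto
    finally have "a * (real m * (a - (4 + 4 * (real m)\<^sup>2) * F)) \<le> a * norm (x - y)"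
      by (simp add: algebra_simps norm_minus_commute)
    then have "real m * (a - (4 + 4 * (real m)\<^sup>2) * F) \<le> norm (x - y)" using a by simp
    then show ?thesis using a(3) by (simp add: algebra_simps)
  qed
  also have "?K \<le> (16 * A + 1) * (4 + 4 * (16 * A + 1)\<^sup>2) * F"
    using m_le F A_ge_1 by (intro mult_right_mono mult_mono add_mono power_mono) auto
  finally show ?thesis by (simp add: D_def)
qed

text \<open>Group the hops into blocks whose end points are at Euclidean distance between \<open>3 h\<close> and \<open>4 h\<close>, and bridge each block by a
geodesic.  The excess \<open>O(F)\<close> of a block is absorbed into its chord, which has length at least \<open>3 h\<close>; the last incomplete
block causes the additive term.\<close>

lemma chain_length:
  fixes p :: "nat \<Rightarrow> 'a"
  assumes h: "h > 0" and F: "F > 0"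
    and exc: "\<And>p c a b \<kappa>. continuous_on {a..b} c \<Longrightarrow> c ` {a..b} \<subseteq> M \<Longrightarrow> a \<le> b \<Longrightarrow> c a = p \<Longrightarrow>
       h < norm (c b - p) \<Longrightarrow> \<kappa> > 0 \<Longrightarrow> \<exists>t\<in>{a..b::real}. d p (c t) \<le> h + F + \<kappa> \<and> h - \<kappa> \<le> norm (c t - p)"
    and p: "\<And>i. i \<le> N \<Longrightarrow> p i \<in> M" "\<And>i. i < N \<Longrightarrow> norm (p i - p (Suc i)) \<le> h"
  shows "d (p 0) (p N) \<le> (1 + (16 * A + 1) * (4 + 4 * (16 * A + 1)\<^sup>2) * F / (3 * h)) * (\<Sum>i<N. norm (p i - p (Suc i))) + 3 * A * h"
  using p
proof (induction N arbitrary: p rule: less_induct)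
  case (less N)
  let ?K = "(16 * A + 1) * (4 + 4 * (16 * A + 1)\<^sup>2) * F"
  have K: "?K \<ge> 0" using A_ge_1 F by simp
  show ?case
  proof (cases "\<exists>i\<le>N. 3 * h \<le> norm (p 0 - p i)")
    case False
    then have "norm (p 0 - p N) \<le> 3 * h" by force
    then have "A * norm (p 0 - p N) \<le> A * (3 * h)" using A_ge_1 by (intro mult_left_mono) auto
    moreover have "d (p 0) (p N) \<le> A * norm (p 0 - p N)" using less.prems by (intro d_le_norm) auto
    moreover have "0 \<le> (1 + ?K / (3 * h)) * (\<Sum>i<N. norm (p i - p (Suc i)))"
      using K h by (intro mult_nonneg_nonneg sum_nonneg) auto
    ultimately show ?thesis by simp
  next
    case True
    define j where "j = (LEAST i. i \<le> N \<and> 3 * h \<le> norm (p 0 - p i))"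
    have j: "j \<le> N" "3 * h \<le> norm (p 0 - p j)" unfolding j_def using LeastI_ex[OF True[unfolded Bex_def]] True
      by (metis (mono_tags, lifting) LeastI_ex)+
    then obtain k where k: "j = Suc k" using h by (cases j) auto
    have "norm (p 0 - p k) < 3 * h"
      using not_less_Least[of k "\<lambda>i. i \<le> N \<and> 3 * h \<le> norm (p 0 - p i)"] j k unfolding j_def by (metis Suc_leD lessI not_le)
    moreover have "norm (p k - p j) \<le> h" using less.prems(2)[of k] j k by simp
    ultimately have j4: "norm (p 0 - p j) \<le> 4 * h"
      using norm_diff_triangle_le[of "p 0" "p k" "norm (p 0 - p k)" "p j" "norm (p k - p j)"] by simp
    have "d (p 0) (p j) \<le> norm (p 0 - p j) + ?K"
      by (rule geodesic_excess[OF _ _ j(2) j4 h F exc]) (use less.prems j in auto)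
    also have "?K \<le> ?K / (3 * h) * norm (p 0 - p j)"
      using mult_left_mono[OF j(2), of "?K / (3 * h)"] K h by simp
    also have "norm (p 0 - p j) + ?K / (3 * h) * norm (p 0 - p j) = (1 + ?K / (3 * h)) * norm (p 0 - p j)"
      by (simp add: algebra_simps)
    also have "\<dots> \<le> (1 + ?K / (3 * h)) * (\<Sum>i<j. norm (p i - p (Suc i)))"
    proof (rule mult_left_mono)
      have "p 0 - p j = (\<Sum>i<j. p i - p (Suc i))" by (rule sum_lessThan_telescope'[symmetric])
      then show "norm (p 0 - p j) \<le> (\<Sum>i<j. norm (p i - p (Suc i)))" by (simp add: norm_sum)
    qed (use K h in auto)
    finally have first: "d (p 0) (p j) \<le> (1 + ?K / (3 * h)) * (\<Sum>i<j. norm (p i - p (Suc i)))" by simp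
    have "d (p (0 + j)) (p (N - j + j)) \<le> (1 + ?K / (3 * h)) * (\<Sum>i<N - j. norm (p (i + j) - p (Suc i + j))) + 3 * A * h"
      by (rule less.IH[where p = "\<lambda>i. p (i + j)"]) (use less.prems j k in auto)
    then have second: "d (p j) (p N) \<le> (1 + ?K / (3 * h)) * (\<Sum>i<N - j. norm (p (i + j) - p (Suc i + j))) + 3 * A * h"
      using j by simp
    have "(\<Sum>i<N. norm (p i - p (Suc i))) = (\<Sum>i<j. norm (p i - p (Suc i))) + (\<Sum>i<N - j. norm (p (i + j) - p (Suc i + j)))"
      using sum.atLeastLessThan_concat[of 0 j N "\<lambda>i. norm (p i - p (Suc i))"] j
        sum.shift_bounds_nat_ivl[of "\<lambda>i. norm (p i - p (Suc i))" 0 j "N - j"]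
      by (simp add: lessThan_atLeast0)
    moreover have "d (p 0) (p N) \<le> d (p 0) (p j) + d (p j) (p N)"
      using less.prems j by (intro d_triangle) auto
    ultimately show ?thesis using first second by (simp only: distrib_left)
  qed
qed

text \<open>The absolutely minimizing property with explicit Lipschitz constants in place of suprema.\<close>

definition amle :: "('a \<Rightarrow> real) \<Rightarrow> 'a set \<Rightarrow> bool" where
  "amle u \<O> \<longleftrightarrow> continuous_on M u \<and>
     (\<forall>V c. openin (top_of_set M) V \<longrightarrow> connected V \<longrightarrow> V \<inter> \<O> = {} \<longrightarrow> c \<ge> 0 \<longrightarrow>
        (\<forall>x\<in>closure V - V. \<forall>y\<in>closure V - V. \<bar>u x - u y\<bar> \<le> c * d x y) \<longrightarrow>
        (\<forall>x\<in>closure V. \<forall>y\<in>closure V. \<bar>u x - u y\<bar> \<le> c * d x y))"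

lemma amle_continuous: "amle u \<O> \<Longrightarrow> continuous_on M u"
  by (simp add: amle_def)

lemma amle_uminus: "amle u \<O> \<Longrightarrow> amle (\<lambda>x. - u x) \<O>"
  unfolding amle_def by (auto simp: abs_minus_commute intro!: continuous_on_minus)

lemma closure_subset_M: "V \<subseteq> M \<Longrightarrow> closure V \<subseteq> M"
  using compact_imp_closed[OF compact_M] by (simp add: closure_minimal)

text \<open>Geodesics between nearby points stay nearby, so the space is locally connected.\<close>

lemma openin_component:
  assumes "openin (top_of_set M) W"
  shows "openin (top_of_set M) (connected_component_set W x)"
  unfolding openin_contains_ball
proof (intro conjI ballI)
  show "connected_component_set W x \<subseteq> M"
    using connected_component_subset[of W x] openin_imp_subset[OF assms] by blast
  fix z assume z: "z \<in> connected_component_set W x"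
  then have zW: "z \<in> W" using connected_component_in by fastforce
  then obtain e where e: "e > 0" "ball z e \<inter> M \<subseteq> W" using assms unfolding openin_contains_ball by blast
  have zM: "z \<in> M" using zW openin_imp_subset[OF assms] by blast
  show "\<exists>e>0. ball z e \<inter> M \<subseteq> connected_component_set W x"
  proof (intro exI[of _ "e / A"] conjI subsetI)
    show "e / A > 0" using e A_ge_1 by simp
    fix y assume "y \<in> ball z (e / A) \<inter> M"
    then have y: "y \<in> M" "A * norm (z - y) < e" using A_ge_1 by (auto simp: dist_norm field_simps)
    then have D: "d z y < e" using d_le_norm[OF zM y(1)] by simp
    obtain \<gamma> where g: "is_geodesic (d z y) \<gamma>" "\<gamma> 0 = z" "\<gamma> (d z y) = y" using obtain_geodesic[OF zM y(1)] .
    have "\<gamma> s \<in> W" if "s \<in> {0..d z y}" for s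
    proof -
      have "norm (z - \<gamma> s) \<le> s" using geodesic_norm[OF g(1), of 0 s] that g(2) d_nonneg[OF zM y(1)] by simp
      then show ?thesis using e(2) geodesic_in[OF g(1)] that D by (force simp: dist_norm)
    qed
    moreover have "connected (\<gamma> ` {0..d z y})"
      by (intro connected_continuous_image geodesic_continuous g) simp
    ultimately have "\<gamma> ` {0..d z y} \<subseteq> connected_component_set W z"
      using d_nonneg[OF zM y(1)] g(2) by (intro connected_component_maximal) force+
    then have "y \<in> connected_component_set W z" using g(3) d_nonneg[OF zM y(1)] by force
    then show "y \<in> connected_component_set W x" using connected_component_eq[OF z] by simp
  qed
qed

text \<open>A frontier point of a component inside the open set \<open>W\<close> would have a component of its own that meets the first one.\<close>

lemma frontier_component:
  assumes W: "openin (top_of_set M) W" and z: "z \<in> closure (connected_component_set W x) - connected_component_set W x"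
  shows "z \<in> M" "z \<notin> W"
proof -
  let ?V = "connected_component_set W x"
  show zM: "z \<in> M" using z closure_subset_M[of ?V] openin_imp_subset[OF openin_component[OF W]] by blast
  show "z \<notin> W"
  proof
    assume zW: "z \<in> W"
    have "openin (top_of_set M) (connected_component_set W z)" by (rule openin_component[OF W])
    moreover have zz: "z \<in> connected_component_set W z" using zW by (simp add: connected_component_refl)
    ultimately obtain e where e: "e > 0" "ball z e \<inter> M \<subseteq> connected_component_set W z"
      unfolding openin_contains_ball by blast
    obtain y where y: "y \<in> ?V" "dist y z < e" using z e(1) closure_approachable by blast
    have "y \<in> M" using y openin_imp_subset[OF openin_component[OF W], of x] by blast
    then have "y \<in> ball z e \<inter> M" using y(2) by (simp add: dist_commute)
    then have "y \<in> connected_component_set W z" using e(2) by blast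
    then have "connected_component_set W z = ?V"
      using connected_component_eq[of y W z] connected_component_eq[of y W x] y by simp
    then show False using z zz by blast
  qed
qed

text \<open>Take the last point outside \<open>V\<close> on a geodesic from \<open>x\<close> to \<open>y\<close>.\<close>

lemma exit_point:
  assumes V: "openin (top_of_set M) V" and x: "x \<in> M" "x \<notin> V" and y: "y \<in> V"
  obtains z where "z \<in> closure V - V" "d x y = d x z + d z y"
proof -
  have yM: "y \<in> M" using V y openin_imp_subset by blast
  define D where "D = d x y"
  obtain \<gamma> where g: "is_geodesic D \<gamma>" "\<gamma> 0 = x" "\<gamma> D = y" using obtain_geodesic[OF x(1) yM] unfolding D_def .
  have D0: "D \<ge> 0" using d_nonneg[OF x(1) yM] by (simp add: D_def)
  have "closedin (top_of_set M) (M - V)" using V by (simp add: closedin_diff)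
  then obtain K where K: "closed K" "M - V = K \<inter> M" unfolding closedin_closed by blast
  have "closedin (top_of_set {0..D}) ({0..D} \<inter> \<gamma> -` K)"
    by (intro continuous_closedin_preimage geodesic_continuous g K)
  then have "compact ({0..D} \<inter> \<gamma> -` K)" by (meson closedin_compact compact_Icc)
  moreover have in_K: "s \<in> {0..D} \<inter> \<gamma> -` K \<longleftrightarrow> s \<in> {0..D} \<and> \<gamma> s \<notin> V" for s
    using K(2) geodesic_in[OF g(1), of s] by auto
  moreover have "{0..D} \<inter> \<gamma> -` K \<noteq> {}" using in_K[of 0] D0 g(2) x(2) by auto
  ultimately obtain s where s: "s \<in> {0..D}" "\<gamma> s \<notin> V" "\<And>t. t \<in> {0..D} \<Longrightarrow> \<gamma> t \<notin> V \<Longrightarrow> t \<le> s"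
    using compact_attains_sup[of "{0..D} \<inter> \<gamma> -` K"] by metis
  have sD: "s < D" using s g(3) y by (cases "s = D") auto
  have "\<gamma> s \<in> closure V"
    unfolding closure_approachable
  proof (intro allI impI)
    fix e :: real assume e: "e > 0"
    define t where "t = min D (s + e / 2)"
    have t: "t \<in> {0..D}" "s < t" "t - s < e" using s(1) sD e by (auto simp: t_def)
    then have "\<gamma> t \<in> V" using s(3)[of t] by force
    moreover have "dist (\<gamma> t) (\<gamma> s) < e" using geodesic_norm[OF g(1), of t s] t s(1) by (simp add: dist_norm)
    ultimately show "\<exists>y\<in>V. dist y (\<gamma> s) < e" by blast
  qed
  moreover have "d x y = d x (\<gamma> s) + d (\<gamma> s) y"
    using geodesic_d[OF g(1), of 0 s] geodesic_d[OF g(1), of s D] g s(1) D0 by (simp add: D_def)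
  ultimately show ?thesis using that s(2) by blast
qed

text \<open>Suppose that \<open>u\<close> exceeds the cone \<open>C\<close> with vertex \<open>x\<close> and slope \<open>a\<close> at \<open>y\<close>, and let \<open>V\<close> be the component of
\<open>{C < u}\<close> containing \<open>y\<close>.  On the frontier of \<open>V\<close> one has \<open>u = C\<close>, so there \<open>u\<close> has Lipschitz constant \<open>a\<close>, and by the
absolutely minimizing property so it has in \<open>V\<close>.  Following the geodesic from \<open>x\<close> to \<open>y\<close> from the point \<open>z\<close> where it
enters \<open>V\<close> for the last time gives \<open>u y \<le> C z + a * d z y = C y\<close>.\<close>

lemma cone_comparison_above:
  assumes u: "amle u \<O>" and x: "x \<in> M" and R: "R > 0"
    and free: "\<And>y. y \<in> M \<Longrightarrow> d x y < R \<Longrightarrow> y \<notin> \<O>"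
    and T: "\<And>y. y \<in> M \<Longrightarrow> d x y \<le> R \<Longrightarrow> u y \<le> T"
    and y: "y \<in> M" "d x y \<le> R"
  shows "u y \<le> u x + (T - u x) / R * d x y"
proof (rule ccontr)
  assume contr: "\<not> ?thesis"
  define a where "a = (T - u x) / R"
  have a: "a \<ge> 0" using T[OF x] R d_refl[OF x] by (simp add: a_def)
  define C where "C y = u x + a * d x y" for y
  have CR: "C y = T" if "d x y = R" for y using R that by (simp add: C_def a_def)
  note cont = amle_continuous[OF u] d_continuous[OF x]
  define W where "W = {y \<in> M. d x y < R \<and> C y < u y}"
  have W: "openin (top_of_set M) W"
  proof -
    have "openin (top_of_set M) (M \<inter> (\<lambda>y. R - d x y) -` {0<..})"
      "openin (top_of_set M) (M \<inter> (\<lambda>y. u y - C y) -` {0<..})"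
      unfolding C_def by (intro continuous_openin_preimage_gen continuous_intros cont; simp)+
    from openin_Int[OF this] show ?thesis by (rule back_subst[of "openin _"]) (auto simp: W_def)
  qed
  have yC: "u y > C y" using contr by (simp add: C_def a_def)
  then have yW: "y \<in> W" using y T[OF y] CR[of y] by (fastforce simp: W_def)
  define V where "V = connected_component_set W y"
  have V: "openin (top_of_set M) V" "connected V" "y \<in> V" "V \<subseteq> W"
    unfolding V_def using openin_component[OF W] yW connected_component_subset
    by (auto simp: connected_component_refl)
  have xV: "x \<notin> V" using V(4) by (auto simp: W_def C_def d_refl[OF x])
  have clV: "z \<in> M \<and> d x z \<le> R \<and> C z \<le> u z" if "z \<in> closure V" for z
  proof -
    have "closedin (top_of_set M) (M \<inter> (\<lambda>y. R - d x y) -` {0..})"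
      "closedin (top_of_set M) (M \<inter> (\<lambda>y. u y - C y) -` {0..})"
      unfolding C_def by (intro continuous_closedin_preimage continuous_intros cont; simp)+
    from closedin_Int[OF this] have "closed ((M \<inter> (\<lambda>y. R - d x y) -` {0..}) \<inter> (M \<inter> (\<lambda>y. u y - C y) -` {0..}))"
      using compact_imp_closed[OF compact_M] closedin_closed_trans by blast
    moreover have "V \<subseteq> (M \<inter> (\<lambda>y. R - d x y) -` {0..}) \<inter> (M \<inter> (\<lambda>y. u y - C y) -` {0..})"
      using V(4) by (auto simp: W_def)
    ultimately have "z \<in> (M \<inter> (\<lambda>y. R - d x y) -` {0..}) \<inter> (M \<inter> (\<lambda>y. u y - C y) -` {0..})"
      using that closure_minimal by blast
    then show ?thesis by auto
  qed
  have bdV: "u z = C z" if "z \<in> closure V - V" for z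
  proof -
    have z: "z \<in> M" "d x z \<le> R" "C z \<le> u z" using clV that by auto
    have "z \<notin> W" using frontier_component[OF W] that unfolding V_def by blast
    then show ?thesis using z T[OF z(1,2)] CR[of z] by (fastforce simp: W_def)
  qed
  have "V \<inter> \<O> = {}" using V(4) free by (auto simp: W_def)
  moreover have "\<bar>u p - u q\<bar> \<le> a * d p q" if "p \<in> closure V - V" "q \<in> closure V - V" for p q
  proof -
    have pq: "p \<in> M" "q \<in> M" using clV that by auto
    have "\<bar>d x p - d x q\<bar> \<le> d p q"
      using d_triangle[OF x pq] d_triangle[OF x pq(2,1)] d_sym[OF pq] by simp
    then have "a * \<bar>d x p - d x q\<bar> \<le> a * d p q" using a by (rule mult_left_mono)
    moreover have "u p - u q = a * (d x p - d x q)" using bdV that by (simp add: C_def algebra_simps)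
    ultimately show ?thesis using a by (simp add: abs_mult)
  qed
  ultimately have lip: "\<bar>u p - u q\<bar> \<le> a * d p q" if "p \<in> closure V" "q \<in> closure V" for p q
    using u V(1,2) a that unfolding amle_def by blast
  obtain z where z: "z \<in> closure V - V" "d x y = d x z + d z y" using exit_point[OF V(1) x xV V(3)] .
  have "\<bar>u z - u y\<bar> \<le> a * d z y" using lip[of z y] z(1) V(3) closure_subset by blast
  then have "u y \<le> u z + a * d z y" by simp
  also have "u z = C z" using bdV z by blast
  finally have "u y \<le> C y" using z(2) by (simp add: C_def algebra_simps)
  then show False using yC by simp
qed

lemma cone_comparison_below:
  assumes u: "amle u \<O>" and x: "x \<in> M" and R: "R > 0"
    and free: "\<And>y. y \<in> M \<Longrightarrow> d x y < R \<Longrightarrow> y \<notin> \<O>"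
    and T: "\<And>y. y \<in> M \<Longrightarrow> d x y \<le> R \<Longrightarrow> T \<le> u y"
    and y: "y \<in> M" "d x y \<le> R"
  shows "u x - (u x - T) / R * d x y \<le> u y"
proof -
  have "- u y \<le> - u x + (- T - - u x) / R * d x y"
    by (rule cone_comparison_above[OF amle_uminus[OF u] x R free]) (use T y in auto)
  moreover have "- T - - u x = u x - T" by simp
  ultimately show ?thesis by simp
qed

text \<open>The components of the complement of \<open>\<O>\<close> have their frontiers in \<open>\<O>\<close>, so the constant is inherited in the closure of each
component.  A geodesic between two points is cut at label points.\<close>

lemma amle_lipschitz:
  assumes u: "amle u \<O>" and \<O>: "closed \<O>" "\<O> \<subseteq> M" and c: "c \<ge> 0"
    and lip: "\<And>a b. a \<in> \<O> \<Longrightarrow> b \<in> \<O> \<Longrightarrow> \<bar>u a - u b\<bar> \<le> c * d a b"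
    and xy: "x \<in> M" "y \<in> M"
  shows "\<bar>u x - u y\<bar> \<le> c * d x y"
proof -
  have W: "openin (top_of_set M) (M - \<O>)"
    using openin_open_Int[OF open_Compl[OF \<O>(1)], of M] by (simp add: Diff_eq)
  have comp: "\<bar>u p - u q\<bar> \<le> c * d p q"
    if "p \<in> closure V" "q \<in> closure V" "V = connected_component_set (M - \<O>) z" for V z p q
  proof -
    have V: "openin (top_of_set M) V" "connected V" unfolding that(3) using openin_component[OF W] by simp_all
    have "V \<inter> \<O> = {}" unfolding that(3) using connected_component_subset by fastforce
    have "closure V - V \<subseteq> \<O>" using frontier_component[OF W] unfolding that(3) by blast
    then have "\<bar>u a - u b\<bar> \<le> c * d a b" if "a \<in> closure V - V" "b \<in> closure V - V" for a b
      using lip that by blast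
    then show ?thesis
      using u[unfolded amle_def, THEN conjunct2, rule_format, OF V \<open>V \<inter> \<O> = {}\<close> c _ that(1,2)] by blast
  qed
  have to_label: "\<bar>u p - u q\<bar> \<le> c * d p q" if pq: "p \<in> M" "q \<in> \<O>" for p q
  proof (cases "p \<in> \<O>")
    case True
    then show ?thesis using lip pq by blast
  next
    case False
    define V where "V = connected_component_set (M - \<O>) p"
    have pV: "p \<in> V" using False pq by (simp add: V_def connected_component_refl)
    have "q \<notin> V" using connected_component_subset[of "M - \<O>" p] pq(2) unfolding V_def by blast
    then obtain z where z: "z \<in> closure V - V" "d q p = d q z + d z p"
      using exit_point[OF openin_component[OF W] subsetD[OF \<O>(2) pq(2)] _ pV[unfolded V_def]] unfolding V_def by metis
    have zO: "z \<in> \<O>" "z \<in> M" using frontier_component[OF W] z(1) unfolding V_def by blast+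
    have "\<bar>u z - u p\<bar> \<le> c * d z p" using comp[OF _ _ V_def] z(1) pV closure_subset by blast
    moreover have "\<bar>u q - u z\<bar> \<le> c * d q z" using lip pq(2) zO by blast
    moreover have "c * d p q = c * d q z + c * d z p"
      using z(2) d_sym[of p q] pq \<O>(2) by (auto simp: distrib_left)
    ultimately show ?thesis by linarith
  qed
  show ?thesis
  proof (cases "x \<in> \<O>")
    case True
    then show ?thesis using to_label[OF xy(2) True] d_sym[OF xy] by (simp add: abs_minus_commute)
  next
    case False
    define V where "V = connected_component_set (M - \<O>) x"
    have xV: "x \<in> V" using False xy by (simp add: V_def connected_component_refl)
    show ?thesis
    proof (cases "y \<in> V")
      case True
      then show ?thesis using comp[OF _ _ V_def] xV closure_subset by blast
    next
      case yV: False
      then obtain z where z: "z \<in> closure V - V" "d y x = d y z + d z x"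
        using exit_point[OF openin_component[OF W] xy(2) _ xV[unfolded V_def]] unfolding V_def by metis
      have zO: "z \<in> \<O>" "z \<in> M" using frontier_component[OF W] z(1) unfolding V_def by blast+
      have "\<bar>u y - u z\<bar> \<le> c * d y z" "\<bar>u x - u z\<bar> \<le> c * d x z" using to_label zO xy by blast+
      moreover have "c * d x y = c * d y z + c * d x z"
        using z(2) d_sym[OF xy] d_sym[OF xy(1) zO(2)] by (simp add: distrib_left)
      ultimately show ?thesis by linarith
    qed
  qed
qed

definition min_ball :: "('a \<Rightarrow> real) \<Rightarrow> real \<Rightarrow> 'a \<Rightarrow> real" where
  "min_ball u \<epsilon> x = (INF y\<in>geo_ball x \<epsilon>. u y)"

lemma min_ball_attained:
  assumes "continuous_on M u" "x \<in> M" "\<epsilon> \<ge> 0"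
  obtains y where "y \<in> geo_ball x \<epsilon>" "min_ball u \<epsilon> x = u y" "\<And>z. z \<in> geo_ball x \<epsilon> \<Longrightarrow> u y \<le> u z"
proof -
  obtain y where y: "y \<in> geo_ball x \<epsilon>" "\<And>z. z \<in> geo_ball x \<epsilon> \<Longrightarrow> u y \<le> u z" using min_on_geo_ball[OF assms] by blast
  have "min_ball u \<epsilon> x = u y" unfolding min_ball_def using y by (intro cInf_eq_minimum) auto
  then show ?thesis using that y by blast
qed

lemma min_ball_le:
  assumes "continuous_on M u" "x \<in> M" "\<epsilon> \<ge> 0" "z \<in> geo_ball x \<epsilon>"
  shows "min_ball u \<epsilon> x \<le> u z"
  using min_ball_attained[OF assms(1-3)] assms(4) by metis

lemma min_ball_min_ball:
  assumes u: "continuous_on M u" and x: "x \<in> M" and \<epsilon>: "\<epsilon> \<ge> 0"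
  obtains z where "z \<in> geo_ball x \<epsilon>" "min_ball u \<epsilon> z = min_ball u (2 * \<epsilon>) x"
    "\<And>y. y \<in> geo_ball x \<epsilon> \<Longrightarrow> min_ball u (2 * \<epsilon>) x \<le> min_ball u \<epsilon> y"
proof -
  obtain p where p: "p \<in> geo_ball x (2 * \<epsilon>)" "min_ball u (2 * \<epsilon>) x = u p" "\<And>z. z \<in> geo_ball x (2 * \<epsilon>) \<Longrightarrow> u p \<le> u z"
    using min_ball_attained[OF u x, of "2 * \<epsilon>"] \<epsilon> by auto
  have low: "u p \<le> min_ball u \<epsilon> y" if "y \<in> geo_ball x \<epsilon>" for y
  proof -
    have yM: "y \<in> M" using that by (simp add: geo_ball_def)
    obtain q where q: "q \<in> geo_ball y \<epsilon>" "min_ball u \<epsilon> y = u q" using min_ball_attained[OF u yM \<epsilon>] by metis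
    have "q \<in> geo_ball x (2 * \<epsilon>)" using q(1) that d_triangle[OF x yM, of q] by (simp add: geo_ball_def)
    then show ?thesis using p(3) q(2) by simp
  qed
  have pM: "p \<in> M" "d x p \<le> \<epsilon> + \<epsilon>" using p(1) by (auto simp: geo_ball_def)
  obtain z where z: "z \<in> M" "d x z \<le> \<epsilon>" "d z p \<le> \<epsilon>" using intermediate_point[OF x pM(1) \<epsilon> \<epsilon> pM(2)] .
  have zc: "z \<in> geo_ball x \<epsilon>" using z by (simp add: geo_ball_def)
  have "min_ball u \<epsilon> z \<le> u p" using min_ball_le[OF u z(1) \<epsilon>, of p] z pM by (simp add: geo_ball_def)
  then have "min_ball u \<epsilon> z = u p" using low[OF zc] by simp
  then show ?thesis using that[OF zc] p(2) low by simp
qed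

text \<open>Every min-ball value within \<open>\<epsilon>\<close> of \<open>x\<close> is at most \<open>u x\<close>, and the smallest of them is the minimum \<open>t\<close> over the ball of
radius \<open>2 \<epsilon>\<close>.  By comparison with the cone of vertex \<open>x\<close> through \<open>t\<close> at radius \<open>2 \<epsilon>\<close>, the values of \<open>u\<close> within
\<open>\<epsilon>\<close> of \<open>x\<close> are at least \<open>(u x + t) / 2\<close>.\<close>

lemma min_ball_supersolution:
  assumes u: "amle u \<O>" and x: "x \<in> M" and \<epsilon>: "\<epsilon> > 0"
    and free: "\<And>y. y \<in> M \<Longrightarrow> d x y < 2 * \<epsilon> \<Longrightarrow> y \<notin> \<O>"
  shows "(SUP y\<in>geo_ball x \<epsilon>. min_ball u \<epsilon> y) + (INF y\<in>geo_ball x \<epsilon>. min_ball u \<epsilon> y) \<le> 2 * min_ball u \<epsilon> x"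
proof -
  note c = amle_continuous[OF u]
  have e0: "\<epsilon> \<ge> 0" using \<epsilon> by simp
  obtain z where z: "z \<in> geo_ball x \<epsilon>" "min_ball u \<epsilon> z = min_ball u (2 * \<epsilon>) x"
    "\<And>y. y \<in> geo_ball x \<epsilon> \<Longrightarrow> min_ball u (2 * \<epsilon>) x \<le> min_ball u \<epsilon> y"
    using min_ball_min_ball[OF c x e0] by blast
  have inf: "(INF y\<in>geo_ball x \<epsilon>. min_ball u \<epsilon> y) = min_ball u (2 * \<epsilon>) x"
  proof (rule cInf_eq_minimum)
    show "min_ball u (2 * \<epsilon>) x \<in> min_ball u \<epsilon> ` geo_ball x \<epsilon>" using z(1) unfolding z(2)[symmetric] by blast
  qed (use z(3) in blast)
  have sup: "(SUP y\<in>geo_ball x \<epsilon>. min_ball u \<epsilon> y) \<le> u x"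
  proof (rule cSUP_least)
    show "geo_ball x \<epsilon> \<noteq> {}" using geo_ball_self[OF x e0] by blast
    fix y assume "y \<in> geo_ball x \<epsilon>"
    then have y: "y \<in> M" "x \<in> geo_ball y \<epsilon>" using d_sym[OF x] x by (auto simp: geo_ball_def)
    then show "min_ball u \<epsilon> y \<le> u x" using min_ball_le[OF c _ e0] by blast
  qed
  obtain y where y: "y \<in> geo_ball x \<epsilon>" "min_ball u \<epsilon> x = u y" using min_ball_attained[OF c x e0] by metis
  let ?t = "min_ball u (2 * \<epsilon>) x"
  have t: "?t \<le> u z" if "z \<in> M" "d x z \<le> 2 * \<epsilon>" for z
    using min_ball_le[OF c x, of "2 * \<epsilon>" z] e0 that by (simp add: geo_ball_def)
  have "u x - (u x - ?t) / (2 * \<epsilon>) * d x y \<le> u y"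
    by (rule cone_comparison_below[OF u x _ free t]) (use y \<epsilon> in \<open>auto simp: geo_ball_def\<close>)
  moreover have "(u x - ?t) / (2 * \<epsilon>) * d x y \<le> (u x - ?t) / (2 * \<epsilon>) * \<epsilon>"
    using y(1) t[OF x] d_refl[OF x] \<epsilon> by (intro mult_left_mono) (auto simp: geo_ball_def)
  moreover have "(u x - ?t) / (2 * \<epsilon>) * \<epsilon> = (u x - ?t) / 2" using \<epsilon> by simp
  ultimately have "u x - (u x - ?t) / 2 \<le> u y" by linarith
  moreover have "S + I \<le> 2 * v" if "a - (a - t) / 2 \<le> v" "I = t" "S \<le> a" for S I v a t :: real
    using that by (simp add: field_simps)
  ultimately show ?thesis using inf sup y(2) by metis
qed

text \<open>If \<open>u\<close> did not descend by \<open>\<alpha> r\<close>, the cone comparison from below would leave only increasing difference quotients near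
\<open>x\<close>, and the comparison from above would make \<open>u\<close> rise by \<open>\<alpha> \<rho>\<close> within every small radius \<open>\<rho>\<close>.  Seen from the
point \<open>y\<close> where that rise is attained, \<open>u\<close> descends with slope \<open>\<alpha>\<close> towards \<open>x\<close>, hence by \<open>\<alpha> (r - \<rho>)\<close> within
radius \<open>r - \<rho>\<close> of \<open>y\<close>; let \<open>\<rho>\<close> tend to \<open>0\<close>.\<close>

lemma slope_downwards:
  assumes u: "amle u \<O>" and x: "x \<in> M" and r: "0 < r" "r < R" and \<alpha>: "\<alpha> > 0"
    and free: "\<And>y. y \<in> M \<Longrightarrow> d x y < R \<Longrightarrow> y \<notin> \<O>"
    and lip: "\<And>y z. y \<in> M \<Longrightarrow> z \<in> M \<Longrightarrow> \<bar>u y - u z\<bar> \<le> \<Lambda> * d y z" and \<Lambda>: "\<Lambda> \<ge> 0"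
    and slope: "\<And>e. e > 0 \<Longrightarrow> \<exists>y\<in>M. y \<noteq> x \<and> d x y < e \<and> \<alpha> * d x y \<le> \<bar>u y - u x\<bar>"
  shows "min_ball u r x \<le> u x - \<alpha> * r"
proof (rule ccontr)
  assume contr: "\<not> ?thesis"
  note c = amle_continuous[OF u]
  let ?t = "min_ball u r x"
  have t: "?t \<le> u z" if "z \<in> M" "d x z \<le> r" for z
    using min_ball_le[OF c x, of r z] r that by (simp add: geo_ball_def)
  have gap: "?t - (u x - \<alpha> * r) > 0" using contr by simp
  have up: "u x - \<alpha> * d x y < u y" if "y \<in> M" "d x y \<le> r" "y \<noteq> x" for y
  proof -
    have pos: "d x y > 0" using d_nonneg[OF x that(1)] d_eq_0[OF x that(1)] that(3) by fastforce
    have "u x - (u x - ?t) / r * d x y \<le> u y"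
      by (rule cone_comparison_below[OF u x r(1) free t]) (use that r in auto)
    moreover have "(u x - ?t) / r < \<alpha>" using gap r by (simp add: pos_divide_less_eq)
    then have "(u x - ?t) / r * d x y < \<alpha> * d x y" using pos by (rule mult_strict_right_mono)
    ultimately show ?thesis by linarith
  qed
  define \<rho> where "\<rho> = min (r / 2) ((?t - (u x - \<alpha> * r)) / (2 * (\<Lambda> + \<alpha>)))"
  have \<rho>: "\<rho> > 0" "\<rho> \<le> r / 2" "(\<Lambda> + \<alpha>) * \<rho> < ?t - (u x - \<alpha> * r)"
  proof -
    show "\<rho> \<le> r / 2" unfolding \<rho>_def by (rule min.cobounded1)
    have "(?t - (u x - \<alpha> * r)) / (2 * (\<Lambda> + \<alpha>)) > 0" using gap \<alpha> \<Lambda> by (intro divide_pos_pos) auto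
    then show "\<rho> > 0" using r unfolding \<rho>_def by simp
    have "(\<Lambda> + \<alpha>) * \<rho> \<le> (\<Lambda> + \<alpha>) * ((?t - (u x - \<alpha> * r)) / (2 * (\<Lambda> + \<alpha>)))"
      unfolding \<rho>_def using \<alpha> \<Lambda> by (intro mult_left_mono min.cobounded2) auto
    also have "\<dots> = (?t - (u x - \<alpha> * r)) / 2" using \<alpha> \<Lambda> by (simp add: field_simps)
    also have "\<dots> < ?t - (u x - \<alpha> * r)" using gap by simp
    finally show "(\<Lambda> + \<alpha>) * \<rho> < ?t - (u x - \<alpha> * r)" .
  qed
  obtain y where y: "y \<in> geo_ball x \<rho>" "\<And>z. z \<in> geo_ball x \<rho> \<Longrightarrow> u z \<le> u y"
    using min_on_geo_ball[OF continuous_on_minus[OF c] x, of \<rho>] \<rho> by auto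
  have yM: "y \<in> M" "d x y \<le> \<rho>" using y(1) by (auto simp: geo_ball_def)
  have high: "u x + \<alpha> * \<rho> \<le> u y"
  proof -
    obtain z where z: "z \<in> M" "z \<noteq> x" "d x z < \<rho>" "\<alpha> * d x z \<le> \<bar>u z - u x\<bar>" using slope[OF \<rho>(1)] by blast
    have pos: "d x z > 0" using d_nonneg[OF x z(1)] d_eq_0[OF x z(1)] z(2) by fastforce
    have "\<alpha> * d x z \<le> u z - u x" using up[OF z(1) _ z(2)] z(3,4) \<rho>(2) r by linarith
    moreover have "u z \<le> u x + (u y - u x) / \<rho> * d x z"
      by (rule cone_comparison_above[OF u x \<rho>(1) free]) (use y(2) z \<rho> r in \<open>auto simp: geo_ball_def\<close>)
    ultimately have "\<alpha> * d x z \<le> (u y - u x) / \<rho> * d x z" by linarith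
    then have "\<alpha> \<le> (u y - u x) / \<rho>" using pos by (rule mult_right_le_imp_le)
    then show ?thesis using \<rho>(1) by (simp add: field_simps)
  qed
  have pos: "d y x > 0"
  proof -
    have "\<alpha> * \<rho> > 0" using \<alpha> \<rho>(1) by simp
    then have "y \<noteq> x" using high by auto
    then show ?thesis using d_nonneg[OF yM(1) x] d_eq_0[OF yM(1) x] by fastforce
  qed
  have dyx: "d y x \<le> \<rho>" using yM d_sym[OF x yM(1)] by simp
  have sub: "d x z \<le> \<rho> + d y z" if "z \<in> M" for z using d_triangle[OF x yM(1) that] yM(2) by simp
  have "u y - (u y - ?t) / (r - \<rho>) * d y x \<le> u x"
  proof (rule cone_comparison_below[OF u yM(1)])
    show "z \<notin> \<O>" if "z \<in> M" "d y z < r - \<rho>" for z using free[OF that(1)] sub[OF that(1)] that r by simp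
    show "?t \<le> u z" if "z \<in> M" "d y z \<le> r - \<rho>" for z using t[OF that(1)] sub[OF that(1)] that by simp
  qed (use \<rho> r x dyx in auto)
  then have "\<alpha> * \<rho> \<le> (u y - ?t) / (r - \<rho>) * d y x" using high by linarith
  moreover have "\<alpha> * d y x \<le> \<alpha> * \<rho>" using dyx \<alpha> by simp
  ultimately have "\<alpha> * d y x \<le> (u y - ?t) / (r - \<rho>) * d y x" by linarith
  then have "\<alpha> \<le> (u y - ?t) / (r - \<rho>)" using pos by (rule mult_right_le_imp_le)
  then have "\<alpha> * (r - \<rho>) \<le> u y - ?t" using \<rho> r by (simp add: pos_le_divide_eq)
  moreover have "u y \<le> u x + \<Lambda> * \<rho>"
    using lip[OF yM(1) x] mult_left_mono[OF dyx \<Lambda>] by linarith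
  ultimately show False using \<rho>(3) by (simp add: algebra_simps)
qed

lemma min_ball_slope:
  assumes u: "amle u \<O>" and x: "x \<in> M" and \<epsilon>: "0 < \<epsilon>" and \<alpha>: "\<alpha> > 0"
    and free: "\<And>y. y \<in> M \<Longrightarrow> d x y < 3 * \<epsilon> \<Longrightarrow> y \<notin> \<O>"
    and lip: "\<And>y z. y \<in> M \<Longrightarrow> z \<in> M \<Longrightarrow> \<bar>u y - u z\<bar> \<le> \<Lambda> * d y z" and \<Lambda>: "\<Lambda> \<ge> 0"
    and slope: "\<And>x e. x \<in> M \<Longrightarrow> e > 0 \<Longrightarrow> \<exists>y\<in>M. y \<noteq> x \<and> d x y < e \<and> \<alpha> * d x y \<le> \<bar>u y - u x\<bar>"
  shows "(INF y\<in>geo_ball x \<epsilon>. min_ball u \<epsilon> y) \<le> min_ball u \<epsilon> x - \<alpha> * \<epsilon>"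
proof -
  note c = amle_continuous[OF u]
  have e0: "\<epsilon> \<ge> 0" using \<epsilon> by simp
  obtain y where y: "y \<in> geo_ball x \<epsilon>" "min_ball u \<epsilon> x = u y" using min_ball_attained[OF c x e0] by metis
  have yM: "y \<in> M" "d x y \<le> \<epsilon>" using y by (auto simp: geo_ball_def)
  have "min_ball u \<epsilon> y \<le> u y - \<alpha> * \<epsilon>"
  proof (rule slope_downwards[OF u yM(1) \<epsilon> _ \<alpha> _ lip \<Lambda> slope[OF yM(1)]])
    show "\<epsilon> < 2 * \<epsilon>" using \<epsilon> by simp
    show "z \<notin> \<O>" if "z \<in> M" "d y z < 2 * \<epsilon>" for z
      using free[OF that(1)] d_triangle[OF x yM(1) that(1)] that(2) yM(2) by simp
  qed
  moreover have "(INF y\<in>geo_ball x \<epsilon>. min_ball u \<epsilon> y) \<le> min_ball u \<epsilon> y"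
  proof (rule cINF_lower[OF _ y(1)])
    obtain z where "\<And>y. y \<in> geo_ball x \<epsilon> \<Longrightarrow> min_ball u (2 * \<epsilon>) x \<le> min_ball u \<epsilon> y"
      using min_ball_min_ball[OF c x e0] by blast
    then show "bdd_below (min_ball u \<epsilon> ` geo_ball x \<epsilon>)" by (rule bdd_belowI2)
  qed
  ultimately show ?thesis using y(2) by simp
qed

end

section \<open>The closure of the domain as a geodesic space\<close>

definition gd :: "'a::euclidean_space set \<Rightarrow> 'a \<Rightarrow> 'a \<Rightarrow> real" where
  "gd \<Omega> x y = enn2real (geodist \<Omega> x y)"

text \<open>\<open>A\<close> depends on the set \<open>\<Omega>\<close> alone, whereas the error function \<open>\<phi>\<close> varies in the final statement.\<close>

locale finite_geodist =
  fixes \<Omega> :: "'a::euclidean_space set" and A :: real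
  assumes bounded_dom: "bounded \<Omega>" and A1: "A \<ge> 1"
    and geodist_le_norm: "\<And>x y. x \<in> closure \<Omega> \<Longrightarrow> y \<in> closure \<Omega> \<Longrightarrow> geodist \<Omega> x y \<le> ennreal (A * norm (x - y))"
begin

lemma geodist_gd: "x \<in> closure \<Omega> \<Longrightarrow> y \<in> closure \<Omega> \<Longrightarrow> geodist \<Omega> x y = ennreal (gd \<Omega> x y)"
  using order_le_less_trans[OF geodist_le_norm ennreal_less_top] by (simp add: gd_def)

lemma gd_nonneg: "gd \<Omega> x y \<ge> 0" by (simp add: gd_def)

lemma gd_le: "x \<in> closure \<Omega> \<Longrightarrow> y \<in> closure \<Omega> \<Longrightarrow> 0 \<le> l \<Longrightarrow> geodist \<Omega> x y \<le> ennreal l \<Longrightarrow> gd \<Omega> x y \<le> l"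
  by (simp add: geodist_gd gd_nonneg)

lemma gd_norm: "x \<in> closure \<Omega> \<Longrightarrow> y \<in> closure \<Omega> \<Longrightarrow> norm (x - y) \<le> gd \<Omega> x y"
  using norm_le_geodist[of x y \<Omega>] by (simp add: geodist_gd gd_nonneg)

lemma gd_le_norm: "x \<in> closure \<Omega> \<Longrightarrow> y \<in> closure \<Omega> \<Longrightarrow> gd \<Omega> x y \<le> A * norm (x - y)"
  using A1 by (intro gd_le geodist_le_norm) auto

lemma gd_sym: "gd \<Omega> x y = gd \<Omega> y x"
  by (simp add: gd_def geodist_sym)

lemma gd_triangle:
  assumes "x \<in> closure \<Omega>" "y \<in> closure \<Omega>" "z \<in> closure \<Omega>"
  shows "gd \<Omega> x z \<le> gd \<Omega> x y + gd \<Omega> y z"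
  using geodist_triangle[of \<Omega> x z y] assms
  by (intro gd_le) (auto simp: geodist_gd gd_nonneg ennreal_plus)

lemma gd_refl: "x \<in> closure \<Omega> \<Longrightarrow> gd \<Omega> x x = 0"
  by (simp add: gd_def geodist_refl)

text \<open>Almost shortest curves with nearly constant speed have a uniformly convergent subsequence by Arzela-Ascoli.  The limit is
Lipschitz with constant \<open>D\<close> and joins two points at distance \<open>D\<close>, which forces equality throughout.\<close>

lemma gd_geodesic:
  assumes xy: "x \<in> closure \<Omega>" "y \<in> closure \<Omega>"
  shows "\<exists>\<gamma>. \<gamma> 0 = x \<and> \<gamma> (gd \<Omega> x y) = y \<and> (\<forall>s\<in>{0..gd \<Omega> x y}. \<gamma> s \<in> closure \<Omega>) \<and>
    (\<forall>s\<in>{0..gd \<Omega> x y}. \<forall>t\<in>{0..gd \<Omega> x y}. gd \<Omega> (\<gamma> s) (\<gamma> t) = \<bar>s - t\<bar>)"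
proof (cases "x = y")
  case True
  then show ?thesis using xy by (intro exI[of _ "\<lambda>_. x"]) (simp add: gd_refl)
next
  case False
  define D where "D = gd \<Omega> x y"
  have "norm (x - y) > 0" using False by simp
  then have D: "D > 0" using gd_norm[OF xy] unfolding D_def by linarith
  define l where "l n = D + 1 / real (Suc n)" for n
  have l: "l n > 0" "D < l n" "l n \<le> D + 1" for n using D by (auto simp: l_def add_pos_pos)
  have "\<exists>\<omega>. \<omega> 0 = x \<and> \<omega> 1 = y \<and> (\<forall>t\<in>{0..1}. \<omega> t \<in> closure \<Omega>) \<and>
     (\<forall>s t. 0 \<le> s \<longrightarrow> s \<le> t \<longrightarrow> t \<le> 1 \<longrightarrow> geodist \<Omega> (\<omega> s) (\<omega> t) \<le> ennreal (l n * (t - s)))" for n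
  proof -
    have "geodist \<Omega> x y < ennreal (l n)" using l[of n] xy by (simp add: geodist_gd D_def ennreal_lessI)
    then show ?thesis by (rule geodist_lipschitz_path) blast
  qed
  then obtain \<omega> where \<omega>: "\<And>n. \<omega> n 0 = x" "\<And>n. \<omega> n 1 = y" "\<And>n t. t \<in> {0..1} \<Longrightarrow> \<omega> n t \<in> closure \<Omega>"
    "\<And>n s t. 0 \<le> s \<Longrightarrow> s \<le> t \<Longrightarrow> t \<le> 1 \<Longrightarrow> geodist \<Omega> (\<omega> n s) (\<omega> n t) \<le> ennreal (l n * (t - s))"
    by metis
  have lip: "gd \<Omega> (\<omega> n s) (\<omega> n t) \<le> l n * \<bar>s - t\<bar>" if "s \<in> {0..1}" "t \<in> {0..1}" for n s t
  proof (cases "s \<le> t")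
    case True
    then show ?thesis using \<omega>(4)[of s t n] that \<omega>(3) l(1)[of n] by (intro gd_le) auto
  next
    case False
    then have "gd \<Omega> (\<omega> n t) (\<omega> n s) \<le> l n * (s - t)" using \<omega>(4)[of t s n] that \<omega>(3) l(1)[of n] by (intro gd_le) auto
    then show ?thesis using False by (simp add: gd_sym)
  qed
  obtain B where B: "\<And>z. z \<in> closure \<Omega> \<Longrightarrow> norm z \<le> B"
    using bounded_closure[OF bounded_dom] by (auto simp: bounded_iff)
  obtain g k where g: "continuous_on {0..1::real} g" "strict_mono (k :: nat \<Rightarrow> nat)"
    "\<And>e. 0 < e \<Longrightarrow> \<exists>N. \<forall>n s. n \<ge> N \<and> s \<in> {0..1} \<longrightarrow> norm (\<omega> (k n) s - g s) < e"
  proof (rule Arzela_Ascoli[of "{0..1::real}" \<omega> B])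
    show "norm (\<omega> n s) \<le> B" if "s \<in> {0..1}" for n s using B \<omega>(3) that by blast
    fix s e :: real assume s: "s \<in> {0..1}" and e: "0 < e"
    show "\<exists>d>0. \<forall>n t. t \<in> {0..1} \<and> norm (s - t) < d \<longrightarrow> norm (\<omega> n s - \<omega> n t) < e"
    proof (intro exI[of _ "e / (D + 1)"] conjI allI impI)
      show "e / (D + 1) > 0" using e D by simp
      fix n t assume t: "t \<in> {0..1} \<and> norm (s - t) < e / (D + 1)"
      have "norm (\<omega> n s - \<omega> n t) \<le> l n * \<bar>s - t\<bar>"
        using gd_norm[OF \<omega>(3)[OF s, of n] \<omega>(3)[of t n]] lip[of s t n] s t by linarith
      also have "\<dots> \<le> (D + 1) * \<bar>s - t\<bar>" using l(3)[of n] by (intro mult_right_mono) auto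
      also have "\<dots> < e" using t D by (simp add: pos_less_divide_eq mult.commute)
      finally show "norm (\<omega> n s - \<omega> n t) < e" .
    qed
  qed auto
  have lim: "(\<lambda>n. \<omega> (k n) s) \<longlonglongrightarrow> g s" if "s \<in> {0..1}" for s
  proof (rule LIMSEQ_I)
    fix e :: real assume "0 < e"
    from g(3)[OF this] show "\<exists>no. \<forall>n\<ge>no. norm (\<omega> (k n) s - g s) < e" using that by blast
  qed
  have gM: "g s \<in> closure \<Omega>" if "s \<in> {0..1}" for s
    by (rule closed_sequentially[OF closed_closure _ lim[OF that]]) (rule \<omega>(3)[OF that])
  have g01: "g 0 = x" "g 1 = y"
    using lim[of 0] lim[of 1] by (simp_all add: \<omega>(1,2) LIMSEQ_const_iff)
  have glip: "gd \<Omega> (g s) (g t) \<le> D * \<bar>s - t\<bar>" if st: "s \<in> {0..1}" "t \<in> {0..1}" for s t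
  proof -
    have "(\<lambda>n. A * norm (g s - \<omega> (k n) s) + l (k n) * \<bar>s - t\<bar> + A * norm (\<omega> (k n) t - g t))
        \<longlonglongrightarrow> A * norm (g s - g s) + (D + 0) * \<bar>s - t\<bar> + A * norm (g t - g t)"
    proof (intro tendsto_intros lim st)
      have "l \<longlonglongrightarrow> D + 0" unfolding l_def by (intro tendsto_intros LIMSEQ_Suc lim_1_over_n)
      then show "(\<lambda>n. l (k n)) \<longlonglongrightarrow> D + 0" using LIMSEQ_subseq_LIMSEQ[OF _ g(2)] by (simp add: o_def)
    qed
    then have "(\<lambda>n. A * norm (g s - \<omega> (k n) s) + l (k n) * \<bar>s - t\<bar> + A * norm (\<omega> (k n) t - g t)) \<longlonglongrightarrow> D * \<bar>s - t\<bar>"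
      by simp
    moreover have "gd \<Omega> (g s) (g t) \<le> A * norm (g s - \<omega> (k n) s) + l (k n) * \<bar>s - t\<bar> + A * norm (\<omega> (k n) t - g t)" for n
    proof -
      have "gd \<Omega> (g s) (g t) \<le> gd \<Omega> (g s) (\<omega> (k n) s) + gd \<Omega> (\<omega> (k n) s) (g t)"
        using st gM \<omega>(3) by (intro gd_triangle) auto
      also have "gd \<Omega> (\<omega> (k n) s) (g t) \<le> gd \<Omega> (\<omega> (k n) s) (\<omega> (k n) t) + gd \<Omega> (\<omega> (k n) t) (g t)"
        using st gM \<omega>(3) by (intro gd_triangle) auto
      finally show ?thesis
        using gd_le_norm[OF gM[OF st(1)] \<omega>(3)[OF st(1), of "k n"]] gd_le_norm[OF \<omega>(3)[OF st(2), of "k n"] gM[OF st(2)]]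
          lip[OF st, of "k n"] by linarith
    qed
    ultimately show ?thesis by (intro LIMSEQ_le_const) auto
  qed
  define \<gamma> where "\<gamma> s = g (s / D)" for s
  have sD: "s / D \<in> {0..1}" if "s \<in> {0..D}" for s using that D by simp
  have le: "gd \<Omega> (\<gamma> s) (\<gamma> t) \<le> \<bar>s - t\<bar>" if "s \<in> {0..D}" "t \<in> {0..D}" for s t
  proof -
    have "gd \<Omega> (\<gamma> s) (\<gamma> t) \<le> D * \<bar>s / D - t / D\<bar>" unfolding \<gamma>_def by (intro glip sD that)
    also have "s / D - t / D = (s - t) / D" by (rule diff_divide_distrib[symmetric])
    also have "D * \<bar>(s - t) / D\<bar> = \<bar>s - t\<bar>" using D by (simp add: abs_divide)
    finally show ?thesis .
  qed
  have M: "\<gamma> s \<in> closure \<Omega>" if "s \<in> {0..D}" for s unfolding \<gamma>_def by (intro gM sD that)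
  have ends: "\<gamma> 0 = x" "\<gamma> D = y" using g01 D by (auto simp: \<gamma>_def)
  have ge: "t - s \<le> gd \<Omega> (\<gamma> s) (\<gamma> t)" if "s \<in> {0..D}" "t \<in> {0..D}" for s t
  proof -
    have "D \<le> gd \<Omega> x (\<gamma> s) + gd \<Omega> (\<gamma> s) y" unfolding D_def by (rule gd_triangle[OF xy(1) M[OF that(1)] xy(2)])
    moreover have "gd \<Omega> (\<gamma> s) y \<le> gd \<Omega> (\<gamma> s) (\<gamma> t) + gd \<Omega> (\<gamma> t) y"
      by (rule gd_triangle[OF M[OF that(1)] M[OF that(2)] xy(2)])
    moreover have "gd \<Omega> x (\<gamma> s) \<le> s" using le[of 0 s] that ends by simp
    moreover have "gd \<Omega> (\<gamma> t) y \<le> D - t" using le[of t D] that ends by simp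
    ultimately show ?thesis by linarith
  qed
  have "gd \<Omega> (\<gamma> s) (\<gamma> t) = \<bar>s - t\<bar>" if "s \<in> {0..D}" "t \<in> {0..D}" for s t
    using le[OF that] ge[OF that] ge[OF that(2,1)] gd_sym[of "\<gamma> s" "\<gamma> t"] by linarith
  then show ?thesis using M ends unfolding D_def[symmetric] by (intro exI[of _ \<gamma>]) simp
qed

sublocale geodesic_space "closure \<Omega>" "gd \<Omega>" A
  by standard
     (use bounded_dom A1 gd_norm gd_le_norm gd_sym gd_triangle gd_geodesic in \<open>auto simp: compact_closure\<close>)

lemma geotop_eq: "geotop \<Omega> = top_of_set (closure \<Omega>)"
  unfolding topology_eq
proof
  fix U
  show "openin (geotop \<Omega>) U \<longleftrightarrow> openin (top_of_set (closure \<Omega>)) U"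
  proof
    assume U: "openin (geotop \<Omega>) U"
    show "openin (top_of_set (closure \<Omega>)) U"
      unfolding openin_contains_ball
    proof (intro conjI ballI)
      show UM: "U \<subseteq> closure \<Omega>" using U by (simp add: openin_geotop)
      fix x assume x: "x \<in> U"
      then obtain r where r: "r > 0" "\<And>y. y \<in> closure \<Omega> \<Longrightarrow> geodist \<Omega> x y < r \<Longrightarrow> y \<in> U"
        using U unfolding openin_geotop by blast
      obtain e where e: "e > 0" "ennreal e \<le> r"
        using r(1) by (cases r) (auto intro: that[of 1])
      show "\<exists>e>0. ball x e \<inter> closure \<Omega> \<subseteq> U"
      proof (intro exI[of _ "e / A"] conjI subsetI)
        show "e / A > 0" using e A1 by simp
        fix y assume "y \<in> ball x (e / A) \<inter> closure \<Omega>"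
        then have y: "y \<in> closure \<Omega>" "A * norm (x - y) < e" using A1 by (auto simp: dist_norm pos_less_divide_eq mult.commute)
        have "geodist \<Omega> x y \<le> ennreal (A * norm (x - y))" using x UM y by (intro geodist_le_norm) auto
        also have "\<dots> < ennreal e" using y(2) e(1) by (intro ennreal_lessI)
        finally show "y \<in> U" using r(2)[OF y(1)] e(2) by simp
      qed
    qed
  next
    assume U: "openin (top_of_set (closure \<Omega>)) U"
    show "openin (geotop \<Omega>) U"
      unfolding openin_geotop
    proof (intro conjI ballI)
      show "U \<subseteq> closure \<Omega>" using U openin_imp_subset by blast
      fix x assume "x \<in> U"
      then obtain e where e: "e > 0" "ball x e \<inter> closure \<Omega> \<subseteq> U" using U unfolding openin_contains_ball by blast
      show "\<exists>r>0. \<forall>y\<in>closure \<Omega>. geodist \<Omega> x y < r \<longrightarrow> y \<in> U"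
      proof (intro exI[of _ "ennreal e"] conjI ballI impI)
        show "ennreal e > 0" using e by simp
        fix y assume y: "y \<in> closure \<Omega>" "geodist \<Omega> x y < ennreal e"
        then have "ennreal (norm (x - y)) < ennreal e" using norm_le_geodist order_le_less_trans by blast
        then have "norm (x - y) < e" using e(1) by (simp add: ennreal_less_iff)
        then show "y \<in> U" using e(2) y(1) by (auto simp: dist_norm)
      qed
    qed
  qed
qed

lemma Lip_const_le_iff:
  assumes F: "F \<subseteq> closure \<Omega>" and c: "c \<ge> 0"
  shows "Lip_const (geodist \<Omega>) u F \<le> ennreal c \<longleftrightarrow> (\<forall>x\<in>F. \<forall>y\<in>F. \<bar>u x - u y\<bar> \<le> c * gd \<Omega> x y)"
proof -
  have q: "ennreal \<bar>u x - u y\<bar> / geodist \<Omega> x y \<le> ennreal c \<longleftrightarrow> \<bar>u x - u y\<bar> \<le> c * gd \<Omega> x y"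
    if "x \<in> F" "y \<in> F" "x \<noteq> y" for x y
  proof -
    have xy: "x \<in> closure \<Omega>" "y \<in> closure \<Omega>" using F that by auto
    have "norm (x - y) > 0" using that(3) by simp
    then have pos: "gd \<Omega> x y > 0" using gd_norm[OF xy] by linarith
    then have "ennreal \<bar>u x - u y\<bar> / geodist \<Omega> x y = ennreal (\<bar>u x - u y\<bar> / gd \<Omega> x y)"
      by (simp add: geodist_gd[OF xy] divide_ennreal)
    then show ?thesis using pos c by (simp add: pos_divide_le_eq)
  qed
  have "Lip_const (geodist \<Omega>) u F \<le> ennreal c \<longleftrightarrow>
     (\<forall>x\<in>F. \<forall>y\<in>F. x \<noteq> y \<longrightarrow> ennreal \<bar>u x - u y\<bar> / geodist \<Omega> x y \<le> ennreal c)"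
    unfolding Lip_const_def by (auto simp: SUP_le_iff)
  also have "\<dots> \<longleftrightarrow> (\<forall>x\<in>F. \<forall>y\<in>F. x \<noteq> y \<longrightarrow> \<bar>u x - u y\<bar> \<le> c * gd \<Omega> x y)" using q by blast
  also have "\<dots> \<longleftrightarrow> (\<forall>x\<in>F. \<forall>y\<in>F. \<bar>u x - u y\<bar> \<le> c * gd \<Omega> x y)"
    using c gd_nonneg by (metis abs_zero diff_self mult_nonneg_nonneg)
  finally show ?thesis .
qed

lemma amle_of_is_AMLE:
  assumes u: "is_AMLE \<Omega> \<O> g u"
  shows "amle u \<O>"
  unfolding amle_def
proof (intro conjI allI impI)
  show "continuous_on (closure \<Omega>) u" using u by (simp add: is_AMLE_def)
  fix V c
  assume V: "openin (top_of_set (closure \<Omega>)) V" "connected V" "V \<inter> \<O> = {}" and c: "(0::real) \<le> c"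
    and bd: "\<forall>x\<in>closure V - V. \<forall>y\<in>closure V - V. \<bar>u x - u y\<bar> \<le> c * gd \<Omega> x y"
  have VM: "V \<subseteq> closure \<Omega>" using V openin_imp_subset by blast
  then have clM: "closure V \<subseteq> closure \<Omega>" by (simp add: closure_minimal)
  have cl: "geotop \<Omega> closure_of V = closure V"
    using VM clM by (simp add: geotop_eq closure_of_subtopology inf_absorb2)
  have fr: "geotop \<Omega> frontier_of V = closure V - V"
    using V(1) cl by (simp add: frontier_of_def interior_of_openin geotop_eq)
  have "connectedin (geotop \<Omega>) V" using V(2) VM by (simp add: geotop_eq connectedin_subtopology)
  moreover have "openin (geotop \<Omega>) V" "V \<subseteq> closure \<Omega> - \<O>" using V VM by (auto simp: geotop_eq)
  ultimately have "Lip_const (geodist \<Omega>) u (geotop \<Omega> closure_of V) = Lip_const (geodist \<Omega>) u (geotop \<Omega> frontier_of V)"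
    using u unfolding is_AMLE_def by blast
  then have "Lip_const (geodist \<Omega>) u (closure V) = Lip_const (geodist \<Omega>) u (closure V - V)"
    unfolding cl fr .
  also have "\<dots> \<le> ennreal c" using bd clM c by (subst Lip_const_le_iff) auto
  finally show "\<forall>x\<in>closure V. \<forall>y\<in>closure V. \<bar>u x - u y\<bar> \<le> c * gd \<Omega> x y"
    using Lip_const_le_iff[OF clM c] by blast
qed

text \<open>The assumption concerns points of the open set \<open>\<Omega>\<close> at distance exactly \<open>h\<close>, but \<open>p\<close> and the curve may lie on
the boundary.  Choose \<open>v0\<close> in \<open>\<Omega>\<close> near \<open>p\<close> and a point of the curve at distance exactly \<open>h\<close> from \<open>v0\<close>.  Replacing
that point by a nearby point \<open>q\<close> of \<open>\<Omega>\<close> changes the distance slightly; this is corrected by moving \<open>v0\<close> on the line through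
\<open>q\<close> within a ball contained in \<open>\<Omega>\<close>.\<close>

lemma crossing_at_distance:
  assumes op: "open \<Omega>" and h: "h > 0"
    and exc: "\<And>x y. x \<in> \<Omega> \<Longrightarrow> y \<in> \<Omega> \<Longrightarrow> norm (x - y) = h \<Longrightarrow> gd \<Omega> x y \<le> h + F"
    and c: "continuous_on {a..b} c" "c ` {a..b} \<subseteq> closure \<Omega>" "a \<le> b" "c a = p"
    and far: "h < norm (c b - p)" and \<kappa>: "\<kappa> > 0"
  shows "\<exists>t\<in>{a..b::real}. gd \<Omega> p (c t) \<le> h + F + \<kappa> \<and> h - \<kappa> \<le> norm (c t - p)"
proof -
  define e where "e = min (min (\<kappa> / (3 * A)) (h / 2)) ((norm (c b - p) - h) / 2)"
  have e1: "e \<le> \<kappa> / (3 * A)" "e \<le> h / 2" "e \<le> (norm (c b - p) - h) / 2"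
    unfolding e_def by (rule min.coboundedI1[OF min.cobounded1] min.coboundedI1[OF min.cobounded2] min.cobounded2)+
  have "\<kappa> / (3 * A) > 0" using \<kappa> A1 by simp
  then have e0: "e > 0" unfolding e_def using h far by simp
  have e\<kappa>: "3 * A * e \<le> \<kappa>" using e1(1) A1 by (simp add: pos_le_divide_eq mult.commute)
  have "1 * e \<le> 3 * A * e" using A1 e0 by (intro mult_right_mono) auto
  then have e\<kappa>': "e \<le> \<kappa>" using e\<kappa> by linarith
  have pM: "p \<in> closure \<Omega>" using c by auto
  obtain v0 where v0: "v0 \<in> \<Omega>" "dist v0 p < e / 2" using pM e0 closure_approachable[of p \<Omega>] by (meson half_gt_zero)
  obtain \<rho>0 where \<rho>0: "\<rho>0 > 0" "ball v0 \<rho>0 \<subseteq> \<Omega>" using op v0(1) open_contains_ball by blast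
  define \<rho> where "\<rho> = min \<rho>0 (e / 2)"
  have \<rho>: "\<rho> > 0" "\<rho> \<le> e / 2" "ball v0 \<rho> \<subseteq> \<Omega>" using \<rho>0 e0 by (auto simp: \<rho>_def)
  have "\<exists>t. a \<le> t \<and> t \<le> b \<and> norm (c t - v0) = h"
  proof (rule IVT')
    show "norm (c a - v0) \<le> h" using v0(2) e1(2) h c(4) by (simp add: dist_norm norm_minus_commute)
    have "norm (c b - p) \<le> norm (c b - v0) + norm (v0 - p)" by (rule norm_diff_triangle_le) auto
    then show "h \<le> norm (c b - v0)" using v0(2) e1(3) e0 by (simp add: dist_norm)
    show "continuous_on {a..b} (\<lambda>t. norm (c t - v0))" by (intro continuous_intros c)
  qed (rule c)
  then obtain t where t: "t \<in> {a..b}" "norm (c t - v0) = h" by auto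
  have ctM: "c t \<in> closure \<Omega>" using c(2) t by blast
  obtain q where q: "q \<in> \<Omega>" "dist q (c t) < \<rho>" using ctM \<rho>(1) closure_approachable by blast
  define r where "r = norm (v0 - q)"
  have rh: "\<bar>r - h\<bar> < \<rho>"
    using norm_triangle_ineq3[of "v0 - q" "v0 - c t"] q(2) t(2) by (simp add: r_def dist_norm norm_minus_commute)
  have r0: "r > 0" using rh \<rho>(2) e1(2) h by linarith
  define v where "v = q + (h / r) *\<^sub>R (v0 - q)"
  have vq: "norm (v - q) = h" using r0 h by (simp add: v_def r_def)
  have "v - v0 = (h / r - 1) *\<^sub>R (v0 - q)" by (simp add: v_def algebra_simps)
  then have "norm (v - v0) = \<bar>h / r - 1\<bar> * r" by (simp add: r_def)
  also have "\<dots> = \<bar>h - r\<bar>" using r0 by (simp add: abs_mult_pos' field_simps flip: abs_mult_pos')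
  finally have vv: "norm (v - v0) < \<rho>" using rh by (simp add: abs_minus_commute)
  then have v\<Omega>: "v \<in> \<Omega>" using \<rho>(3) by (auto simp: dist_norm norm_minus_commute)
  have M: "v \<in> closure \<Omega>" "q \<in> closure \<Omega>" using v\<Omega> q closure_subset by auto
  have pv: "norm (p - v) \<le> e"
    using norm_diff_triangle_le[of p v0 "e / 2" v "e / 2"] v0(2) vv \<rho>(2) by (simp add: dist_norm norm_minus_commute)
  have "gd \<Omega> p (c t) \<le> gd \<Omega> p v + (gd \<Omega> v q + gd \<Omega> q (c t))"
    using gd_triangle[OF pM M(1) ctM] gd_triangle[OF M ctM] by simp
  moreover have "gd \<Omega> p v \<le> A * e"
  proof -
    have "A * norm (p - v) \<le> A * e" using pv A1 by (intro mult_left_mono) auto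
    then show ?thesis using gd_le_norm[OF pM M(1)] by linarith
  qed
  moreover have "gd \<Omega> v q \<le> h + F" using exc v\<Omega> q(1) vq by blast
  moreover have "gd \<Omega> q (c t) \<le> A * e"
  proof -
    have "A * norm (q - c t) \<le> A * e"
      using q(2) \<rho>(2) e0 A1 by (intro mult_left_mono) (auto simp: dist_norm)
    then show ?thesis using gd_le_norm[OF M(2) ctM] by linarith
  qed
  moreover have "A * e + A * e \<le> \<kappa>"
  proof -
    have "0 \<le> A * e" using A1 e0 by simp
    then show ?thesis using e\<kappa> by (simp only: mult.assoc)
  qed
  ultimately have "gd \<Omega> p (c t) \<le> h + F + \<kappa>" by linarith
  moreover have "h - \<kappa> \<le> norm (c t - p)"
  proof -
    have "norm (c t - v0) \<le> norm (c t - p) + norm (p - v0)" by (rule norm_diff_triangle_le) auto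
    then show ?thesis using t(2) v0(2) e\<kappa>' e0 by (simp add: dist_norm norm_minus_commute)
  qed
  ultimately show ?thesis using t(1) by blast
qed

end

text \<open>Nearby points satisfy the bound with constant \<open>2\<close>; for the others boundedness of the geodesic distance suffices.\<close>

lemma finite_geodist_of_domain:
  assumes dom: "domain_assumption \<Omega> \<phi> r" and \<Omega>: "connected \<Omega>" "bounded \<Omega>"
  obtains A where "finite_geodist \<Omega> A"
proof (cases "\<Omega> = {}")
  case True
  have "finite_geodist \<Omega> 1" by standard (use True in auto)
  then show ?thesis by (rule that)
next
  case False
  then obtain x0 where x0: "x0 \<in> closure \<Omega>" using closure_subset by blast
  obtain r0 where r0: "r0 > 0" "\<And>x y. x \<in> \<Omega> \<Longrightarrow> y \<in> \<Omega> \<Longrightarrow> norm (x - y) \<le> r0 \<Longrightarrow> geodist \<Omega> x y \<le> ennreal (2 * norm (x - y))"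
    using domain_local[OF dom] by blast
  have loc: "geodist \<Omega> x y \<le> ennreal (2 * norm (x - y))"
    if "x \<in> closure \<Omega>" "y \<in> closure \<Omega>" "norm (x - y) < r0" for x y
    using geodist_local[of \<Omega> r0, OF r0(2)] that by blast
  have fin: "geodist \<Omega> x y < top" if "x \<in> closure \<Omega>" "y \<in> closure \<Omega>" for x y
    using geodist_finite[of \<Omega> r0, OF loc r0(1) \<Omega>(1) that] by blast
  define D where "D x y = enn2real (geodist \<Omega> x y)" for x y
  have D: "geodist \<Omega> x y = ennreal (D x y)" if "x \<in> closure \<Omega>" "y \<in> closure \<Omega>" for x y
    using fin[OF that] by (simp add: D_def ennreal_enn2real)
  have D0: "D x y \<ge> 0" for x y by (simp add: D_def)
  have tri: "D x z \<le> D x y + D y z" if "x \<in> closure \<Omega>" "y \<in> closure \<Omega>" "z \<in> closure \<Omega>" for x y z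
    using geodist_triangle[of \<Omega> x z y] that D0 by (simp add: D flip: ennreal_plus)
  have sym: "D x y = D y x" for x y by (simp add: D_def geodist_sym)
  have near: "D x y \<le> 2 * norm (x - y)" if "x \<in> closure \<Omega>" "y \<in> closure \<Omega>" "norm (x - y) < r0" for x y
    using loc[OF that] D[OF that(1,2)] D0 by simp
  have "continuous_on (closure \<Omega>) (D x0)"
  proof (rule continuous_onI)
    fix y and e :: real assume y: "y \<in> closure \<Omega>" and e: "e > 0"
    show "\<exists>d>0. \<forall>z\<in>closure \<Omega>. dist z y < d \<longrightarrow> dist (D x0 z) (D x0 y) \<le> e"
    proof (intro exI[of _ "min r0 (e / 2)"] conjI ballI impI)
      show "min r0 (e / 2) > 0" using r0 e by simp
      fix z assume z: "z \<in> closure \<Omega>" "dist z y < min r0 (e / 2)"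
      then have "D z y \<le> e" using near[OF z(1) y] by (simp add: dist_norm)
      then show "dist (D x0 z) (D x0 y) \<le> e"
        using tri[OF x0 y z(1)] tri[OF x0 z(1) y] sym[of y z] by (simp add: dist_real_def)
    qed
  qed
  then have "bounded (D x0 ` closure \<Omega>)"
    using \<Omega>(2) by (intro compact_imp_bounded compact_continuous_image) (auto simp: compact_closure)
  then obtain B where "\<forall>z\<in>D x0 ` closure \<Omega>. norm z \<le> B" unfolding bounded_iff by blast
  then have B: "D x0 y \<le> B" if "y \<in> closure \<Omega>" for y using that by force
  have B0: "B \<ge> 0" using B[OF x0] D0[of x0 x0] by linarith
  define A where "A = max 2 (2 * B / r0)"
  have "D x y \<le> A * norm (x - y)" if xy: "x \<in> closure \<Omega>" "y \<in> closure \<Omega>" for x y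
  proof (cases "norm (x - y) < r0")
    case True
    have "2 * norm (x - y) \<le> A * norm (x - y)" by (intro mult_right_mono) (auto simp: A_def)
    then show ?thesis using near[OF xy True] by linarith
  next
    case False
    have "D x y \<le> D x0 x + D x0 y" using tri[OF xy(1) x0 xy(2)] sym[of x x0] by simp
    also have "\<dots> \<le> 2 * B" using B[OF xy(1)] B[OF xy(2)] by simp
    also have "\<dots> = 2 * B / r0 * r0" using r0(1) by simp
    also have "\<dots> \<le> A * norm (x - y)" using False r0(1) B0 by (intro mult_mono) (auto simp: A_def)
    finally show ?thesis .
  qed
  then have geo: "geodist \<Omega> x y \<le> ennreal (A * norm (x - y))" if "x \<in> closure \<Omega>" "y \<in> closure \<Omega>" for x y
    using D[OF that] that by (simp add: ennreal_leI)
  show ?thesis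
  proof (rule that, unfold_locales)
    show "bounded \<Omega>" by (rule \<Omega>)
    show "1 \<le> A" by (simp add: A_def)
  qed (rule geo)
qed

section \<open>The graph infinity Laplacian and the graph distance\<close>

text \<open>At a vertex off the labels an edge of maximal slope arriving from below is continued by an edge of the same slope,
because the largest slopes upwards and downwards agree.  The values increase strictly, so the walk ends at a label; the
rise along it is \<open>S\<close> times its length.\<close>

lemma steepest_ascent_reaches_label:
  fixes u :: "'a \<Rightarrow> real" and wt D :: "'a \<Rightarrow> 'a \<Rightarrow> real"
  assumes X: "finite X" and S: "S > 0"
    and balance: "\<And>x y. x \<in> X - L \<Longrightarrow> y \<in> X \<Longrightarrow> \<exists>z\<in>X. wt x y * (u x - u y) \<le> wt x z * (u z - u x)"
    and nonneg: "\<And>x y. wt x y \<ge> 0" and wsym: "\<And>x y. wt x y = wt y x"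
    and steep: "\<And>x y. x \<in> X \<Longrightarrow> y \<in> X \<Longrightarrow> wt x y * (u y - u x) \<le> S"
    and edge: "\<And>y z. y \<in> X \<Longrightarrow> z \<in> X \<Longrightarrow> wt y z > 0 \<Longrightarrow> D a z \<le> D a y + 1 / wt y z"
    and start: "x \<in> X" "y \<in> X" "wt x y * (u y - u x) = S" "S * D a y \<le> u y - u a"
  shows "\<exists>b\<in>X \<inter> L. S * D a b \<le> u b - u a \<and> u y \<le> u b"
  using start
proof (induction "card {z \<in> X. u y < u z}" arbitrary: x y rule: less_induct)
  case less
  show ?case
  proof (cases "y \<in> L")
    case True
    then show ?thesis using less.prems by blast
  next
    case False
    then obtain z where z: "z \<in> X" "wt y x * (u y - u x) \<le> wt y z * (u z - u y)"
      using balance[of y x] less.prems by blast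
    then have eq: "wt y z * (u z - u y) = S"
      using steep[of y z] less.prems wsym[of x y] by simp
    have pos: "wt y z > 0"
      using eq S nonneg[of y z] by (cases "wt y z = 0") auto
    have gap: "u z - u y = S * (1 / wt y z)" using eq pos by (simp add: field_simps)
    moreover have "S * (1 / wt y z) > 0" using S pos by simp
    ultimately have lt: "u y < u z" by linarith
    have "S * D a z \<le> S * (D a y + 1 / wt y z)"
      using edge[of y z] z less.prems pos S by (intro mult_left_mono) auto
    then have "S * D a z \<le> u z - u a" using gap less.prems by (simp add: algebra_simps)
    moreover have "card {w \<in> X. u z < u w} < card {w \<in> X. u y < u w}"
      using X lt z by (intro psubset_card_mono) auto
    ultimately obtain b where "b \<in> X \<inter> L" "S * D a b \<le> u b - u a" "u z \<le> u b"
      using less.hyps[of z y] z less.prems eq by blast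
    then show ?thesis using lt by force
  qed
qed

lemma balance_of_graph_equation:
  fixes u :: "'a \<Rightarrow> real"
  assumes X: "finite X" and y: "y \<in> X"
    and eq: "Min ((\<lambda>y. wt x y * (u y - u x)) ` X) + Max ((\<lambda>y. wt x y * (u y - u x)) ` X) = 0"
  shows "\<exists>z\<in>X. wt x y * (u x - u y) \<le> wt x z * (u z - u x)"
    and "\<exists>z\<in>X. wt x y * (u y - u x) \<le> wt x z * (u x - u z)"
proof -
  let ?f = "\<lambda>y. wt x y * (u y - u x)"
  have ne: "?f ` X \<noteq> {}" using y by blast
  obtain z where z: "z \<in> X" "Max (?f ` X) = ?f z" using Max_in[OF _ ne] X by auto
  obtain z' where z': "z' \<in> X" "Min (?f ` X) = ?f z'" using Min_in[OF _ ne] X by auto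
  have "Min (?f ` X) \<le> ?f y" "?f y \<le> Max (?f ` X)" using X y by auto
  then have "- ?f y \<le> ?f z" "?f y \<le> - ?f z'" using z(2) z'(2) eq by linarith+
  then show "\<exists>z\<in>X. wt x y * (u x - u y) \<le> wt x z * (u z - u x)"
    and "\<exists>z\<in>X. wt x y * (u y - u x) \<le> wt x z * (u x - u z)"
    using z(1) z'(1) by (force simp: algebra_simps)+
qed

text \<open>Extending an edge of maximal slope \<open>S\<close> by steepest ascent and descent gives two labels whose values differ by at least \<open>S\<close>
times their distance, so \<open>S\<close> is at most the Lipschitz constant of the labels.\<close>

lemma graph_lipschitz:
  fixes u :: "'a \<Rightarrow> real" and wt D :: "'a \<Rightarrow> 'a \<Rightarrow> real"
  assumes X: "finite X" and L: "L \<subseteq> X" and m: "m \<ge> 0"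
    and balance: "\<And>x y. x \<in> X - L \<Longrightarrow> y \<in> X \<Longrightarrow> \<exists>z\<in>X. wt x y * (u x - u y) \<le> wt x z * (u z - u x)"
      "\<And>x y. x \<in> X - L \<Longrightarrow> y \<in> X \<Longrightarrow> \<exists>z\<in>X. wt x y * (u y - u x) \<le> wt x z * (u x - u z)"
    and nonneg: "\<And>x y. wt x y \<ge> 0" and wsym: "\<And>x y. wt x y = wt y x"
    and D: "\<And>x. x \<in> X \<Longrightarrow> D x x = 0" "\<And>x y. x \<in> X \<Longrightarrow> y \<in> X \<Longrightarrow> D x y \<ge> 0"
      "\<And>x y. x \<in> X \<Longrightarrow> y \<in> X \<Longrightarrow> D x y = D y x"
    and edge: "\<And>x y z. x \<in> X \<Longrightarrow> y \<in> X \<Longrightarrow> z \<in> X \<Longrightarrow> wt y z > 0 \<Longrightarrow> D x z \<le> D x y + 1 / wt y z"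
    and bellman: "\<And>x y. x \<in> X \<Longrightarrow> y \<in> X \<Longrightarrow> x \<noteq> y \<Longrightarrow> \<exists>z\<in>X. wt z y > 0 \<and> D x y = D x z + 1 / wt z y"
    and lab: "\<And>a b. a \<in> L \<Longrightarrow> b \<in> L \<Longrightarrow> \<bar>u a - u b\<bar> \<le> m * D a b"
    and xy: "x \<in> X" "y \<in> X"
  shows "\<bar>u x - u y\<bar> \<le> m * D x y"
proof -
  define S where "S = Max ((\<lambda>(x, y). wt x y * (u y - u x)) ` (X \<times> X))"
  have steep: "wt x y * (u y - u x) \<le> S" if "x \<in> X" "y \<in> X" for x y
    unfolding S_def using X that by (intro Max_ge) auto
  have "S \<le> m"
  proof (rule ccontr)
    assume "\<not> S \<le> m"
    then have Sm: "S > m" "S > 0" using m by auto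
    have "S \<in> (\<lambda>(x, y). wt x y * (u y - u x)) ` (X \<times> X)"
      unfolding S_def using X xy by (intro Max_in) auto
    then obtain p q where pq: "p \<in> X" "q \<in> X" "wt p q * (u q - u p) = S" by auto
    have wpos: "wt p q > 0" using pq Sm nonneg[of p q] by (cases "wt p q = 0") auto
    have gap: "u q - u p = S * (1 / wt p q)" using pq wpos by (simp add: field_simps)
    have D_pq: "D q p \<le> 1 / wt p q" using edge[of q q p] pq wpos wsym[of p q] D(1)[of q] by simp
    have down: "S * D q p \<le> u q - u p" unfolding gap using D_pq Sm by (intro mult_left_mono) auto
    have "\<exists>a\<in>X \<inter> L. S * D q a \<le> (- u a) - (- u q) \<and> - u p \<le> - u a"
    proof (intro steepest_ascent_reaches_label[where wt = wt and x = q and y = p])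
      show "\<exists>z\<in>X. wt x y * (- u x - - u y) \<le> wt x z * (- u z - - u x)" if "x \<in> X - L" "y \<in> X" for x y
        using balance(2)[OF that] by (simp add: algebra_simps)
      show "wt x y * (- u y - - u x) \<le> S" if "x \<in> X" "y \<in> X" for x y
        using steep[of y x] that wsym[of x y] by (simp add: algebra_simps)
      show "wt q p * (- u p - - u q) = S" using pq wsym[of p q] by (simp add: algebra_simps)
      show "D q z \<le> D q y + 1 / wt y z" if "y \<in> X" "z \<in> X" "wt y z > 0" for y z
        using edge[OF pq(2) that] .
      show "S * D q p \<le> - u p - - u q" using down by simp
      show "S > 0" by fact
    qed (fact X nonneg wsym pq(1,2))+
    then obtain a where a': "a \<in> X" "a \<in> L" "S * D q a \<le> u q - u a" "u a \<le> u p" by fastforce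
    have a: "a \<in> X" "a \<in> L" "S * D a q \<le> u q - u a" "u a \<le> u p"
      using a' D(3)[OF pq(2) a'(1)] by simp_all
    have "\<exists>b\<in>X \<inter> L. S * D a b \<le> u b - u a \<and> u q \<le> u b"
    proof (rule steepest_ascent_reaches_label[where wt = wt and x = p and y = q])
      show "D a z \<le> D a y + 1 / wt y z" if "y \<in> X" "z \<in> X" "wt y z > 0" for y z
        using edge[OF a(1) that] .
    qed (fact X Sm(2) balance(1) nonneg wsym steep pq a(3))+
    then obtain b where b: "b \<in> X" "b \<in> L" "S * D a b \<le> u b - u a" "u q \<le> u b" by blast
    have "S * (1 / wt p q) > 0" using Sm wpos by simp
    then have "u p < u q" using gap by linarith
    then have "a \<noteq> b" using a b by auto
    then obtain z where "z \<in> X" "wt z b > 0" "D a b = D a z + 1 / wt z b" using bellman a b by blast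
    then have "D a b > 0" using D(2)[of a z] a by (simp add: add_nonneg_pos)
    then have "m * D a b < S * D a b" using Sm by simp
    then show False using b(3) lab[of a b] a b by linarith
  qed
  have slope: "\<bar>u y - u z\<bar> \<le> m * (1 / wt z y)" if "y \<in> X" "z \<in> X" "wt z y > 0" for y z
  proof -
    have "wt z y * (u y - u z) \<le> m" "wt z y * (u z - u y) \<le> m"
      using steep[OF that(2,1)] steep[OF that(1,2)] \<open>S \<le> m\<close> wsym[of z y] by auto
    then have "wt z y * \<bar>u y - u z\<bar> \<le> m" by (cases "u y \<le> u z") simp_all
    then show ?thesis using that by (simp add: pos_le_divide_eq mult.commute)
  qed
  show ?thesis using xy(2)
  proof (induction "card {z \<in> X. D x z < D x y}" arbitrary: y rule: less_induct)
    case less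
    show ?case
    proof (cases "y = x")
      case True
      then show ?thesis using D(1)[OF xy(1)] by simp
    next
      case False
      then obtain z where z: "z \<in> X" "wt z y > 0" "D x y = D x z + 1 / wt z y"
        using bellman[OF xy(1) less.prems] by metis
      then have lt: "D x z < D x y" by simp
      \<comment> \<open>The Bellman recursion terminates because the predecessor is strictly closer to \<open>x\<close>.\<close>
      have "{w \<in> X. D x w < D x z} \<subset> {w \<in> X. D x w < D x y}"
        using lt z(1) by fastforce
      then have "card {w \<in> X. D x w < D x z} < card {w \<in> X. D x w < D x y}"
        using X by (intro psubset_card_mono) simp_all
      then have "\<bar>u x - u z\<bar> \<le> m * D x z" by (rule less.hyps[OF _ z(1)])
      then show ?thesis using slope[OF less.prems z(1,2)] unfolding z(3) distrib_left by linarith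
    qed
  qed
qed

text \<open>At a maximum point \<open>p\<close> of \<open>u - C\<close> that is closest to \<open>x\<close>, the optimal path from \<open>x\<close> arrives through a vertex \<open>z0\<close> where
\<open>u - C\<close> is strictly smaller; so \<open>u\<close> descends from \<open>p\<close> to \<open>z0\<close> with slope larger than \<open>a\<close>, and by the graph equation it
ascends from \<open>p\<close> with slope larger than \<open>a\<close>.  This leads to a larger value of \<open>u - C\<close>.  Edges may leave the ball of radius
\<open>R\<close>, but only by \<open>\<rho>\<close>; there \<open>C \<ge> T \<ge> u\<close>.\<close>

lemma graph_cone_comparison:
  fixes u :: "'a \<Rightarrow> real" and wt D :: "'a \<Rightarrow> 'a \<Rightarrow> real"
  assumes X: "finite X" and x: "x \<in> X" and R: "R > 0"
    and balance: "\<And>x y. x \<in> X - L \<Longrightarrow> y \<in> X \<Longrightarrow> \<exists>z\<in>X. wt x y * (u x - u y) \<le> wt x z * (u z - u x)"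
    and nonneg: "\<And>x y. wt x y \<ge> 0" and wsym: "\<And>x y. wt x y = wt y x"
    and D: "D x x = 0" 
    and edge: "\<And>y z. y \<in> X \<Longrightarrow> z \<in> X \<Longrightarrow> wt y z > 0 \<Longrightarrow> D x z \<le> D x y + 1 / wt y z"
    and bellman: "\<And>y. y \<in> X \<Longrightarrow> x \<noteq> y \<Longrightarrow> \<exists>z\<in>X. wt z y > 0 \<and> D x y = D x z + 1 / wt z y"
    and jump: "\<And>y z. y \<in> X \<Longrightarrow> z \<in> X \<Longrightarrow> wt y z > 0 \<Longrightarrow> D x z \<le> D x y + \<rho>" and \<rho>: "\<rho> \<ge> 0"
    and free: "\<And>y. y \<in> X \<Longrightarrow> y \<noteq> x \<Longrightarrow> D x y < R \<Longrightarrow> y \<notin> L"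
    and T: "\<And>y. y \<in> X \<Longrightarrow> D x y \<le> R + \<rho> \<Longrightarrow> u y \<le> T"
    and y: "y \<in> X" "D x y \<le> R"
  shows "u y \<le> u x + (T - u x) / R * D x y"
proof (rule ccontr)
  assume contr: "\<not> ?thesis"
  define a where "a = (T - u x) / R"
  define C where "C y = u x + a * D x y" for y
  have Tx: "u x \<le> T" using T[OF x] D R \<rho> by simp
  then have a0: "a \<ge> 0" using R by (simp add: a_def)
  have C_out: "T \<le> C z" if "D x z \<ge> R" for z
  proof -
    have "a * R \<le> a * D x z" using that a0 by (intro mult_left_mono)
    then show ?thesis using R by (simp add: C_def a_def)
  qed
  define Y where "Y = {y \<in> X. D x y < R}"
  have yC: "u y > C y" using contr by (simp add: C_def a_def)
  have yY: "y \<in> Y"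
    using y yC C_out[of y] T[OF y(1)] \<rho> by (fastforce simp: Y_def)
  define mx where "mx = Max ((\<lambda>z. u z - C z) ` Y)"
  have finY: "finite Y" using X by (simp add: Y_def)
  have mx: "u z - C z \<le> mx" if "z \<in> Y" for z unfolding mx_def using finY that by simp
  have mx0: "mx > 0" using mx[OF yY] yC by simp
  have "mx \<in> (\<lambda>z. u z - C z) ` Y" unfolding mx_def using finY yY by (intro Max_in) auto
  then have "{z \<in> Y. u z - C z = mx} \<noteq> {}" by auto
  then obtain p where p: "p \<in> Y" "u p - C p = mx"
    and pmin: "\<And>z. z \<in> Y \<Longrightarrow> u z - C z = mx \<Longrightarrow> D x p \<le> D x z"
    using ex_min_if_finite[of "D x ` {z \<in> Y. u z - C z = mx}"] finY
    by (fastforce simp: not_less)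
  have px: "p \<noteq> x" using p mx0 D by (auto simp: C_def)
  have pX: "p \<in> X" using p by (simp add: Y_def)
  obtain z0 where z0: "z0 \<in> X" "wt z0 p > 0" "D x p = D x z0 + 1 / wt z0 p"
    using bellman[OF pX] px by blast
  have lt: "D x z0 < D x p" using z0 by simp
  then have z0Y: "z0 \<in> Y" using p(1) z0(1) unfolding Y_def by fastforce
  have "u z0 - C z0 < mx" using mx[OF z0Y] pmin[OF z0Y] lt by fastforce
  then have "u p - u z0 > a * (1 / wt z0 p)" using p z0(3) by (simp add: C_def algebra_simps)
  then have st: "wt p z0 * (u p - u z0) > a" using z0(2) wsym[of z0 p] by (simp add: field_simps)
  have "p \<notin> L" using free[OF pX px] p by (simp add: Y_def)
  then obtain z where z: "z \<in> X" "wt p z0 * (u p - u z0) \<le> wt p z * (u z - u p)"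
    using balance[of p z0] pX z0 by blast
  have wz: "wt p z > 0" using z st a0 nonneg[of p z] by (cases "wt p z = 0") auto
  then have "u z - u p > a * (1 / wt p z)" using z st by (simp add: field_simps)
  moreover have "a * D x z \<le> a * (D x p + 1 / wt p z)"
    using edge[OF pX z(1) wz] a0 by (intro mult_left_mono)
  ultimately have big: "u z - C z > mx" using p by (simp add: C_def algebra_simps)
  show False
  proof (cases "D x z < R")
    case True
    then show False using mx[of z] z big by (simp add: Y_def)
  next
    case False
    moreover have "D x z \<le> R + \<rho>" using jump[OF pX z(1) wz] p by (simp add: Y_def)
    ultimately show False using T[OF z(1)] C_out[of z] big mx0 by simp
  qed
qed

definition hop_cost :: "(real \<Rightarrow> real) \<Rightarrow> real \<Rightarrow> 'a::euclidean_space \<Rightarrow> 'a \<Rightarrow> ennreal" where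
  "hop_cost \<eta> h x y = inverse (ennreal (weight \<eta> h x y))"

lemma weight_sym: "weight \<eta> h x y = weight \<eta> h y x"
  by (simp add: weight_def norm_minus_commute)

lemma graphdist_le_path:
  fixes N :: nat
  assumes "\<And>i. i \<le> N \<Longrightarrow> p i \<in> X"
  shows "graphdist \<eta> h X (p 0) (p N) \<le> (\<Sum>i=1..N. hop_cost \<eta> h (p (i - 1)) (p i))"
proof (cases "p 0 = p N")
  case False
  then show ?thesis
    using assms unfolding graphdist_def hop_cost_def
    by (simp only: if_False) (rule Inf_lower, rule CollectI, rule exI[of _ N], rule exI[of _ p], auto)
qed (simp add: graphdist_def)

lemma graphdist_path_less:
  assumes "graphdist \<eta> h X x y < c" "x \<in> X"
  shows "\<exists>(N::nat) p. (\<forall>i\<le>N. p i \<in> X) \<and> p 0 = x \<and> p N = y \<and>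
    (\<Sum>i=1..N. hop_cost \<eta> h (p (i - 1)) (p i)) < c"
proof (cases "x = y")
  case True
  then show ?thesis using assms by (intro exI[of _ 0] exI[of _ "\<lambda>_. x"]) (simp add: graphdist_def)
next
  case False
  then show ?thesis using assms unfolding graphdist_def hop_cost_def by (auto simp: Inf_less_iff)
qed

lemma graphdist_refl: "graphdist \<eta> h X x x = 0"
  by (simp add: graphdist_def)

lemma graphdist_hop: "x \<in> X \<Longrightarrow> y \<in> X \<Longrightarrow> graphdist \<eta> h X x y \<le> hop_cost \<eta> h x y"
  using graphdist_le_path[of "Suc 0" "\<lambda>i. if i = 0 then x else y" X \<eta> h] by (simp split: if_splits)

lemma graphdist_triangle:
  assumes "x \<in> X" "y \<in> X"
  shows "graphdist \<eta> h X x z \<le> graphdist \<eta> h X x y + graphdist \<eta> h X y z"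
proof (rule ennreal_le_epsilon)
  fix e :: real assume e: "0 < e" and fin: "graphdist \<eta> h X x y + graphdist \<eta> h X y z < top"
  have "graphdist \<eta> h X x y < graphdist \<eta> h X x y + ennreal (e / 2)"
    "graphdist \<eta> h X y z < graphdist \<eta> h X y z + ennreal (e / 2)"
    using fin e by (auto intro!: ennreal_add_left_cancel_less[THEN iffD2, of _ 0, simplified] simp: less_top)
  note less = graphdist_path_less[OF this(1) assms(1)] graphdist_path_less[OF this(2) assms(2)]
  obtain N :: nat and p :: "nat \<Rightarrow> 'a" where
    p: "\<And>i. i \<le> N \<Longrightarrow> p i \<in> X" "p 0 = x" "p N = y"
      "(\<Sum>i=1..N. hop_cost \<eta> h (p (i - 1)) (p i)) < graphdist \<eta> h X x y + ennreal (e / 2)"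
    using less(1) by blast
  obtain K :: nat and q :: "nat \<Rightarrow> 'a" where
    q: "\<And>i. i \<le> K \<Longrightarrow> q i \<in> X" "q 0 = y" "q K = z"
      "(\<Sum>i=1..K. hop_cost \<eta> h (q (i - 1)) (q i)) < graphdist \<eta> h X y z + ennreal (e / 2)"
    using less(2) by blast
  define r where "r i = (if i \<le> N then p i else q (i - N))" for i
  have "graphdist \<eta> h X (r 0) (r (N + K)) \<le> (\<Sum>i=1..N+K. hop_cost \<eta> h (r (i - 1)) (r i))"
    using p(1) q(1) by (intro graphdist_le_path) (auto simp: r_def)
  also have "\<dots> = (\<Sum>i=1..N. hop_cost \<eta> h (r (i - 1)) (r i)) + (\<Sum>i=N+1..N+K. hop_cost \<eta> h (r (i - 1)) (r i))"
    by (subst sum.ub_add_nat) auto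
  also have "(\<Sum>i=1..N. hop_cost \<eta> h (r (i - 1)) (r i)) = (\<Sum>i=1..N. hop_cost \<eta> h (p (i - 1)) (p i))"
    by (intro sum.cong) (auto simp: r_def)
  also have "(\<Sum>i=N+1..N+K. hop_cost \<eta> h (r (i - 1)) (r i)) = (\<Sum>i=1..K. hop_cost \<eta> h (q (i - 1)) (q i))"
  proof -
    have r: "r (i + N) = q i" for i using p(3) q(2) by (cases i) (auto simp: r_def)
    have "(\<Sum>i=N+1..N+K. hop_cost \<eta> h (r (i - 1)) (r i)) = (\<Sum>i=1+N..K+N. hop_cost \<eta> h (r (i - 1)) (r i))"
      by (simp add: add.commute)
    also have "\<dots> = (\<Sum>i=1..K. hop_cost \<eta> h (r (i + N - 1)) (r (i + N)))"
      by (rule sum.shift_bounds_cl_nat_ivl)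
    also have "\<dots> = (\<Sum>i=1..K. hop_cost \<eta> h (q (i - 1)) (q i))"
    proof (rule sum.cong)
      fix i assume "i \<in> {1..K}"
      then have "i + N - 1 = (i - 1) + N" by simp
      then show "hop_cost \<eta> h (r (i + N - 1)) (r (i + N)) = hop_cost \<eta> h (q (i - 1)) (q i)" by (simp only: r)
    qed simp
    finally show ?thesis .
  qed
  also have "(\<Sum>i=1..N. hop_cost \<eta> h (p (i - 1)) (p i)) + (\<Sum>i=1..K. hop_cost \<eta> h (q (i - 1)) (q i))
     \<le> (graphdist \<eta> h X x y + ennreal (e / 2)) + (graphdist \<eta> h X y z + ennreal (e / 2))"
    using p(4) q(4) by (intro add_mono) auto
  also have "\<dots> = graphdist \<eta> h X x y + graphdist \<eta> h X y z + ennreal e"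
  proof -
    have "ennreal (e / 2) + ennreal (e / 2) = ennreal e" using e by (simp flip: ennreal_plus)
    moreover have "(a + b) + (c + b) = a + c + (b + b)" for a b c :: ennreal by (simp add: ac_simps)
    ultimately show ?thesis by simp
  qed
  finally show "graphdist \<eta> h X x z \<le> graphdist \<eta> h X x y + graphdist \<eta> h X y z + ennreal e"
    using p q by (cases "K = 0") (auto simp: r_def)
qed

lemma graphdist_sym_le:
  assumes "x \<in> X"
  shows "graphdist \<eta> h X y x \<le> graphdist \<eta> h X x y"
proof (rule ennreal_le_epsilon)
  fix e :: real assume e: "0 < e" and fin: "graphdist \<eta> h X x y < top"
  have "graphdist \<eta> h X x y < graphdist \<eta> h X x y + ennreal e"
    using fin e by (auto intro!: ennreal_add_left_cancel_less[THEN iffD2, of _ 0, simplified] simp: less_top)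
  then obtain N :: nat and p where
    p: "\<And>i. i \<le> N \<Longrightarrow> p i \<in> X" "p 0 = x" "p N = y"
      "(\<Sum>i=1..N. hop_cost \<eta> h (p (i - 1)) (p i)) < graphdist \<eta> h X x y + ennreal e"
    using graphdist_path_less[OF _ assms] by blast
  have "graphdist \<eta> h X (p (N - 0)) (p (N - N)) \<le> (\<Sum>i=1..N. hop_cost \<eta> h (p (N - (i - 1))) (p (N - i)))"
    using p(1) by (intro graphdist_le_path[where p = "\<lambda>i. p (N - i)"]) auto
  also have "\<dots> = (\<Sum>i=1..N. hop_cost \<eta> h (p (i - 1)) (p i))"
    by (rule sum.reindex_bij_witness[of _ "\<lambda>i. N + 1 - i" "\<lambda>i. N + 1 - i"])
       (auto simp: hop_cost_def weight_sym Suc_diff_le)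
  finally show "graphdist \<eta> h X y x \<le> graphdist \<eta> h X x y + ennreal e" using p by simp
qed

lemma graphdist_sym: "x \<in> X \<Longrightarrow> y \<in> X \<Longrightarrow> graphdist \<eta> h X y x = graphdist \<eta> h X x y"
  by (intro antisym graphdist_sym_le)

lemma graphdist_bellman:
  assumes X: "finite X" "x \<in> X" "y \<in> X" "x \<noteq> y"
  shows "\<exists>z\<in>X. graphdist \<eta> h X x z + hop_cost \<eta> h z y \<le> graphdist \<eta> h X x y"
proof -
  let ?f = "\<lambda>z. graphdist \<eta> h X x z + hop_cost \<eta> h z y"
  have "Min (?f ` X) \<in> ?f ` X" using X by (intro Min_in) auto
  then obtain z where z: "z \<in> X" "Min (?f ` X) = ?f z" by auto
  have "?f z \<le> graphdist \<eta> h X x y"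
  proof (rule ccontr)
    assume "\<not> ?thesis"
    then have "graphdist \<eta> h X x y < ?f z" by simp
    then obtain N :: nat and p where p: "\<And>i. i \<le> N \<Longrightarrow> p i \<in> X" "p 0 = x" "p N = y"
      "(\<Sum>i=1..N. hop_cost \<eta> h (p (i - 1)) (p i)) < ?f z"
      using graphdist_path_less[OF _ X(2)] by blast
    obtain K where K: "N = Suc K" using p X by (cases N) auto
    have "graphdist \<eta> h X x (p K) \<le> (\<Sum>i=1..K. hop_cost \<eta> h (p (i - 1)) (p i))"
      using graphdist_le_path[of K p X \<eta> h] p K by auto
    then have "?f (p K) \<le> (\<Sum>i=1..N. hop_cost \<eta> h (p (i - 1)) (p i))"
      using K p(3) by (auto intro: add_mono)
    moreover have "?f z \<le> ?f (p K)" unfolding z(2)[symmetric] using X p(1)[of K] K by (intro Min_le) auto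
    ultimately show False using p(4) by simp
  qed
  then show ?thesis using z by blast
qed

text \<open>The normalization of the weights makes every hop at least as expensive as its length; hops of length at
most \<open>t\<^sub>0 h\<close> cost at most \<open>t\<^sub>0 h\<close>.\<close>

lemma kernel_weight:
  assumes k: "kernel_assumption \<eta> t\<^sub>0" and h: "h > 0"
  shows weight_nonneg: "weight \<eta> h x y \<ge> 0"
    and weight_pos_near: "weight \<eta> h x y > 0 \<Longrightarrow> norm (x - y) \<le> h"
    and weight_pos_cost: "weight \<eta> h x y > 0 \<Longrightarrow> norm (x - y) \<le> 1 / weight \<eta> h x y"
    and weight_short: "x \<noteq> y \<Longrightarrow> norm (x - y) \<le> t\<^sub>0 * h \<Longrightarrow> 1 / (t\<^sub>0 * h) \<le> weight \<eta> h x y"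
proof -
  note K = k[unfolded kernel_assumption_def]
  have s: "sigma_eta \<eta> > 0" using K by blast
  have t0: "t\<^sub>0 > 0" "t\<^sub>0 \<le> 1" "sigma_eta \<eta> = t\<^sub>0 * \<eta> t\<^sub>0" using K by auto
  have le: "t * \<eta> t \<le> sigma_eta \<eta>" if "t > 0" for t
    unfolding sigma_eta_def using K that by (intro cSUP_upper) auto
  show nn: "weight \<eta> h x y \<ge> 0" for x y
    using K s h by (auto simp: weight_def eta_scaled_def)
  show "norm (x - y) \<le> h" if "weight \<eta> h x y > 0"
  proof (rule ccontr)
    assume "\<not> ?thesis"
    then have "norm (x - y) / h > 1" using h by simp
    then have "\<eta> (norm (x - y) / h) = 0" using K by blast
    then show False using that by (auto simp: weight_def eta_scaled_def split: if_splits)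
  qed
  show "norm (x - y) \<le> 1 / weight \<eta> h x y" if w: "weight \<eta> h x y > 0"
  proof -
    have ne: "x \<noteq> y" using w by (auto simp: weight_def)
    have eq: "weight \<eta> h x y = \<eta> (norm (x - y) / h) / (sigma_eta \<eta> * h)"
      using ne by (simp add: weight_def eta_scaled_def)
    have "norm (x - y) / h * \<eta> (norm (x - y) / h) \<le> sigma_eta \<eta>" using ne h by (intro le) simp
    then have "norm (x - y) * weight \<eta> h x y \<le> 1" using s h by (simp add: eq field_simps)
    then show ?thesis using w by (simp add: field_simps)
  qed
  show "1 / (t\<^sub>0 * h) \<le> weight \<eta> h x y" if "x \<noteq> y" "norm (x - y) \<le> t\<^sub>0 * h"
  proof -
    have "\<eta> t\<^sub>0 \<le> \<eta> (norm (x - y) / h)"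
      using K that h t0 by (intro monotone_onD[of "{0<..}" "(\<le>)" "(\<ge>)" \<eta>]) (auto simp: field_simps)
    moreover have "\<eta> t\<^sub>0 = sigma_eta \<eta> / t\<^sub>0" using t0 by simp
    ultimately have "sigma_eta \<eta> / t\<^sub>0 / (sigma_eta \<eta> * h) \<le> \<eta> (norm (x - y) / h) / (sigma_eta \<eta> * h)"
      using s h by (intro divide_right_mono) auto
    also have "sigma_eta \<eta> / t\<^sub>0 / (sigma_eta \<eta> * h) = 1 / (t\<^sub>0 * h)" using s by simp
    finally show ?thesis using that by (simp add: weight_def eta_scaled_def)
  qed
qed

lemma hop_cost_pos:
  assumes "weight \<eta> h x y > 0"
  shows "hop_cost \<eta> h x y = ennreal (1 / weight \<eta> h x y)"
  using assms by (simp add: hop_cost_def inverse_ennreal inverse_eq_divide)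

lemma hop_cost_zero: "weight \<eta> h x y = 0 \<Longrightarrow> hop_cost \<eta> h x y = top"
  by (simp add: hop_cost_def)

lemma graphdist_short:
  assumes k: "kernel_assumption \<eta> t\<^sub>0" and h: "h > 0"
    and xy: "x \<in> X" "y \<in> X" "norm (x - y) \<le> t\<^sub>0 * h"
  shows "graphdist \<eta> h X x y \<le> ennreal (t\<^sub>0 * h)"
proof (cases "x = y")
  case True
  then show ?thesis by (simp add: graphdist_refl)
next
  case False
  have t0: "t\<^sub>0 > 0" using k by (auto simp: kernel_assumption_def)
  have w: "1 / (t\<^sub>0 * h) \<le> weight \<eta> h x y" using weight_short[OF k h False xy(3)] .
  moreover have "1 / (t\<^sub>0 * h) > 0" using t0 h by simp
  ultimately have p: "weight \<eta> h x y > 0" by linarith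
  have "1 / weight \<eta> h x y \<le> t\<^sub>0 * h" using w p t0 h by (simp add: field_simps)
  then have "hop_cost \<eta> h x y \<le> ennreal (t\<^sub>0 * h)" by (simp add: hop_cost_pos[OF p] ennreal_leI)
  then show ?thesis using graphdist_hop[OF xy(1,2), of \<eta> h] by simp
qed

lemma graphdist_lower:
  assumes k: "kernel_assumption \<eta> t\<^sub>0" and h: "h > 0" and x: "x \<in> X"
    and len: "\<And>N p. (\<And>i. i \<le> N \<Longrightarrow> p i \<in> X) \<Longrightarrow> p 0 = x \<Longrightarrow> p N = y \<Longrightarrow>
      (\<And>i. i < N \<Longrightarrow> norm (p i - p (Suc i)) \<le> h) \<Longrightarrow> F \<le> (\<Sum>i<N. norm (p i - p (Suc i)))"
  shows "ennreal F \<le> graphdist \<eta> h X x y"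
proof (rule ccontr)
  assume "\<not> ?thesis"
  then have "graphdist \<eta> h X x y < ennreal F" by simp
  then obtain N :: nat and p where p: "\<And>i. i \<le> N \<Longrightarrow> p i \<in> X" "p 0 = x" "p N = y"
      "(\<Sum>i=1..N. hop_cost \<eta> h (p (i - 1)) (p i)) < ennreal F"
    using graphdist_path_less[OF _ x] by blast
  have sum: "(\<Sum>i=1..N. hop_cost \<eta> h (p (i - 1)) (p i)) = (\<Sum>i<N. hop_cost \<eta> h (p i) (p (Suc i)))"
    by (rule sum.reindex_bij_witness[of _ Suc "\<lambda>i. i - 1"]) auto
  have wpos: "weight \<eta> h (p i) (p (Suc i)) > 0" if "i < N" for i
  proof (rule ccontr)
    assume "\<not> ?thesis"
    then have "weight \<eta> h (p i) (p (Suc i)) = 0" using weight_nonneg[OF k h, of "p i" "p (Suc i)"] by simp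
    then have "hop_cost \<eta> h (p i) (p (Suc i)) = top" by (rule hop_cost_zero)
    then have "(\<Sum>i<N. hop_cost \<eta> h (p i) (p (Suc i))) = top"
      using that member_le_sum[of i "{..<N}" "\<lambda>i. hop_cost \<eta> h (p i) (p (Suc i))"] by (simp add: top_unique)
    then show False using p(4) unfolding sum by (simp only: not_top_less)
  qed
  have "F \<le> (\<Sum>i<N. norm (p i - p (Suc i)))"
  proof (rule len)
    show "norm (p i - p (Suc i)) \<le> h" if "i < N" for i
      using weight_pos_near[OF k h wpos[OF that]] .
  qed (use p(1-3) in auto)
  also have "\<dots> \<le> (\<Sum>i<N. 1 / weight \<eta> h (p i) (p (Suc i)))"
    by (rule sum_mono, rule weight_pos_cost[OF k h], rule wpos, simp)
  finally have "ennreal F \<le> ennreal (\<Sum>i<N. 1 / weight \<eta> h (p i) (p (Suc i)))" by (rule ennreal_leI)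
  also have "\<dots> = (\<Sum>i<N. ennreal (1 / weight \<eta> h (p i) (p (Suc i))))"
    by (rule sum_ennreal[symmetric]) (simp add: weight_nonneg[OF k h])
  also have "\<dots> = (\<Sum>i<N. hop_cost \<eta> h (p i) (p (Suc i)))"
    by (rule sum.cong) (simp_all add: hop_cost_pos wpos)
  finally show False using p(4) unfolding sum by (meson leD)
qed

section \<open>Comparison for the nonlocal infinity Laplacian\<close>

text \<open>Compare \<open>v\<close> with \<open>q \<circ> w\<close> for the concave function \<open>q\<close>, which is increasing on the range of \<open>w\<close>.  If \<open>A\<close> and \<open>I\<close> are the
supremum and infimum of \<open>w\<close> over a neighbourhood of \<open>y\<close>, then \<open>2 q (w y) \<ge> q A + q I + \<kappa> (A - I)\<^sup>2 / 4\<close>, and \<open>A - I \<ge> \<theta>\<close>.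
At an almost maximum point of \<open>v - q \<circ> w\<close> the increments of \<open>v\<close> are bounded by those of \<open>q \<circ> w\<close>, and the gain
contradicts \<open>E < \<kappa> \<theta>\<^sup>2 / 4\<close>.  Suprema are only approached, not attained, whence the slack \<open>\<iota>\<close>.\<close>

lemma nonlocal_comparison:
  fixes M :: "'a set" and N :: "'a \<Rightarrow> 'a set" and v w :: "'a \<Rightarrow> real"
  assumes N: "\<And>x. x \<in> M \<Longrightarrow> x \<in> N x \<and> N x \<subseteq> M"
    and v: "\<And>x. x \<in> M \<Longrightarrow> \<bar>v x\<bar> \<le> Q"
    and w: "\<And>x. x \<in> M \<Longrightarrow> m \<le> w x \<and> w x \<le> m + S"
    and \<kappa>: "\<kappa> > 0" "\<kappa> * S \<le> 1" and \<theta>: "\<theta> \<ge> 0" "E < \<kappa> * \<theta>\<^sup>2 / 4"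
    and sub: "\<And>x. x \<in> M - B \<Longrightarrow> 2 * v x \<le> (SUP y\<in>N x. v y) + (INF y\<in>N x. v y) + E"
    and super: "\<And>x. x \<in> M - B \<Longrightarrow> (SUP y\<in>N x. w y) + (INF y\<in>N x. w y) \<le> 2 * w x"
    and slope: "\<And>x. x \<in> M - B \<Longrightarrow> (INF y\<in>N x. w y) \<le> w x - \<theta>"
    and bd: "\<And>x. x \<in> M \<inter> B \<Longrightarrow> v x - w x \<le> b"
    and x: "x \<in> M"
  shows "v x - w x \<le> b + \<kappa> * S\<^sup>2 / 2"
proof (rule ccontr)
  assume contr: "\<not> v x - w x \<le> b + \<kappa> * S\<^sup>2 / 2"
  define q where "q t = t - \<kappa> / 2 * (t - m)\<^sup>2" for t
  define F where "F y = v y - q (w y)" for y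
  have S0: "S \<ge> 0" using w[OF x] by simp
  have q_le: "q t \<le> t" for t using \<kappa> by (simp add: q_def)
  have q_ge: "q t \<ge> t - \<kappa> * S\<^sup>2 / 2" if "m \<le> t" "t \<le> m + S" for t
  proof -
    have "(t - m)\<^sup>2 \<le> S\<^sup>2" using that by (intro power_mono) auto
    then have "\<kappa> / 2 * (t - m)\<^sup>2 \<le> \<kappa> / 2 * S\<^sup>2" using \<kappa> by (intro mult_left_mono) auto
    then show ?thesis by (simp add: q_def)
  qed
  have q_diff: "q t - q s = (t - s) * (1 - \<kappa> / 2 * ((t - m) + (s - m)))" for s t
    by (simp add: q_def power2_eq_square) algebra
  have q_fac: "0 \<le> 1 - \<kappa> / 2 * ((t - m) + (s - m))" "1 - \<kappa> / 2 * ((t - m) + (s - m)) \<le> 1"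
    if "m \<le> s" "s \<le> m + S" "m \<le> t" "t \<le> m + S" for s t
  proof -
    have "\<kappa> / 2 * ((t - m) + (s - m)) \<le> \<kappa> / 2 * (S + S)" using that \<kappa>(1) by (intro mult_left_mono) linarith+
    moreover have "\<kappa> / 2 * (S + S) = \<kappa> * S" by simp
    ultimately show "0 \<le> 1 - \<kappa> / 2 * ((t - m) + (s - m))" using \<kappa>(2) by linarith
    have "0 \<le> \<kappa> / 2 * ((t - m) + (s - m))" using that \<kappa> by simp
    then show "1 - \<kappa> / 2 * ((t - m) + (s - m)) \<le> 1" by simp
  qed
  have q_mono: "q s \<le> q t" if "m \<le> s" "s \<le> t" "t \<le> m + S" for s t
  proof -
    have "0 \<le> (t - s) * (1 - \<kappa> / 2 * ((t - m) + (s - m)))"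
      using that q_fac[of s t] by (intro mult_nonneg_nonneg) auto
    then show ?thesis using q_diff[of t s] by simp
  qed
  have q_lip: "q t \<le> q s + (t - s)" if "m \<le> s" "s \<le> t" "t \<le> m + S" for s t
  proof -
    have "(t - s) * (1 - \<kappa> / 2 * ((t - m) + (s - m))) \<le> (t - s) * 1"
      using that q_fac[of s t] by (intro mult_left_mono) auto
    then show ?thesis using q_diff[of t s] by simp
  qed
  have Fbd: "bdd_above (F ` M)"
  proof (rule bdd_aboveI2)
    fix y assume y: "y \<in> M"
    show "F y \<le> Q - (m - \<kappa> * S\<^sup>2 / 2)"
      using v[OF y] w[OF y] q_ge[of "w y"] unfolding F_def by linarith
  qed
  define ms where "ms = (SUP y\<in>M. F y)"
  have F_le: "F y \<le> ms" if "y \<in> M" for y unfolding ms_def using Fbd that by (rule cSUP_upper2) simp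
  have ms_gt: "ms > b + \<kappa> * S\<^sup>2 / 2"
    using contr F_le[OF x] q_le[of "w x"] by (simp add: F_def)
  define \<iota> where "\<iota> = min ((\<kappa> * \<theta>\<^sup>2 / 4 - E) / 8) ((ms - (b + \<kappa> * S\<^sup>2 / 2)) / 2)"
  have \<iota>: "\<iota> > 0" "4 * \<iota> < \<kappa> * \<theta>\<^sup>2 / 4 - E" "\<iota> < ms - (b + \<kappa> * S\<^sup>2 / 2)"
    using \<theta> ms_gt by (auto simp: \<iota>_def min_def field_simps)
  have "\<exists>y\<in>M. ms - \<iota> < F y"
  proof (rule ccontr)
    assume "\<not> ?thesis"
    then have "ms \<le> ms - \<iota>" unfolding ms_def using x by (intro cSUP_least) (auto simp: not_less ms_def)
    then show False using \<iota> by simp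
  qed
  then obtain y where y: "y \<in> M" "ms - \<iota> < F y" by blast
  have yB: "y \<notin> B"
  proof
    assume "y \<in> B"
    then have "v y - w y \<le> b" using bd y by simp
    then have "F y \<le> b + \<kappa> * S\<^sup>2 / 2" using q_ge[of "w y"] w[OF y(1)] by (simp add: F_def)
    then show False using y \<iota> by linarith
  qed
  have yM: "y \<in> M - B" using y yB by simp
  have NyM: "z \<in> M" if "z \<in> N y" for z using N[OF y(1)] that by blast
  have Ny: "y \<in> N y" using N[OF y(1)] by blast
  have vba: "bdd_above (v ` N y)" "bdd_below (v ` N y)"
    by (rule bdd_aboveI2[of _ _ Q] bdd_belowI2[of _ "-Q"]; use v NyM in fastforce)+
  have wba: "bdd_above (w ` N y)" "bdd_below (w ` N y)"
    by (rule bdd_aboveI2[of _ _ "m + S"] bdd_belowI2[of _ m]; use w NyM in fastforce)+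
  define A where "A = (SUP z\<in>N y. w z)"
  define I where "I = (INF z\<in>N y. w z)"
  have A: "w z \<le> A" if "z \<in> N y" for z unfolding A_def using wba that by (intro cSUP_upper)
  have I: "I \<le> w z" if "z \<in> N y" for z unfolding I_def using wba that by (intro cINF_lower)
  have AI: "A \<le> m + S" "m \<le> I" unfolding A_def I_def
    using Ny w NyM by (auto intro!: cSUP_least cINF_greatest)
  have vz: "v z \<le> v y - q (w y) + q (w z) + \<iota>" if "z \<in> N y" for z
    using F_le[OF NyM[OF that]] y(2) by (simp add: F_def)
  have "(SUP z\<in>N y. v z) \<le> v y - q (w y) + q A + \<iota>"
  proof (rule cSUP_least)
    show "N y \<noteq> {}" using Ny by blast
    fix z assume z: "z \<in> N y"
    have "q (w z) \<le> q A" using A[OF z] w[OF NyM[OF z]] AI by (intro q_mono) auto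
    then show "v z \<le> v y - q (w y) + q A + \<iota>" using vz[OF z] by linarith
  qed
  moreover have "(INF z\<in>N y. v z) \<le> v y - q (w y) + q I + 2 * \<iota>"
  proof -
    have "\<exists>z\<in>N y. w z < I + \<iota>"
    proof (rule ccontr)
      assume "\<not> ?thesis"
      then have "I + \<iota> \<le> I" unfolding I_def using Ny by (intro cINF_greatest) (auto simp: not_less I_def)
      then show False using \<iota> by simp
    qed
    then obtain z where z: "z \<in> N y" "w z < I + \<iota>" by blast
    have "q (w z) \<le> q I + (w z - I)" using z w[OF NyM[OF z(1)]] AI I[OF z(1)] by (intro q_lip) auto
    then have "v z \<le> v y - q (w y) + q I + 2 * \<iota>" using vz[OF z(1)] z(2) by linarith
    then show ?thesis using vba z(1) by (meson cINF_lower2)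
  qed
  ultimately have "2 * q (w y) \<le> q A + q I + 3 * \<iota> + E" using sub[OF yM] by linarith
  moreover have "q A + q I + \<kappa> * \<theta>\<^sup>2 / 4 \<le> 2 * q (w y)"
  proof -
    have IA: "I \<le> A" using A[OF Ny] I[OF Ny] by linarith
    have "(A + I) / 2 \<le> w y" using super[OF yM] by (simp add: A_def I_def)
    then have "q ((A + I) / 2) \<le> q (w y)" using AI IA w[OF y(1)] by (intro q_mono) auto
    moreover have "2 * q ((A + I) / 2) = q A + q I + \<kappa> / 4 * (A - I)\<^sup>2"
      by (simp add: q_def power2_eq_square field_simps)
    moreover have "\<kappa> / 4 * \<theta>\<^sup>2 \<le> \<kappa> / 4 * (A - I)\<^sup>2"
    proof (rule mult_left_mono)
      have "\<theta> \<le> A - I" using slope[OF yM] A[OF Ny] by (simp add: I_def)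
      then show "\<theta>\<^sup>2 \<le> (A - I)\<^sup>2" using \<theta> by (intro power_mono) auto
    qed (use \<kappa> in auto)
    ultimately show ?thesis by simp
  qed
  ultimately show False using \<iota> by linarith
qed

text \<open>Values of chains that walk outside \<open>G\<close>, pay \<open>\<theta>\<close> per step and read off \<open>w\<close> when they first meet \<open>G\<close>.\<close>

inductive descent_value ::
  "'a set \<Rightarrow> ('a \<Rightarrow> 'a set) \<Rightarrow> 'a set \<Rightarrow> ('a \<Rightarrow> real) \<Rightarrow> real \<Rightarrow> 'a \<Rightarrow> real \<Rightarrow> bool"
  for M N G w \<theta> where
  stop: "x \<in> M \<Longrightarrow> x \<in> G \<Longrightarrow> descent_value M N G w \<theta> x (w x)"
| step: "x \<in> M \<Longrightarrow> x \<notin> G \<Longrightarrow> y \<in> N x \<Longrightarrow> descent_value M N G w \<theta> y c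
          \<Longrightarrow> descent_value M N G w \<theta> x (c + \<theta>)"

text \<open>Keep \<open>w\<close> on the set \<open>G\<close> where it already drops by \<open>\<theta>\<close> (and on \<open>B\<close>), and elsewhere put \<open>w' x\<close> equal to the infimum of
\<open>w + \<theta> * steps\<close> over chains that lead to \<open>G\<close>.  Outside \<open>G\<close> a step changes \<open>w\<close> by at most \<open>\<theta>\<close>, which gives the bounds,
while \<open>w'\<close> drops by \<open>\<theta>\<close> and rises by at most \<open>\<theta>\<close> there.  In \<open>G\<close> the steepest descent of a supersolution leads to a
point that again belongs to \<open>G\<close>, since from there \<open>w\<close> rises by \<open>\<theta>\<close> and hence also drops by \<open>\<theta>\<close>; so the drop survives.\<close>

lemma slope_patching:
  fixes M :: "'a set" and N :: "'a \<Rightarrow> 'a set" and w :: "'a \<Rightarrow> real"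
  assumes N: "\<And>x. x \<in> M \<Longrightarrow> x \<in> N x \<and> N x \<subseteq> M"
    and sym: "\<And>x y. x \<in> M \<Longrightarrow> y \<in> N x \<Longrightarrow> x \<in> N y"
    and w: "\<And>x. x \<in> M \<Longrightarrow> \<bar>w x\<bar> \<le> Q"
    and \<theta>: "\<theta> > 0" and BM: "B \<subseteq> M"
    and super: "\<And>x. x \<in> M - B \<Longrightarrow> (SUP y\<in>N x. w y) + (INF y\<in>N x. w y) \<le> 2 * w x"
    and attained: "\<And>x. x \<in> M - B \<Longrightarrow> \<exists>y\<in>N x. \<forall>z\<in>N x. w y \<le> w z"
    and chain: "\<And>x. x \<in> M \<Longrightarrow> \<exists>p. p 0 = x \<and> p k \<in> B \<and> (\<forall>i<k. p (Suc i) \<in> N (p i))"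
  obtains w' where "\<And>x. x \<in> M \<Longrightarrow> w x \<le> w' x \<and> w' x \<le> w x + 2 * real k * \<theta>"
    and "\<And>x. x \<in> M - B \<Longrightarrow> (SUP y\<in>N x. w' y) + (INF y\<in>N x. w' y) \<le> 2 * w' x"
    and "\<And>x. x \<in> M - B \<Longrightarrow> (INF y\<in>N x. w' y) \<le> w' x - \<theta>"
proof -
  define G where "G = B \<union> {x \<in> M. (INF y\<in>N x. w y) \<le> w x - \<theta>}"
  let ?D = "descent_value M N G w \<theta>"
  define w' where "w' x = Inf {c. ?D x c}" for x
  have NM: "z \<in> M" if "x \<in> M" "z \<in> N x" for x z using N[OF that(1)] that(2) by blast
  have wba: "bdd_above (w ` N x)" "bdd_below (w ` N x)" if "x \<in> M" for x
    by (rule bdd_aboveI2[of _ _ Q] bdd_belowI2[of _ "-Q"]; use w NM that in fastforce)+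
  have sup: "w z \<le> (SUP y\<in>N x. w y)" if "x \<in> M" "z \<in> N x" for x z
    using wba that by (intro cSUP_upper)
  have inf: "(INF y\<in>N x. w y) \<le> w z" if "x \<in> M" "z \<in> N x" for x z
    using wba that by (intro cINF_lower)
  have notG: "w x - \<theta> < w z \<and> w z \<le> w x + \<theta>" if "x \<in> M" "x \<notin> G" "z \<in> N x" for x z
  proof -
    have "w x - \<theta> < (INF y\<in>N x. w y)" "x \<in> M - B" using that by (auto simp: G_def)
    then show ?thesis using sup[OF that(1,3)] inf[OF that(1,3)] super[of x] by linarith
  qed
  have D_ge: "w x \<le> c" if "?D x c" for x c
    using that
  proof induction
    case (step x y c)
    then show ?case using notG[of x y] by linarith
  qed simp
  have D_ex: "\<exists>c. ?D x c \<and> c \<le> w x + 2 * real j * \<theta>"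
    if "x \<in> M" "p 0 = x" "p j \<in> B" "\<forall>i<j. p (Suc i) \<in> N (p i)" for x j and p :: "nat \<Rightarrow> 'a"
    using that
  proof (induction j arbitrary: x p)
    case 0
    then have "x \<in> G" by (simp add: G_def)
    then show ?case using descent_value.stop[of x M G N w \<theta>] 0 by auto
  next
    case (Suc j)
    show ?case
    proof (cases "x \<in> G")
      case True
      have "?D x (w x)" using True Suc.prems by (intro descent_value.stop)
      moreover have "w x \<le> w x + 2 * real (Suc j) * \<theta>" using \<theta> by simp
      ultimately show ?thesis by blast
    next
      case False
      have y: "p 1 \<in> N x" using Suc.prems by force
      have "p 1 \<in> M" using NM y Suc.prems(1) by blast
      moreover have "\<forall>i<j. p (Suc (Suc i)) \<in> N (p (Suc i))" using Suc.prems(4) by blast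
      ultimately have "\<exists>c. ?D (p 1) c \<and> c \<le> w (p 1) + 2 * real j * \<theta>"
        using Suc.prems(3) by (intro Suc.IH[where p = "\<lambda>i. p (Suc i)"]) (simp_all only: One_nat_def)
      then obtain c where c: "?D (p 1) c" "c \<le> w (p 1) + 2 * real j * \<theta>" by blast
      have "?D x (c + \<theta>)" using c y False Suc.prems by (intro descent_value.step)
      moreover have "c + \<theta> \<le> w x + 2 * real (Suc j) * \<theta>"
        using c notG[OF _ False y] Suc.prems by (simp add: algebra_simps)
      ultimately show ?thesis by blast
    qed
  qed
  have D_ex': "\<exists>c. ?D x c \<and> c \<le> w x + 2 * real k * \<theta>" if "x \<in> M" for x
    using chain[OF that] D_ex[OF that] by blast
  have Dbd: "bdd_below {c. ?D x c}" for x by (rule bdd_belowI[of _ "w x"]) (use D_ge in blast)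
  have w'_le: "w' x \<le> c" if "?D x c" for x c
    unfolding w'_def using that Dbd by (intro cInf_lower) auto
  have w'_ge: "b \<le> w' x" if "x \<in> M" "\<And>c. ?D x c \<Longrightarrow> b \<le> c" for x b
    unfolding w'_def using D_ex'[OF that(1)] that(2) by (intro cInf_greatest) auto
  have bounds: "w x \<le> w' x \<and> w' x \<le> w x + 2 * real k * \<theta>" if "x \<in> M" for x
    using D_ex'[OF that] w'_le[of x] w'_ge[OF that, of "w x"] D_ge by fastforce
  have w'_G: "w' x = w x" if "x \<in> M" "x \<in> G" for x
    using w'_le[of x "w x"] descent_value.stop[OF that] bounds[OF that(1)] by fastforce
  have w'_nb: "w' z \<le> w' x + \<theta>" if "x \<in> M" "z \<in> N x" "z \<notin> G" for x z
  proof -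
    have "w' z - \<theta> \<le> w' x"
    proof (rule w'_ge[OF that(1)])
      fix c assume c: "?D x c"
      have "?D z (c + \<theta>)"
        by (rule descent_value.step[OF NM[OF that(1,2)] that(3) sym[OF that(1,2)] c])
      then show "w' z - \<theta> \<le> c" using w'_le by fastforce
    qed
    then show ?thesis by simp
  qed
  have w'ba: "bdd_below (w' ` N x)" if "x \<in> M" for x
  proof (rule bdd_belowI2[of _ "-Q"])
    fix y assume "y \<in> N x"
    then show "- Q \<le> w' y" using bounds[of y] w[of y] NM[OF that] by fastforce
  qed
  have inf': "(INF y\<in>N x. w' y) \<le> w' z" if "x \<in> M" "z \<in> N x" for x z
    using w'ba that by (intro cINF_lower)
  have main: "(SUP y\<in>N x. w' y) + (INF y\<in>N x. w' y) \<le> 2 * w' x \<and> (INF y\<in>N x. w' y) \<le> w' x - \<theta>"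
    if x: "x \<in> M - B" for x
  proof (cases "x \<in> G")
    case False
    have "(INF y\<in>N x. w' y) + \<theta> \<le> w' x"
    proof (rule w'_ge)
      show "x \<in> M" using x by simp
      fix c assume "?D x c"
      then show "(INF y\<in>N x. w' y) + \<theta> \<le> c"
      proof cases
        case stop
        then show ?thesis using False by simp
      next
        case (step y c')
        then show ?thesis using w'_le[of y c'] inf'[of x y] by simp
      qed
    qed
    moreover have "(SUP y\<in>N x. w' y) \<le> w' x + \<theta>"
    proof (rule cSUP_least)
      show "N x \<noteq> {}" using N[of x] x by blast
      fix z assume z: "z \<in> N x"
      show "w' z \<le> w' x + \<theta>"
      proof (cases "z \<in> G")
        case True
        then have "w' z = w z" using w'_G z NM x by blast
        then show ?thesis using notG[of x z] False x z bounds[of x] by simp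
      next
        case False
        then show ?thesis using w'_nb x z by blast
      qed
    qed
    ultimately show ?thesis by linarith
  next
    case True
    then have low: "(INF y\<in>N x. w y) \<le> w x - \<theta>" using x by (auto simp: G_def)
    obtain y where y: "y \<in> N x" "\<And>z. z \<in> N x \<Longrightarrow> w y \<le> w z" using attained[OF x] by blast
    have yM: "y \<in> M" using NM x y by blast
    have wy: "w y = (INF y\<in>N x. w y)"
      using y inf[of x y] x by (intro antisym cINF_greatest) auto
    have "y \<in> G"
    proof (cases "y \<in> B")
      case False
      have "w x \<le> (SUP z\<in>N y. w z)" using sup[OF yM, of x] sym y x by blast
      then have "(INF z\<in>N y. w z) \<le> w y - \<theta>" using super[of y] False yM low wy by force
      then show ?thesis using yM by (simp add: G_def)
    qed (simp add: G_def)
    then have "w' y = w y" using w'_G yM by blast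
    then have inf_w': "(INF y\<in>N x. w' y) \<le> (INF y\<in>N x. w y)" using inf'[of x y] x y wy by simp
    have "(SUP y\<in>N x. w' y) \<le> 2 * w x - (INF y\<in>N x. w y)"
    proof (rule cSUP_least)
      show "N x \<noteq> {}" using N[of x] x by blast
      fix z assume z: "z \<in> N x"
      show "w' z \<le> 2 * w x - (INF y\<in>N x. w y)"
      proof (cases "z \<in> G")
        case True
        then have "w' z = w z" using w'_G z NM x by blast
        then show ?thesis using sup[of x z] x z super[OF x] by simp
      next
        case False
        then show ?thesis using w'_nb[of x z] x z low w'_G[of x] True by simp
      qed
    qed
    then show ?thesis using inf_w' low w'_G[of x] True x by simp
  qed
  show ?thesis using that[of w'] bounds main by blast
qed

section \<open>One-sided rates\<close>

text \<open>What is used of the graph: \<open>wt\<close> and \<open>Dn\<close> stand for its weights and its distance, \<open>v\<close> for the graph solution, and \<open>s\<close>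
for the relative error between \<open>Dn\<close> and the geodesic distance.  The assumptions are invariant under negation
of \<open>u\<close> and \<open>v\<close>, so that estimates from one side suffice.\<close>

locale approximation_problem = finite_geodist \<Omega> A for \<Omega> :: "'a::euclidean_space set" and A +
  fixes \<O> X L :: "'a set" and u v :: "'a \<Rightarrow> real" and wt Dn :: "'a \<Rightarrow> 'a \<Rightarrow> real" and \<pi> :: "'a \<Rightarrow> 'a"
    and h \<delta> s m K \<Lambda> :: real
  assumes u_amle: "amle u \<O>" and u_lip: "\<And>x y. x \<in> closure \<Omega> \<Longrightarrow> y \<in> closure \<Omega> \<Longrightarrow> \<bar>u x - u y\<bar> \<le> \<Lambda> * gd \<Omega> x y"
    and \<O>: "\<O> \<subseteq> closure \<Omega>" "\<O> \<noteq> {}"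
    and X: "finite X" "X \<subseteq> closure \<Omega>" "L \<subseteq> X"
    and balance: "\<And>x y. x \<in> X - L \<Longrightarrow> y \<in> X \<Longrightarrow> \<exists>z\<in>X. wt x y * (v x - v y) \<le> wt x z * (v z - v x)"
      "\<And>x y. x \<in> X - L \<Longrightarrow> y \<in> X \<Longrightarrow> \<exists>z\<in>X. wt x y * (v y - v x) \<le> wt x z * (v x - v z)"
    and wt: "\<And>x y. wt x y \<ge> 0" "\<And>x y. wt x y = wt y x"
    and wt_near: "\<And>x y. wt x y > 0 \<Longrightarrow> norm (x - y) \<le> h"
    and Dn_refl: "\<And>x. x \<in> X \<Longrightarrow> Dn x x = 0"
    and Dn_edge: "\<And>x y z. x \<in> X \<Longrightarrow> y \<in> X \<Longrightarrow> z \<in> X \<Longrightarrow> wt y z > 0 \<Longrightarrow> Dn x z \<le> Dn x y + 1 / wt y z"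
    and Dn_triangle: "\<And>x y z. x \<in> X \<Longrightarrow> y \<in> X \<Longrightarrow> z \<in> X \<Longrightarrow> Dn x z \<le> Dn x y + Dn y z"
    and Dn_bellman: "\<And>x y. x \<in> X \<Longrightarrow> y \<in> X \<Longrightarrow> x \<noteq> y \<Longrightarrow> \<exists>z\<in>X. wt z y > 0 \<and> Dn x y = Dn x z + 1 / wt z y"
    and Dn_le: "\<And>x y. x \<in> X \<Longrightarrow> y \<in> X \<Longrightarrow> Dn x y \<le> (1 + s) * gd \<Omega> x y + h"
    and gd_le_Dn: "\<And>x y. x \<in> X \<Longrightarrow> y \<in> X \<Longrightarrow> gd \<Omega> x y \<le> (1 + s) * Dn x y + 3 * A * h"
    and v_lip: "\<And>x y. x \<in> X \<Longrightarrow> y \<in> X \<Longrightarrow> \<bar>v x - v y\<bar> \<le> m * Dn x y"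
    and \<pi>: "\<And>x. x \<in> closure \<Omega> \<Longrightarrow> \<pi> x \<in> X \<and> norm (x - \<pi> x) \<le> \<delta>"
    and label_near: "\<And>y. y \<in> L \<Longrightarrow> \<exists>z\<in>\<O>. norm (y - z) \<le> \<delta>"
    and label_data: "\<And>z. z \<in> \<O> \<Longrightarrow> \<exists>y\<in>L. norm (z - y) \<le> \<delta> \<and> \<bar>v y - u z\<bar> \<le> K * \<delta>"
    and params: "h > 0" "0 \<le> \<delta>" "\<delta> \<le> h" "0 \<le> s" "0 \<le> m" "0 \<le> K" "0 \<le> \<Lambda>"
begin

lemma negated: "approximation_problem \<Omega> A \<O> X L (\<lambda>x. - u x) (\<lambda>x. - v x) wt Dn \<pi> h \<delta> s m K \<Lambda>"
proof (unfold_locales)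
  show "amle (\<lambda>x. - u x) \<O>" by (rule amle_uminus[OF u_amle])
  show "\<bar>- u x - - u y\<bar> \<le> \<Lambda> * gd \<Omega> x y" if "x \<in> closure \<Omega>" "y \<in> closure \<Omega>" for x y
    using u_lip[OF that] by (simp add: abs_minus_commute)
  show "\<bar>- v x - - v y\<bar> \<le> m * Dn x y" if "x \<in> X" "y \<in> X" for x y
    using v_lip[OF that] by (simp add: abs_minus_commute)
  show "\<exists>z\<in>X. wt x y * (- v x - - v y) \<le> wt x z * (- v z - - v x)" if "x \<in> X - L" "y \<in> X" for x y
    using balance(2)[OF that] by (simp add: algebra_simps)
  show "\<exists>z\<in>X. wt x y * (- v y - - v x) \<le> wt x z * (- v x - - v z)" if "x \<in> X - L" "y \<in> X" for x y
    using balance(1)[OF that] by (simp add: algebra_simps)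
  show "\<exists>y\<in>L. norm (z - y) \<le> \<delta> \<and> \<bar>- v y - - u z\<bar> \<le> K * \<delta>" if "z \<in> \<O>" for z
    using label_data[OF that] by (simp add: abs_minus_commute)
qed (fact \<O> X wt wt_near Dn_refl Dn_edge Dn_triangle Dn_bellman Dn_le gd_le_Dn \<pi> label_near params)+

text \<open>The radius exceeds \<open>\<epsilon>\<close> by \<open>A * \<delta>\<close> so that the ball around any point within \<open>\<epsilon>\<close> of \<open>x\<close> contains the vertex \<open>\<pi> x\<close>.\<close>

definition max_ball :: "real \<Rightarrow> 'a \<Rightarrow> real" where
  "max_ball \<epsilon> x = Max (v ` {y \<in> X. gd \<Omega> x y \<le> \<epsilon> + A * \<delta>})"

text \<open>Outside this layer, all balls that occur in the comparison arguments are free of labels.\<close>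

definition layer :: "real \<Rightarrow> 'a set" where
  "layer \<epsilon> = {x \<in> closure \<Omega>. \<exists>z\<in>\<O>. gd \<Omega> x z \<le> 3 * \<epsilon>}"

lemma gd_\<pi>: assumes "x \<in> closure \<Omega>" shows "gd \<Omega> x (\<pi> x) \<le> A * \<delta>"
proof -
  have "gd \<Omega> x (\<pi> x) \<le> A * norm (x - \<pi> x)" using \<pi>[OF assms] X assms by (intro gd_le_norm) auto
  also have "\<dots> \<le> A * \<delta>" using \<pi>[OF assms] A1 by (intro mult_left_mono) auto
  finally show ?thesis .
qed

lemma max_ball_upper:
  assumes "y \<in> X" "gd \<Omega> x y \<le> \<epsilon> + A * \<delta>"
  shows "v y \<le> max_ball \<epsilon> x"
  unfolding max_ball_def using X(1) assms by (intro Max_ge) auto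

lemma max_ball_attained:
  assumes "x \<in> closure \<Omega>" "\<epsilon> \<ge> 0"
  obtains y where "y \<in> X" "gd \<Omega> x y \<le> \<epsilon> + A * \<delta>" "max_ball \<epsilon> x = v y"
proof -
  have "\<pi> x \<in> {y \<in> X. gd \<Omega> x y \<le> \<epsilon> + A * \<delta>}" using \<pi>[OF assms(1)] gd_\<pi>[OF assms(1)] assms(2) by auto
  then have "max_ball \<epsilon> x \<in> v ` {y \<in> X. gd \<Omega> x y \<le> \<epsilon> + A * \<delta>}"
    unfolding max_ball_def using X(1) by (intro Max_in) auto
  then show ?thesis using that by blast
qed

lemma max_ball_bounded:
  assumes e: "\<epsilon> \<ge> 0"
  obtains Q where "\<And>x. x \<in> closure \<Omega> \<Longrightarrow> \<bar>max_ball \<epsilon> x\<bar> \<le> Q"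
proof
  fix x assume x: "x \<in> closure \<Omega>"
  obtain y where y: "y \<in> X" "max_ball \<epsilon> x = v y" using max_ball_attained[OF x e] by blast
  have "\<bar>v y\<bar> \<le> Max ((\<lambda>y. \<bar>v y\<bar>) ` X)" using X(1) y(1) by (intro Max_ge) auto
  then show "\<bar>max_ball \<epsilon> x\<bar> \<le> Max ((\<lambda>y. \<bar>v y\<bar>) ` X)" using y(2) by simp
qed

text \<open>Cone comparison is applied at \<open>p = \<pi> x\<close> with the largest radius \<open>R\<close> for which the graph ball of radius \<open>R + \<rho>\<close> is contained in the
geodesic ball of radius \<open>2 \<epsilon>\<close>.  A vertex realizing the max-ball value is at graph distance
\<open>\<epsilon> + O(\<epsilon> s + h)\<close> from \<open>p\<close>, which is \<open>R / 2\<close> up to the same error, so its value is at most the mean of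
\<open>v p\<close> and the maximum \<open>T\<close>, up to that error times the slope of the cone.\<close>

lemma max_ball_subsolution:
  assumes \<epsilon>: "20 * A * h \<le> \<epsilon>" and s: "s \<le> 1 / 20" and x: "x \<in> closure \<Omega> - layer \<epsilon>"
  shows "2 * max_ball \<epsilon> x \<le> (SUP y\<in>geo_ball x \<epsilon>. max_ball \<epsilon> y) + (INF y\<in>geo_ball x \<epsilon>. max_ball \<epsilon> y)
    + 2 * m * (4 * \<epsilon> * s + 14 * A * h)"
proof -
  have xM: "x \<in> closure \<Omega>" using x by simp
  have Ah: "h \<le> A * h" "A * h > 0" using A1 params by auto
  then have e0: "\<epsilon> > 0" using \<epsilon> by linarith
  have A\<delta>: "A * \<delta> \<le> A * h" "0 \<le> A * \<delta>" using A1 params by auto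
  have es: "0 \<le> \<epsilon> * s" "\<epsilon> * s \<le> \<epsilon> / 20"
  proof -
    show "0 \<le> \<epsilon> * s" using e0 params by simp
    have "\<epsilon> * s \<le> \<epsilon> * (1 / 20)" using s e0 by (intro mult_left_mono) auto
    then show "\<epsilon> * s \<le> \<epsilon> / 20" by simp
  qed
  define \<rho> where "\<rho> = (2 * A + 1) * h"
  define R where "R = (2 * \<epsilon> - 3 * A * h) / (1 + s) - \<rho>"
  have \<rho>: "\<rho> \<ge> 0" "\<rho> \<le> 3 * (A * h)" using A1 params Ah by (auto simp: \<rho>_def algebra_simps)
  have s1: "1 + s > 0" using params by simp
  have R_s: "(1 + s) * (R + \<rho>) + 3 * A * h = 2 * \<epsilon>" using s1 by (simp add: R_def)
  have R_ge: "2 * \<epsilon> - 2 * (\<epsilon> * s) - 6 * (A * h) \<le> R"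
  proof -
    have "(2 * \<epsilon> - 3 * A * h) * (1 - s) \<le> (2 * \<epsilon> - 3 * A * h) / (1 + s)"
    proof (subst pos_le_divide_eq[OF s1])
      have "(2 * \<epsilon> - 3 * A * h) * (1 - s) * (1 + s) = (2 * \<epsilon> - 3 * A * h) - (2 * \<epsilon> - 3 * A * h) * s\<^sup>2"
        by (simp add: power2_eq_square algebra_simps)
      moreover have "(2 * \<epsilon> - 3 * A * h) * s\<^sup>2 \<ge> 0" using \<epsilon> Ah e0 by simp
      ultimately show "(2 * \<epsilon> - 3 * A * h) * (1 - s) * (1 + s) \<le> 2 * \<epsilon> - 3 * A * h" by linarith
    qed
    moreover have "(2 * \<epsilon> - 3 * A * h) * (1 - s) = 2 * \<epsilon> - 2 * (\<epsilon> * s) - 3 * (A * h) + 3 * (A * h) * s"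
      by (simp add: algebra_simps)
    moreover have "3 * (A * h) * s \<ge> 0" using Ah params by simp
    ultimately show ?thesis using \<rho>(2) unfolding R_def by linarith
  qed
  have R_le: "R + \<rho> \<le> 2 * \<epsilon>"
  proof -
    have "0 \<le> R + \<rho>" using R_ge es \<epsilon> \<rho> e0 by linarith
    then have "R + \<rho> \<le> (1 + s) * (R + \<rho>)" using params mult_right_mono[of 1 "1 + s" "R + \<rho>"] by simp
    then show ?thesis using R_s Ah by linarith
  qed
  have R\<epsilon>: "\<epsilon> \<le> R" using R_ge es \<epsilon> e0 by linarith
  define p where "p = \<pi> x"
  have p: "p \<in> X" "p \<in> closure \<Omega>" "gd \<Omega> x p \<le> A * \<delta>"
    using \<pi>[OF xM] X gd_\<pi>[OF xM] by (auto simp: p_def)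
  obtain y where y: "y \<in> X" "gd \<Omega> x y \<le> \<epsilon> + A * \<delta>" "max_ball \<epsilon> x = v y"
    using max_ball_attained[OF xM less_imp_le[OF e0]] by blast
  have yM: "y \<in> closure \<Omega>" using y X by auto
  have gpy: "gd \<Omega> p y \<le> \<epsilon> + 2 * (A * h)"
    using gd_triangle[OF p(2) xM yM] gd_sym[of p x] p(3) y(2) A\<delta> by linarith
  have D: "Dn p y \<le> \<epsilon> + \<epsilon> * s + 4 * (A * h)"
  proof -
    have "(1 + s) * gd \<Omega> p y \<le> (1 + s) * (\<epsilon> + 2 * (A * h))" using gpy s1 by (intro mult_left_mono) auto
    also have "\<dots> = \<epsilon> + \<epsilon> * s + 2 * (A * h) + 2 * (A * h) * s" by (simp add: algebra_simps)
    also have "2 * (A * h) * s \<le> 2 * (A * h) * (1 / 20)" using s Ah by (intro mult_left_mono) auto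
    finally have "(1 + s) * gd \<Omega> p y \<le> \<epsilon> + \<epsilon> * s + 2 * (A * h) + 2 * (A * h) * (1 / 20)" by simp
    then show ?thesis using Dn_le[OF p(1) y(1)] Ah by linarith
  qed
  have jump: "Dn p z \<le> Dn p y + \<rho>" if "y \<in> X" "z \<in> X" "wt y z > 0" for y z
  proof -
    have M: "y \<in> closure \<Omega>" "z \<in> closure \<Omega>" using that X by auto
    have "gd \<Omega> y z \<le> A * norm (y - z)" by (rule gd_le_norm[OF M])
    also have "\<dots> \<le> A * h" using wt_near[OF that(3)] A1 by (intro mult_left_mono) auto
    finally have g: "gd \<Omega> y z \<le> A * h" .
    have "(1 + s) * gd \<Omega> y z \<le> 2 * (A * h)" using g s gd_nonneg[of y z] s1 by (intro mult_mono) auto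
    then have "Dn y z \<le> \<rho>" using Dn_le[OF that(1,2)] by (simp add: \<rho>_def algebra_simps)
    then show ?thesis using Dn_triangle[OF p(1) that(1,2)] by linarith
  qed
  have within: "gd \<Omega> p z \<le> 2 * \<epsilon>" if "z \<in> X" "Dn p z \<le> R + \<rho>" for z
  proof -
    have "(1 + s) * Dn p z \<le> (1 + s) * (R + \<rho>)" using that s1 by (intro mult_left_mono) auto
    then show ?thesis using gd_le_Dn[OF p(1) that(1)] R_s by linarith
  qed
  have free: "z \<notin> L" if "z \<in> X" "Dn p z < R" for z
  proof
    assume "z \<in> L"
    then obtain o' where o': "o' \<in> \<O>" "norm (z - o') \<le> \<delta>" using label_near by blast
    have M: "z \<in> closure \<Omega>" "o' \<in> closure \<Omega>" using that X o' \<O> by auto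
    have "gd \<Omega> z o' \<le> A * norm (z - o')" by (rule gd_le_norm[OF M])
    also have "\<dots> \<le> A * \<delta>" using o'(2) A1 by (intro mult_left_mono) auto
    finally have "gd \<Omega> x o' \<le> 3 * \<epsilon>"
      using gd_triangle[OF xM M] gd_triangle[OF xM p(2) M(1)] within[OF that(1)] that(2) \<rho> p(3) A\<delta> \<epsilon> Ah by linarith
    then show False using x o'(1) by (auto simp: layer_def)
  qed
  define T where "T = Max (v ` {z \<in> X. Dn p z \<le> R + \<rho>})"
  have pin: "p \<in> {z \<in> X. Dn p z \<le> R + \<rho>}" using p Dn_refl R\<epsilon> e0 \<rho> by auto
  have T: "v z \<le> T" if "z \<in> X" "Dn p z \<le> R + \<rho>" for z
    unfolding T_def using that X(1) by (intro Max_ge) auto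
  have "T \<in> v ` {z \<in> X. Dn p z \<le> R + \<rho>}" unfolding T_def using pin X(1) by (intro Max_in) auto
  then obtain z where z: "z \<in> X" "Dn p z \<le> R + \<rho>" "T = v z" by auto
  have zM: "z \<in> closure \<Omega>" using z X by auto
  have DR: "Dn p y \<le> R" using D R_ge es \<epsilon> e0 by linarith
  have cone: "v y \<le> v p + (T - v p) / R * Dn p y"
  proof (rule graph_cone_comparison[where wt = wt and X = X and L = L and \<rho> = \<rho>])
    show "Dn p z \<le> Dn p y + 1 / wt y z" if "y \<in> X" "z \<in> X" "wt y z > 0" for y z
      by (rule Dn_edge[OF p(1) that])
    show "\<exists>z\<in>X. wt z y > 0 \<and> Dn p y = Dn p z + 1 / wt z y" if "y \<in> X" "p \<noteq> y" for y
      by (rule Dn_bellman[OF p(1) that])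
    show "R > 0" using R\<epsilon> e0 by simp
    show "y \<notin> L" if "y \<in> X" "y \<noteq> p" "Dn p y < R" for y by (rule free[OF that(1,3)])
  qed (fact X(1) p(1) balance(1) wt Dn_refl[OF p(1)] jump \<rho>(1) free T y(1) DR)+
  have Tp: "v p \<le> T" using T pin by auto
  have "m * Dn p z \<le> m * (2 * \<epsilon>)" using z(2) R_le params by (intro mult_left_mono) auto
  then have "T - v p \<le> 2 * m * \<epsilon>" using v_lip[OF p(1) z(1)] z(3) by simp
  also have "\<dots> \<le> 2 * m * R" using R\<epsilon> params by (intro mult_left_mono) auto
  finally have q: "(T - v p) / R \<le> 2 * m" using R\<epsilon> e0 by (simp add: pos_divide_le_eq)
  have q0: "0 \<le> (T - v p) / R" using Tp R\<epsilon> e0 by simp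
  have B: "2 * Dn p y - R \<le> 4 * \<epsilon> * s + 14 * A * h"
    using D R_ge by linarith
  have B0: "0 \<le> 4 * \<epsilon> * s + 14 * A * h" using es Ah by simp
  have "(T - v p) / R * (2 * Dn p y - R) \<le> (T - v p) / R * (4 * \<epsilon> * s + 14 * A * h)"
    using B q0 by (rule mult_left_mono)
  also have "\<dots> \<le> 2 * m * (4 * \<epsilon> * s + 14 * A * h)" using q B0 by (rule mult_right_mono)
  finally have qB: "(T - v p) / R * (2 * Dn p y - R) \<le> 2 * m * (4 * \<epsilon> * s + 14 * A * h)" .
  have "2 * ((T - v p) / R * Dn p y) \<le> (T - v p) / R * R + 2 * m * (4 * \<epsilon> * s + 14 * A * h)"
  proof -
    have "a * (2 * b - c) = 2 * (a * b) - a * c" for a b c :: real by (simp add: algebra_simps)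
    from qB[unfolded this] show ?thesis by linarith
  qed
  moreover have "(T - v p) / R * R = T - v p" using R\<epsilon> e0 by simp
  ultimately have main: "2 * v y \<le> v p + T + 2 * m * (4 * \<epsilon> * s + 14 * A * h)" using cone by linarith
  obtain Q where Q: "\<And>x. x \<in> closure \<Omega> \<Longrightarrow> \<bar>max_ball \<epsilon> x\<bar> \<le> Q" using max_ball_bounded[OF less_imp_le[OF e0]] by blast
  have "T \<le> (SUP y\<in>geo_ball x \<epsilon>. max_ball \<epsilon> y)"
  proof -
    have "gd \<Omega> x z \<le> \<epsilon> + (\<epsilon> + A * \<delta>)"
      using gd_triangle[OF xM p(2) zM] p(3) within[OF z(1,2)] by linarith
    then obtain c where c: "c \<in> closure \<Omega>" "gd \<Omega> x c \<le> \<epsilon>" "gd \<Omega> c z \<le> \<epsilon> + A * \<delta>"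
      using intermediate_point[OF xM zM less_imp_le[OF e0], of "\<epsilon> + A * \<delta>"] e0 A\<delta> by force
    have "v z \<le> max_ball \<epsilon> c" using max_ball_upper[OF z(1) c(3)] .
    also have "\<dots> \<le> (SUP y\<in>geo_ball x \<epsilon>. max_ball \<epsilon> y)"
    proof (rule cSUP_upper)
      show "c \<in> geo_ball x \<epsilon>" using c by (simp add: geo_ball_def)
      show "bdd_above (max_ball \<epsilon> ` geo_ball x \<epsilon>)"
        by (rule bdd_aboveI2[of _ _ Q]) (use Q in \<open>force simp: geo_ball_def abs_le_iff\<close>)
    qed
    finally show ?thesis using z(3) by simp
  qed
  moreover have "v p \<le> (INF y\<in>geo_ball x \<epsilon>. max_ball \<epsilon> y)"
  proof (rule cINF_greatest)
    show "geo_ball x \<epsilon> \<noteq> {}" using geo_ball_self[OF xM less_imp_le[OF e0]] by blast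
    fix c assume "c \<in> geo_ball x \<epsilon>"
    then have c: "c \<in> closure \<Omega>" "gd \<Omega> x c \<le> \<epsilon>" by (auto simp: geo_ball_def)
    have "gd \<Omega> c p \<le> \<epsilon> + A * \<delta>" using gd_triangle[OF c(1) xM p(2)] gd_sym[of c x] c(2) p(3) by linarith
    then show "v p \<le> max_ball \<epsilon> c" by (rule max_ball_upper[OF p(1)])
  qed
  ultimately show ?thesis using main y(3) by linarith
qed

text \<open>All points involved are within \<open>6 \<epsilon>\<close> of a common label, and both functions are Lipschitz.\<close>

lemma layer_estimate:
  assumes \<epsilon>: "20 * A * h \<le> \<epsilon>" and s: "s \<le> 1 / 20" and x: "x \<in> layer \<epsilon>"
  shows "max_ball \<epsilon> x - min_ball u \<epsilon> x \<le> (K + 7 * m + 4 * \<Lambda>) * \<epsilon>"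
proof -
  have Ah: "h \<le> A * h" "A * h > 0" using A1 params by auto
  then have e0: "\<epsilon> > 0" using \<epsilon> by linarith
  have A\<delta>: "A * \<delta> \<le> A * h" "0 \<le> A * \<delta>" using A1 params by auto
  obtain z where z: "x \<in> closure \<Omega>" "z \<in> \<O>" "gd \<Omega> x z \<le> 3 * \<epsilon>" using x by (auto simp: layer_def)
  have zM: "z \<in> closure \<Omega>" using z \<O> by auto
  obtain y where y: "y \<in> X" "gd \<Omega> x y \<le> \<epsilon> + A * \<delta>" "max_ball \<epsilon> x = v y"
    using max_ball_attained[OF z(1) less_imp_le[OF e0]] by blast
  have yM: "y \<in> closure \<Omega>" using y X by auto
  obtain l where l: "l \<in> L" "norm (z - l) \<le> \<delta>" "\<bar>v l - u z\<bar> \<le> K * \<delta>" using label_data[OF z(2)] by blast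
  have lX: "l \<in> X" "l \<in> closure \<Omega>" using l X by auto
  have "gd \<Omega> z l \<le> A * norm (z - l)" by (rule gd_le_norm[OF zM lX(2)])
  also have "\<dots> \<le> A * \<delta>" using l(2) A1 by (intro mult_left_mono) auto
  finally have "gd \<Omega> y l \<le> 6 * \<epsilon>"
    using gd_triangle[OF yM z(1) lX(2)] gd_triangle[OF z(1) zM lX(2)] gd_sym[of y x] y(2) z(3) A\<delta> \<epsilon> Ah by linarith
  then have "(1 + s) * gd \<Omega> y l \<le> (1 + 1 / 20) * (6 * \<epsilon>)"
    using s params gd_nonneg[of y l] by (intro mult_mono) auto
  moreover have "(1 + 1 / 20) * (6 * \<epsilon>) + h \<le> 7 * \<epsilon>" using \<epsilon> Ah by simp
  ultimately have "Dn y l \<le> 7 * \<epsilon>" using Dn_le[OF y(1) lX(1)] by linarith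
  then have "m * Dn y l \<le> m * (7 * \<epsilon>)" using params by (intro mult_left_mono) auto
  moreover have "\<delta> \<le> \<epsilon>" using params(3) \<epsilon> Ah by linarith
  then have "K * \<delta> \<le> K * \<epsilon>" using params(6) by (rule mult_left_mono)
  ultimately have "v y \<le> u z + K * \<epsilon> + m * (7 * \<epsilon>)" using v_lip[OF y(1) lX(1)] l(3) by linarith
  moreover obtain q where q: "q \<in> geo_ball x \<epsilon>" "min_ball u \<epsilon> x = u q"
    using min_ball_attained[OF amle_continuous[OF u_amle] z(1) less_imp_le[OF e0]] by blast
  have qM: "q \<in> closure \<Omega>" "gd \<Omega> x q \<le> \<epsilon>" using q by (auto simp: geo_ball_def)
  have "gd \<Omega> z q \<le> 4 * \<epsilon>" using gd_triangle[OF zM z(1) qM(1)] gd_sym[of z x] z(3) qM(2) by linarith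
  then have "\<Lambda> * gd \<Omega> z q \<le> \<Lambda> * (4 * \<epsilon>)" using params by (intro mult_left_mono) auto
  then have "u z - \<Lambda> * (4 * \<epsilon>) \<le> u q" using u_lip[OF zM qM(1)] by linarith
  ultimately show ?thesis using y(3) q(2) by (simp add: algebra_simps)
qed

lemma one_sided_estimate:
  assumes \<epsilon>: "20 * A * h \<le> \<epsilon>" and s: "s \<le> 1 / 20"
    and w_ge: "\<And>x. x \<in> closure \<Omega> \<Longrightarrow> min_ball u \<epsilon> x \<le> w x \<and> w x \<le> min_ball u \<epsilon> x + g"
    and super: "\<And>x. x \<in> closure \<Omega> - layer \<epsilon> \<Longrightarrow> (SUP y\<in>geo_ball x \<epsilon>. w y) + (INF y\<in>geo_ball x \<epsilon>. w y) \<le> 2 * w x"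
    and slope: "\<And>x. x \<in> closure \<Omega> - layer \<epsilon> \<Longrightarrow> (INF y\<in>geo_ball x \<epsilon>. w y) \<le> w x - \<theta>"
    and range: "\<And>x. x \<in> closure \<Omega> \<Longrightarrow> b \<le> w x \<and> w x \<le> b + S"
    and \<kappa>: "\<kappa> > 0" "\<kappa> * S \<le> 1" and \<theta>: "\<theta> \<ge> 0" "2 * m * (4 * \<epsilon> * s + 14 * A * h) < \<kappa> * \<theta>\<^sup>2 / 4"
    and x: "x \<in> closure \<Omega>"
  shows "v (\<pi> x) - u x \<le> g + (K + 7 * m + 4 * \<Lambda>) * \<epsilon> + \<kappa> * S\<^sup>2 / 2"
proof -
  have Ah: "h \<le> A * h" "A * h > 0" using A1 params by auto
  then have e0: "\<epsilon> > 0" using \<epsilon> by linarith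
  obtain Q where Q: "\<And>x. x \<in> closure \<Omega> \<Longrightarrow> \<bar>max_ball \<epsilon> x\<bar> \<le> Q" using max_ball_bounded[OF less_imp_le[OF e0]] by blast
  have "max_ball \<epsilon> x - w x \<le> (K + 7 * m + 4 * \<Lambda>) * \<epsilon> + \<kappa> * S\<^sup>2 / 2"
  proof (rule nonlocal_comparison[where N = "\<lambda>x. geo_ball x \<epsilon>" and B = "layer \<epsilon>"])
    show "x \<in> geo_ball x \<epsilon> \<and> geo_ball x \<epsilon> \<subseteq> closure \<Omega>" if "x \<in> closure \<Omega>" for x
      using geo_ball_self[OF that] e0 by (auto simp: geo_ball_def)
    show "2 * max_ball \<epsilon> x \<le> (SUP y\<in>geo_ball x \<epsilon>. max_ball \<epsilon> y) + (INF y\<in>geo_ball x \<epsilon>. max_ball \<epsilon> y)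
      + 2 * m * (4 * \<epsilon> * s + 14 * A * h)" if "x \<in> closure \<Omega> - layer \<epsilon>" for x
      by (rule max_ball_subsolution[OF \<epsilon> s that])
    show "max_ball \<epsilon> x - w x \<le> (K + 7 * m + 4 * \<Lambda>) * \<epsilon>" if "x \<in> closure \<Omega> \<inter> layer \<epsilon>" for x
      using layer_estimate[OF \<epsilon> s, of x] w_ge[of x] that by auto
  qed (fact Q range \<kappa> \<theta> super slope x)+
  moreover have "v (\<pi> x) \<le> max_ball \<epsilon> x" using \<pi>[OF x] gd_\<pi>[OF x] e0 by (intro max_ball_upper) auto
  moreover have "min_ball u \<epsilon> x \<le> u x"
    by (rule min_ball_le[OF amle_continuous[OF u_amle] x _ geo_ball_self[OF x]]) (use e0 in auto)
  ultimately show ?thesis using w_ge[OF x] by linarith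
qed

lemma free_outside_layer:
  assumes "x \<in> closure \<Omega> - layer \<epsilon>" "y \<in> closure \<Omega>" "gd \<Omega> x y < r" "r \<le> 3 * \<epsilon>"
  shows "y \<notin> \<O>"
  using assms by (auto simp: layer_def)

lemma min_ball_range:
  assumes "\<And>x. x \<in> closure \<Omega> \<Longrightarrow> \<bar>u x\<bar> \<le> Q" "x \<in> closure \<Omega>" "\<epsilon> \<ge> 0"
  shows "\<bar>min_ball u \<epsilon> x\<bar> \<le> Q"
proof -
  obtain y where "y \<in> geo_ball x \<epsilon>" "min_ball u \<epsilon> x = u y"
    using min_ball_attained[OF amle_continuous[OF u_amle] assms(2,3)] by blast
  then show ?thesis using assms(1)[of y] by (simp add: geo_ball_def)
qed

text \<open>With slope bounded below, the min-ball function needs no patching.\<close>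

lemma sloped_estimate:
  assumes \<epsilon>: "20 * A * h \<le> \<epsilon>" and s: "s \<le> 1 / 20" and \<alpha>: "\<alpha> > 0"
    and slope: "\<And>x e. x \<in> closure \<Omega> \<Longrightarrow> e > 0 \<Longrightarrow> \<exists>y\<in>closure \<Omega>. y \<noteq> x \<and> gd \<Omega> x y < e \<and> \<alpha> * gd \<Omega> x y \<le> \<bar>u y - u x\<bar>"
    and Q: "\<And>x. x \<in> closure \<Omega> \<Longrightarrow> \<bar>u x\<bar> \<le> Q"
    and \<kappa>: "\<kappa> > 0" "\<kappa> * (2 * Q) \<le> 1" and E: "2 * m * (4 * \<epsilon> * s + 14 * A * h) < \<kappa> * (\<alpha> * \<epsilon>)\<^sup>2 / 4"
    and x: "x \<in> closure \<Omega>"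
  shows "v (\<pi> x) - u x \<le> (K + 7 * m + 4 * \<Lambda>) * \<epsilon> + \<kappa> * (2 * Q)\<^sup>2 / 2"
proof -
  have Ah: "h \<le> A * h" "A * h > 0" using A1 params by auto
  then have e0: "\<epsilon> > 0" using \<epsilon> by linarith
  have "v (\<pi> x) - u x \<le> 0 + (K + 7 * m + 4 * \<Lambda>) * \<epsilon> + \<kappa> * (2 * Q)\<^sup>2 / 2"
  proof (rule one_sided_estimate[OF \<epsilon> s _ _ _ _ \<kappa> _ E x])
    show "min_ball u \<epsilon> x \<le> min_ball u \<epsilon> x \<and> min_ball u \<epsilon> x \<le> min_ball u \<epsilon> x + 0" for x by simp
    show "(SUP y\<in>geo_ball x \<epsilon>. min_ball u \<epsilon> y) + (INF y\<in>geo_ball x \<epsilon>. min_ball u \<epsilon> y) \<le> 2 * min_ball u \<epsilon> x"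
      if "x \<in> closure \<Omega> - layer \<epsilon>" for x
      by (rule min_ball_supersolution[OF u_amle _ e0 free_outside_layer[OF that]]) (use that e0 in auto)
    show "(INF y\<in>geo_ball x \<epsilon>. min_ball u \<epsilon> y) \<le> min_ball u \<epsilon> x - \<alpha> * \<epsilon>" if "x \<in> closure \<Omega> - layer \<epsilon>" for x
      by (rule min_ball_slope[OF u_amle _ e0 \<alpha> free_outside_layer[OF that] u_lip params(7) slope])
         (use that in auto)
    show "- Q \<le> min_ball u \<epsilon> x \<and> min_ball u \<epsilon> x \<le> - Q + 2 * Q" if "x \<in> closure \<Omega>" for x
      using min_ball_range[OF Q that, of \<epsilon>] e0 by (auto simp: abs_le_iff)
    show "0 \<le> \<alpha> * \<epsilon>" using \<alpha> e0 by simp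
  qed
  then show ?thesis by simp
qed

text \<open>Chains to the layer are obtained from geodesics to a label; the number of steps \<open>k\<close> is of order \<open>1 / \<epsilon>\<close>, so patching with drop
\<open>\<epsilon>\<^sup>2\<close> raises the min-ball function by \<open>O(\<epsilon>)\<close>.\<close>

lemma patched_estimate:
  assumes \<epsilon>: "20 * A * h \<le> \<epsilon>" "\<epsilon> \<le> 1" and s: "s \<le> 1 / 20"
    and Dm: "\<And>x y. x \<in> closure \<Omega> \<Longrightarrow> y \<in> closure \<Omega> \<Longrightarrow> gd \<Omega> x y \<le> Dm"
    and Q: "\<And>x. x \<in> closure \<Omega> \<Longrightarrow> \<bar>u x\<bar> \<le> Q"
    and S: "S = 2 * Q + 2 * (Dm + 1)"
    and \<kappa>: "\<kappa> > 0" "\<kappa> * S \<le> 1" and E: "2 * m * (4 * \<epsilon> * s + 14 * A * h) < \<kappa> * (\<epsilon>\<^sup>2)\<^sup>2 / 4"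
    and x: "x \<in> closure \<Omega>"
  shows "v (\<pi> x) - u x \<le> 2 * (Dm + 1) * \<epsilon> + (K + 7 * m + 4 * \<Lambda>) * \<epsilon> + \<kappa> * S\<^sup>2 / 2"
proof -
  have Ah: "h \<le> A * h" "A * h > 0" using A1 params by auto
  then have e0: "\<epsilon> > 0" using \<epsilon> by linarith
  have Dm0: "Dm \<ge> 0" using Dm[OF x x] gd_nonneg[of x x] by linarith
  \<comment> \<open>Enough steps of length \<open>\<epsilon>\<close> to follow any geodesic to its end.\<close>
  define k where "k = nat \<lceil>Dm / \<epsilon>\<rceil>"
  have k: "Dm \<le> real k * \<epsilon>" "real k \<le> Dm / \<epsilon> + 1"
  proof -
    have "Dm / \<epsilon> \<le> real k" unfolding k_def by (rule real_nat_ceiling_ge)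
    then show "Dm \<le> real k * \<epsilon>" using e0 by (simp add: pos_divide_le_eq)
    show "real k \<le> Dm / \<epsilon> + 1" unfolding k_def using Dm0 e0 by (simp add: of_nat_nat)
  qed
  have k\<theta>: "2 * real k * \<epsilon>\<^sup>2 \<le> 2 * (Dm + 1) * \<epsilon>"
  proof -
    have "real k * \<epsilon>\<^sup>2 \<le> (Dm / \<epsilon> + 1) * \<epsilon>\<^sup>2" using k(2) by (intro mult_right_mono) auto
    also have "\<dots> = Dm * \<epsilon> + \<epsilon> * \<epsilon>" using e0 by (simp add: power2_eq_square algebra_simps)
    also have "\<epsilon> * \<epsilon> \<le> 1 * \<epsilon>" using \<epsilon>(2) e0 by (intro mult_right_mono) auto
    finally show ?thesis by (simp add: algebra_simps)
  qed
  have cont: "continuous_on (closure \<Omega>) u" by (rule amle_continuous[OF u_amle])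
  obtain w where w: "\<And>x. x \<in> closure \<Omega> \<Longrightarrow> min_ball u \<epsilon> x \<le> w x \<and> w x \<le> min_ball u \<epsilon> x + 2 * real k * \<epsilon>\<^sup>2"
    "\<And>x. x \<in> closure \<Omega> - layer \<epsilon> \<Longrightarrow> (SUP y\<in>geo_ball x \<epsilon>. w y) + (INF y\<in>geo_ball x \<epsilon>. w y) \<le> 2 * w x"
    "\<And>x. x \<in> closure \<Omega> - layer \<epsilon> \<Longrightarrow> (INF y\<in>geo_ball x \<epsilon>. w y) \<le> w x - \<epsilon>\<^sup>2"
  proof (rule slope_patching[where M = "closure \<Omega>" and N = "\<lambda>x. geo_ball x \<epsilon>" and w = "min_ball u \<epsilon>" and \<theta> = "\<epsilon>\<^sup>2"
        and B = "layer \<epsilon>" and k = k and Q = Q])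
    show "x \<in> geo_ball x \<epsilon> \<and> geo_ball x \<epsilon> \<subseteq> closure \<Omega>" if "x \<in> closure \<Omega>" for x
      using geo_ball_self[OF that] e0 by (auto simp: geo_ball_def)
    show "x \<in> geo_ball y \<epsilon>" if "x \<in> closure \<Omega>" "y \<in> geo_ball x \<epsilon>" for x y
      using that gd_sym[of x y] by (simp add: geo_ball_def)
    show "\<bar>min_ball u \<epsilon> x\<bar> \<le> Q" if "x \<in> closure \<Omega>" for x
      by (rule min_ball_range[OF Q that]) (use e0 in auto)
    show "\<epsilon>\<^sup>2 > 0" using e0 by simp
    show "layer \<epsilon> \<subseteq> closure \<Omega>" by (auto simp: layer_def)
    show "(SUP y\<in>geo_ball x \<epsilon>. min_ball u \<epsilon> y) + (INF y\<in>geo_ball x \<epsilon>. min_ball u \<epsilon> y) \<le> 2 * min_ball u \<epsilon> x"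
      if "x \<in> closure \<Omega> - layer \<epsilon>" for x
      by (rule min_ball_supersolution[OF u_amle _ e0 free_outside_layer[OF that]]) (use that e0 in auto)
    show "\<exists>y\<in>geo_ball x \<epsilon>. \<forall>z\<in>geo_ball x \<epsilon>. min_ball u \<epsilon> y \<le> min_ball u \<epsilon> z" if "x \<in> closure \<Omega> - layer \<epsilon>" for x
    proof -
      have "x \<in> closure \<Omega>" using that by simp
      from min_ball_min_ball[OF cont this less_imp_le[OF e0]] show ?thesis by metis
    qed
    show "\<exists>p. p 0 = x \<and> p k \<in> layer \<epsilon> \<and> (\<forall>i<k. p (Suc i) \<in> geo_ball (p i) \<epsilon>)" if xM: "x \<in> closure \<Omega>" for x
    proof -
      obtain z where z: "z \<in> \<O>" "z \<in> closure \<Omega>" using \<O> by blast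
      obtain \<gamma> where \<gamma>: "is_geodesic (gd \<Omega> x z) \<gamma>" "\<gamma> 0 = x" "\<gamma> (gd \<Omega> x z) = z"
        using obtain_geodesic[OF xM z(2)] .
      define p where "p i = \<gamma> (min (real i * \<epsilon>) (gd \<Omega> x z))" for i :: nat
      have rng: "0 \<le> min (real i * \<epsilon>) (gd \<Omega> x z)" "min (real i * \<epsilon>) (gd \<Omega> x z) \<le> gd \<Omega> x z" for i :: nat
        using e0 gd_nonneg[of x z] by auto
      have "p 0 = x" using \<gamma>(2) gd_nonneg[of x z] by (simp add: p_def)
      moreover have "p k = z"
        using \<gamma>(3) k(1) Dm[OF xM z(2)] by (simp add: p_def min_absorb2)
      then have "p k \<in> layer \<epsilon>" using z gd_refl[OF z(2)] e0 by (auto simp: layer_def intro!: bexI[of _ z])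
      moreover have "p (Suc i) \<in> geo_ball (p i) \<epsilon>" for i
      proof -
        have "gd \<Omega> (p i) (p (Suc i)) = \<bar>min (real i * \<epsilon>) (gd \<Omega> x z) - min (real (Suc i) * \<epsilon>) (gd \<Omega> x z)\<bar>"
          unfolding p_def by (rule geodesic_d[OF \<gamma>(1) rng rng])
        also have "\<dots> \<le> \<epsilon>" using e0 by (simp add: algebra_simps min_def)
        finally show ?thesis using geodesic_in[OF \<gamma>(1) rng[of "Suc i"]] unfolding geo_ball_def p_def by simp
      qed
      ultimately show ?thesis by blast
    qed
  qed blast
  show ?thesis
  proof (rule one_sided_estimate[OF \<epsilon>(1) s _ w(2,3) _ \<kappa> _ E x])
    show "min_ball u \<epsilon> y \<le> w y \<and> w y \<le> min_ball u \<epsilon> y + 2 * (Dm + 1) * \<epsilon>" if "y \<in> closure \<Omega>" for y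
      using w(1)[OF that] k\<theta> by linarith
    have "2 * (Dm + 1) * \<epsilon> \<le> 2 * (Dm + 1) * 1" using \<epsilon>(2) Dm0 by (intro mult_left_mono) auto
    then show "- Q \<le> w y \<and> w y \<le> - Q + S" if "y \<in> closure \<Omega>" for y
      using w(1)[OF that] k\<theta> min_ball_range[OF Q that, of \<epsilon>] e0 unfolding S by (auto simp: abs_le_iff)
  qed auto
qed

lemma power_le_linear:
  assumes "0 \<le> (\<epsilon>::real)" "\<epsilon> \<le> 1" "n > 0"
  shows "\<epsilon> ^ n \<le> \<epsilon>"
  using power_decreasing[of 1 n \<epsilon>] assms by simp

text \<open>The choice \<open>\<kappa> = 4 CE \<epsilon>\<close> makes the strictness \<open>CE * \<epsilon> ^ 5\<close>, just above the error \<open>(CE - 1) * \<epsilon> ^ 5\<close> in the inequality for the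
max-ball function.\<close>

lemma patched_rate:
  assumes \<epsilon>: "\<epsilon> > 0" and C: "Cs \<ge> 0" "Ch \<ge> 0" and sh: "s \<le> Cs * \<epsilon> ^ 4" "h \<le> Ch * \<epsilon> ^ 5"
    and Dm: "\<And>x y. x \<in> closure \<Omega> \<Longrightarrow> y \<in> closure \<Omega> \<Longrightarrow> gd \<Omega> x y \<le> Dm"
    and Q: "\<And>x. x \<in> closure \<Omega> \<Longrightarrow> \<bar>u x\<bar> \<le> Q"
    and S: "S = 2 * Q + 2 * (Dm + 1)" and CE: "CE = 2 * m * (4 * Cs + 14 * A * Ch) + 1"
    and small: "\<epsilon> * (1 + 20 * A * Ch + 20 * Cs + 4 * CE * S) \<le> 1"
    and x: "x \<in> closure \<Omega>"
  shows "v (\<pi> x) - u x \<le> (2 * (Dm + 1) + (K + 7 * m + 4 * \<Lambda>) + 2 * CE * S\<^sup>2) * \<epsilon>"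
proof -
  have Dm0: "Dm \<ge> 0" using Dm[OF x x] gd_nonneg[of x x] by linarith
  have "Q \<ge> 0" using Q[OF x] by linarith
  then have S0: "S > 0" using Dm0 unfolding S by simp
  have CE0: "CE \<ge> 1" using C A1 params CE by simp
  have nn: "0 \<le> \<epsilon> * (20 * A * Ch)" "0 \<le> \<epsilon> * (20 * Cs)" "0 \<le> \<epsilon> * (4 * CE * S)"
    using \<epsilon> C A1 CE0 S0 by auto
  have sm: "\<epsilon> \<le> 1" "\<epsilon> * (20 * A * Ch) \<le> 1" "\<epsilon> * (20 * Cs) \<le> 1" "\<epsilon> * (4 * CE * S) \<le> 1"
    using small nn \<epsilon> unfolding distrib_left by linarith+
  have e4: "\<epsilon> ^ 4 \<le> \<epsilon>" using \<epsilon> sm(1) by (intro power_le_linear) auto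
  have h1: "20 * A * h \<le> \<epsilon>"
  proof -
    have "20 * A * h \<le> 20 * A * (Ch * \<epsilon> ^ 5)" using sh A1 by (intro mult_left_mono) auto
    also have "\<dots> = 20 * A * Ch * \<epsilon> ^ 4 * \<epsilon>" by (simp add: power_numeral_reduce)
    also have "\<dots> \<le> 20 * A * Ch * \<epsilon> * \<epsilon>" using e4 \<epsilon> C A1 by (intro mult_right_mono mult_left_mono) auto
    also have "\<dots> \<le> 1 * \<epsilon>" using sm(2) \<epsilon> by (intro mult_right_mono) (auto simp: mult.commute)
    finally show ?thesis by simp
  qed
  have s1: "s \<le> 1 / 20"
  proof -
    have "Cs * \<epsilon> ^ 4 \<le> Cs * \<epsilon>" using e4 C by (intro mult_left_mono)
    moreover have "\<epsilon> * (20 * Cs) = 20 * (Cs * \<epsilon>)" by simp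
    ultimately show ?thesis using sh(1) sm(3) by linarith
  qed
  define \<kappa> where "\<kappa> = 4 * CE * \<epsilon>"
  have \<kappa>: "\<kappa> > 0" "\<kappa> * S \<le> 1" using CE0 \<epsilon> sm(4) by (auto simp: \<kappa>_def mult.commute mult.left_commute)
  have "2 * m * (4 * \<epsilon> * s + 14 * A * h) \<le> 2 * m * (4 * \<epsilon> * (Cs * \<epsilon> ^ 4) + 14 * A * (Ch * \<epsilon> ^ 5))"
    using sh params A1 \<epsilon> by (intro mult_left_mono add_mono) auto
  also have "\<dots> = (CE - 1) * \<epsilon> ^ 5" unfolding CE by (simp add: power_numeral_reduce algebra_simps)
  also have "\<dots> < CE * \<epsilon> ^ 5" using \<epsilon> by simp
  also have "\<dots> = \<kappa> * (\<epsilon>\<^sup>2)\<^sup>2 / 4" by (simp add: \<kappa>_def power_numeral_reduce)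
  finally have E: "2 * m * (4 * \<epsilon> * s + 14 * A * h) < \<kappa> * (\<epsilon>\<^sup>2)\<^sup>2 / 4" .
  have "v (\<pi> x) - u x \<le> 2 * (Dm + 1) * \<epsilon> + (K + 7 * m + 4 * \<Lambda>) * \<epsilon> + \<kappa> * S\<^sup>2 / 2"
    by (rule patched_estimate[OF h1 sm(1) s1 Dm Q S \<kappa> E x])
  also have "\<kappa> * S\<^sup>2 / 2 = 2 * CE * S\<^sup>2 * \<epsilon>" by (simp add: \<kappa>_def)
  finally show ?thesis by (simp only: distrib_right)
qed

text \<open>Here the drop is \<open>\<alpha> \<epsilon>\<close> in place of \<open>\<epsilon>\<^sup>2\<close>, so that the strictness is \<open>CE * \<epsilon> ^ 3\<close> for \<open>\<kappa> = 4 CE \<epsilon> / \<alpha>\<^sup>2\<close>, and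
errors of order \<open>\<epsilon> ^ 3\<close> can be afforded.\<close>

lemma sloped_rate:
  assumes \<epsilon>: "\<epsilon> > 0" and C: "Cs \<ge> 0" "Ch \<ge> 0" and sh: "s \<le> Cs * \<epsilon> ^ 2" "h \<le> Ch * \<epsilon> ^ 3"
    and \<alpha>: "\<alpha> > 0"
    and slope: "\<And>x e. x \<in> closure \<Omega> \<Longrightarrow> e > 0 \<Longrightarrow> \<exists>y\<in>closure \<Omega>. y \<noteq> x \<and> gd \<Omega> x y < e \<and> \<alpha> * gd \<Omega> x y \<le> \<bar>u y - u x\<bar>"
    and Q: "\<And>x. x \<in> closure \<Omega> \<Longrightarrow> \<bar>u x\<bar> \<le> Q"
    and CE: "CE = 2 * m * (4 * Cs + 14 * A * Ch) + 1"
    and small: "\<epsilon> * (1 + 20 * A * Ch + 20 * Cs + 4 * (CE / \<alpha>\<^sup>2) * (2 * Q)) \<le> 1"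
    and x: "x \<in> closure \<Omega>"
  shows "v (\<pi> x) - u x \<le> ((K + 7 * m + 4 * \<Lambda>) + 2 * (CE / \<alpha>\<^sup>2) * (2 * Q)\<^sup>2) * \<epsilon>"
proof -
  have Q0: "Q \<ge> 0" using Q[OF x] by linarith
  have CE0: "CE \<ge> 1" using C A1 params CE by simp
  have nn: "0 \<le> \<epsilon> * (20 * A * Ch)" "0 \<le> \<epsilon> * (20 * Cs)" "0 \<le> \<epsilon> * (4 * (CE / \<alpha>\<^sup>2) * (2 * Q))"
    using \<epsilon> C A1 CE0 Q0 by auto
  have sm: "\<epsilon> \<le> 1" "\<epsilon> * (20 * A * Ch) \<le> 1" "\<epsilon> * (20 * Cs) \<le> 1" "\<epsilon> * (4 * (CE / \<alpha>\<^sup>2) * (2 * Q)) \<le> 1"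
    using small nn \<epsilon> unfolding distrib_left by linarith+
  have e2: "\<epsilon> ^ 2 \<le> \<epsilon>" using \<epsilon> sm(1) by (intro power_le_linear) auto
  have h1: "20 * A * h \<le> \<epsilon>"
  proof -
    have "20 * A * h \<le> 20 * A * (Ch * \<epsilon> ^ 3)" using sh A1 by (intro mult_left_mono) auto
    also have "\<dots> = 20 * A * Ch * \<epsilon> ^ 2 * \<epsilon>" by (simp add: power_numeral_reduce)
    also have "\<dots> \<le> 20 * A * Ch * \<epsilon> * \<epsilon>" using e2 \<epsilon> C A1 by (intro mult_right_mono mult_left_mono) auto
    also have "\<dots> \<le> 1 * \<epsilon>" using sm(2) \<epsilon> by (intro mult_right_mono) (auto simp: mult.commute)
    finally show ?thesis by simp
  qed
  have s1: "s \<le> 1 / 20"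
  proof -
    have "Cs * \<epsilon> ^ 2 \<le> Cs * \<epsilon>" using e2 C by (intro mult_left_mono)
    moreover have "\<epsilon> * (20 * Cs) = 20 * (Cs * \<epsilon>)" by simp
    ultimately show ?thesis using sh(1) sm(3) by linarith
  qed
  define \<kappa> where "\<kappa> = 4 * (CE / \<alpha>\<^sup>2) * \<epsilon>"
  have \<kappa>0: "\<kappa> > 0" using CE0 \<epsilon> \<alpha> by (simp add: \<kappa>_def)
  have "\<kappa> * (2 * Q) = \<epsilon> * (4 * (CE / \<alpha>\<^sup>2) * (2 * Q))" by (simp add: \<kappa>_def)
  then have \<kappa>Q: "\<kappa> * (2 * Q) \<le> 1" using sm(4) by linarith
  have "2 * m * (4 * \<epsilon> * s + 14 * A * h) \<le> 2 * m * (4 * \<epsilon> * (Cs * \<epsilon> ^ 2) + 14 * A * (Ch * \<epsilon> ^ 3))"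
    using sh params A1 \<epsilon> by (intro mult_left_mono add_mono) auto
  also have "\<dots> = (CE - 1) * \<epsilon> ^ 3" unfolding CE by (simp add: power_numeral_reduce algebra_simps)
  also have "\<dots> < CE * \<epsilon> ^ 3" using \<epsilon> by simp
  also have "\<dots> = \<kappa> * (\<alpha> * \<epsilon>)\<^sup>2 / 4" using \<alpha> by (simp add: \<kappa>_def power_numeral_reduce)
  finally have E: "2 * m * (4 * \<epsilon> * s + 14 * A * h) < \<kappa> * (\<alpha> * \<epsilon>)\<^sup>2 / 4" .
  have "v (\<pi> x) - u x \<le> (K + 7 * m + 4 * \<Lambda>) * \<epsilon> + \<kappa> * (2 * Q)\<^sup>2 / 2"
    by (rule sloped_estimate[OF h1 s1 \<alpha> slope Q \<kappa>0 \<kappa>Q E x])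
  also have "\<kappa> * (2 * Q)\<^sup>2 / 2 = 2 * (CE / \<alpha>\<^sup>2) * (2 * Q)\<^sup>2 * \<epsilon>" by (simp add: \<kappa>_def)
  finally show ?thesis by (simp only: distrib_right)
qed

text \<open>A bound independent of \<open>\<epsilon>\<close>, for the case that \<open>\<epsilon>\<close> is not small.\<close>

lemma crude_estimate:
  assumes Dm: "\<And>x y. x \<in> closure \<Omega> \<Longrightarrow> y \<in> closure \<Omega> \<Longrightarrow> gd \<Omega> x y \<le> Dm"
    and b: "s \<le> Cs" "h \<le> 1" and x: "x \<in> closure \<Omega>"
  shows "\<bar>u x - v (\<pi> x)\<bar> \<le> m * ((1 + Cs) * Dm + 1) + K + \<Lambda> * Dm"
proof -
  obtain z where z: "z \<in> \<O>" "z \<in> closure \<Omega>" using \<O> by blast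
  obtain l where l: "l \<in> L" "\<bar>v l - u z\<bar> \<le> K * \<delta>" using label_data[OF z(1)] by blast
  have lX: "l \<in> X" "l \<in> closure \<Omega>" using l X by auto
  have p: "\<pi> x \<in> X" "\<pi> x \<in> closure \<Omega>" using \<pi>[OF x] X by auto
  have "(1 + s) * gd \<Omega> (\<pi> x) l \<le> (1 + Cs) * Dm"
    using Dm[OF p(2) lX(2)] b params gd_nonneg[of "\<pi> x" l] by (intro mult_mono) auto
  then have "Dn (\<pi> x) l \<le> (1 + Cs) * Dm + 1" using Dn_le[OF p(1) lX(1)] b by linarith
  then have "m * Dn (\<pi> x) l \<le> m * ((1 + Cs) * Dm + 1)" using params by (intro mult_left_mono) auto
  moreover have "K * \<delta> \<le> K * 1" using params b by (intro mult_left_mono) auto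
  moreover have "\<Lambda> * gd \<Omega> x z \<le> \<Lambda> * Dm" using Dm[OF x z(2)] params by (intro mult_left_mono) auto
  ultimately show ?thesis using v_lip[OF p(1) lX(1)] l(2) u_lip[OF x z(2)] by linarith
qed

end

section \<open>Convergence rates\<close>

text \<open>Divide \<open>h \<le> c * \<phi>h powr p\<close> by \<open>h powr p\<close> and take roots.\<close>

lemma rate_exponents:
  fixes h p c c' \<phi>h \<delta> :: real
  assumes h: "h > 0" and p: "0 < p" "p < 1" and c: "c > 0" "c' > 0" and \<phi>: "\<phi>h \<ge> 0" and \<delta>: "\<delta> \<ge> 0"
    and h_le: "h \<le> c * \<phi>h powr p" and \<delta>_le: "\<delta> powr p \<le> c' * h"
  shows "\<phi>h > 0" "\<delta> \<le> (c' * c) powr (1 / p) * \<phi>h" "h \<le> c powr (1 / (1 - p)) * (\<phi>h / h) powr (p / (1 - p))"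
proof -
  show pos: "\<phi>h > 0"
  proof (rule ccontr)
    assume "\<not> \<phi>h > 0"
    then have "\<phi>h = 0" using \<phi> by simp
    then show False using h h_le by simp
  qed
  have "\<delta> powr p \<le> c' * (c * \<phi>h powr p)" using \<delta>_le mult_left_mono[OF h_le, of c'] c by linarith
  then have "(\<delta> powr p) powr (1 / p) \<le> (c' * c * \<phi>h powr p) powr (1 / p)"
    using p by (intro powr_mono2) (auto simp: mult.assoc)
  moreover have "(\<delta> powr p) powr (1 / p) = \<delta>" using \<delta> p by (simp add: powr_powr)
  moreover have "(c' * c * \<phi>h powr p) powr (1 / p) = (c' * c) powr (1 / p) * \<phi>h"
    using c pos p by (simp add: powr_mult powr_powr)
  ultimately show "\<delta> \<le> (c' * c) powr (1 / p) * \<phi>h" by simp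
  have "h powr (1 - p) = h / h powr p" using h by (simp add: powr_diff)
  also have "\<dots> \<le> c * \<phi>h powr p / h powr p" using h_le h by (intro divide_right_mono) auto
  also have "\<dots> = c * (\<phi>h / h) powr p" using pos h by (simp add: powr_divide)
  finally have "(h powr (1 - p)) powr (1 / (1 - p)) \<le> (c * (\<phi>h / h) powr p) powr (1 / (1 - p))"
    using p by (intro powr_mono2) auto
  moreover have "(h powr (1 - p)) powr (1 / (1 - p)) = h" using h p by (simp add: powr_powr)
  moreover have "(c * (\<phi>h / h) powr p) powr (1 / (1 - p)) = c powr (1 / (1 - p)) * (\<phi>h / h) powr (p / (1 - p))"
    using c pos h p by (simp add: powr_mult powr_powr)
  ultimately show "h \<le> c powr (1 / (1 - p)) * (\<phi>h / h) powr (p / (1 - p))" by simp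
qed

lemma hausdorff_left:
  assumes A: "bounded A" "x \<in> A" and B: "B \<noteq> {}" and c: "\<And>y. y \<in> B \<Longrightarrow> c \<le> norm (x - y)"
  shows "c \<le> hausdorff_dist A B"
proof -
  obtain b where b: "b \<in> B" using B by blast
  obtain M where M: "\<And>x. x \<in> A \<Longrightarrow> norm x \<le> M" using A(1) by (auto simp: bounded_iff)
  have "bdd_above ((\<lambda>x. INF y\<in>B. norm (x - y)) ` A)"
  proof (rule bdd_aboveI2)
    fix x assume x: "x \<in> A"
    have "(INF y\<in>B. norm (x - y)) \<le> norm (x - b)" by (intro cINF_lower b bdd_belowI2[of _ 0]) auto
    also have "\<dots> \<le> M + norm b" using norm_triangle_ineq4[of x b] M[OF x] by linarith
    finally show "(INF y\<in>B. norm (x - y)) \<le> M + norm b" .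
  qed
  then have "(INF y\<in>B. norm (x - y)) \<le> (SUP x\<in>A. INF y\<in>B. norm (x - y))" by (rule cSUP_upper[OF A(2)])
  moreover have "c \<le> (INF y\<in>B. norm (x - y))" using B c by (intro cINF_greatest) auto
  ultimately show ?thesis unfolding hausdorff_dist_def by linarith
qed

lemma hausdorff_sym: "hausdorff_dist A B = hausdorff_dist B A"
  by (simp add: hausdorff_dist_def max.commute)

lemma closest_pointD:
  assumes "closest_point_projection S X \<pi>" "x \<in> S"
  shows "\<pi> x \<in> X" "\<And>y. y \<in> X \<Longrightarrow> norm (x - \<pi> x) \<le> norm (x - y)"
  using assms unfolding closest_point_projection_def is_arg_min_linorder by auto

lemma resolution_bounds:
  assumes \<Omega>: "bounded \<Omega>" and X: "finite X" "X \<subseteq> closure \<Omega>" "L \<noteq> {}" "L \<subseteq> X"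
    and \<O>: "closed \<O>" "\<O> \<subseteq> closure \<Omega>" "\<O> \<noteq> {}"
    and \<pi>: "closest_point_projection (closure \<Omega>) X \<pi>" and \<pi>L: "closest_point_projection \<O> L \<pi>L"
  shows "\<And>x. x \<in> closure \<Omega> \<Longrightarrow> norm (x - \<pi> x) \<le> resolution \<Omega> \<O> X L"
    "\<And>z. z \<in> \<O> \<Longrightarrow> norm (z - \<pi>L z) \<le> resolution \<Omega> \<O> X L"
    "\<And>y. y \<in> L \<Longrightarrow> \<exists>z\<in>\<O>. norm (y - z) \<le> resolution \<Omega> \<O> X L"
    "0 \<le> resolution \<Omega> \<O> X L"
proof -
  have X0: "X \<noteq> {}" using X by auto
  have b\<Omega>: "bounded (closure \<Omega>)" "bounded \<O>" using bounded_closure[OF \<Omega>] bounded_subset \<O> by blast+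
  have le: "hausdorff_dist (closure \<Omega>) X \<le> resolution \<Omega> \<O> X L" "hausdorff_dist \<O> L \<le> resolution \<Omega> \<O> X L"
    unfolding resolution_def by (simp_all add: hausdorff_sym)
  show "norm (x - \<pi> x) \<le> resolution \<Omega> \<O> X L" if "x \<in> closure \<Omega>" for x
    using hausdorff_left[OF b\<Omega>(1) that X0 closest_pointD(2)[OF \<pi> that]] le(1) by linarith
  show "norm (z - \<pi>L z) \<le> resolution \<Omega> \<O> X L" if "z \<in> \<O>" for z
    using hausdorff_left[OF b\<Omega>(2) that X(3) closest_pointD(2)[OF \<pi>L that]] le(2) by linarith
  show "\<exists>z\<in>\<O>. norm (y - z) \<le> resolution \<Omega> \<O> X L" if "y \<in> L" for y
  proof -
    obtain z where z: "z \<in> \<O>" "\<And>w. w \<in> \<O> \<Longrightarrow> dist y z \<le> dist y w"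
      using distance_attains_inf[OF \<O>(1,3)] by metis
    have "bounded L" using X finite_imp_bounded finite_subset by blast
    then have "norm (y - z) \<le> hausdorff_dist L \<O>" using z(2) that by (intro hausdorff_left \<O>(3)) (auto simp: dist_norm)
    then have "norm (y - z) \<le> resolution \<Omega> \<O> X L" unfolding resolution_def by linarith
    then show ?thesis using z(1) by blast
  qed
  obtain x where "x \<in> closure \<Omega>" using \<O> by blast
  then have "0 \<le> hausdorff_dist (closure \<Omega>) X" using X0 by (intro hausdorff_left[OF b\<Omega>(1)]) auto
  then show "0 \<le> resolution \<Omega> \<O> X L" using le(1) by linarith
qed

lemma scaling_bounds:
  assumes sc: "scaling_assumption \<phi> r t\<^sub>0 \<delta> h \<epsilon>" and pos: "h > 0" "\<phi> h > 0" "\<epsilon> > 0" "\<delta> \<ge> 0" and t0: "0 < t\<^sub>0" "t\<^sub>0 \<le> 1"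
  shows "h \<le> r" "\<phi> h / h \<le> 1 / 4" "\<delta> / h \<le> t\<^sub>0 / 4" "h < \<epsilon> / 2"
proof -
  note S = sc[unfolded scaling_assumption_def]
  show "h \<le> r" using S by blast
  have "h / \<epsilon> < 1 / 2" using S by blast
  then show "h < \<epsilon> / 2" using pos by (simp add: pos_divide_less_eq)
  note S(1)[THEN conjunct2, THEN conjunct2, THEN conjunct1]
  then have \<sigma>: "\<phi> h / h \<le> sigma_phi \<phi> h" unfolding sigma_phi_def using pos by (intro cSUP_upper) auto
  have \<tau>: "\<phi> h / h > 0" using pos by simp
  have "t\<^sub>0 / (4 + 2 * sigma_phi \<phi> h) \<le> t\<^sub>0 / 4" using t0 \<sigma> \<tau> by (intro divide_left_mono) auto
  moreover have "0 \<le> t\<^sub>0 / (4 + 2 * sigma_phi \<phi> h)" using t0 \<sigma> \<tau> by (intro divide_nonneg_nonneg) auto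
  moreover have "1 - 2 * (h / \<epsilon>) \<le> 1" using pos by simp
  ultimately have "t\<^sub>0 / (4 + 2 * sigma_phi \<phi> h) * (1 - 2 * (h / \<epsilon>)) \<le> t\<^sub>0 / 4"
    using mult_left_le[of "1 - 2 * (h / \<epsilon>)" "t\<^sub>0 / (4 + 2 * sigma_phi \<phi> h)"] by linarith
  then have "sigma_phi \<phi> h + \<delta> / h \<le> t\<^sub>0 / 4" using S by linarith
  moreover have "0 \<le> \<delta> / h" using pos by simp
  ultimately show "\<phi> h / h \<le> 1 / 4" "\<delta> / h \<le> t\<^sub>0 / 4" using \<sigma> \<tau> t0 by linarith+
qed

context finite_geodist
begin

text \<open>Project points of a geodesic with spacing \<open>a = t\<^sub>0 h - 2 \<delta>\<close> to the point cloud.  Consecutive projections have distance at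
most \<open>t\<^sub>0 h\<close> and may coincide, in which case they are not joined by an edge; therefore distances are added up rather than edge
weights.\<close>

lemma graphdist_upper:
  assumes k: "kernel_assumption \<eta> t\<^sub>0" and h: "h > 0" and X: "X \<subseteq> closure \<Omega>"
    and \<pi>: "\<And>x. x \<in> closure \<Omega> \<Longrightarrow> \<pi> x \<in> X \<and> norm (x - \<pi> x) \<le> \<delta>"
    and \<delta>: "0 \<le> \<delta>" "\<delta> / h \<le> t\<^sub>0 / 4" and xy: "x \<in> X" "y \<in> X"
  shows "graphdist \<eta> h X x y \<le> ennreal ((1 + 4 * \<delta> / (t\<^sub>0 * h)) * gd \<Omega> x y + h)"
proof (cases "x = y")
  case True
  then show ?thesis by (simp add: graphdist_refl)
next
  case False
  have t0: "0 < t\<^sub>0" "t\<^sub>0 \<le> 1" using k by (auto simp: kernel_assumption_def)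
  have th: "t\<^sub>0 * h > 0" "t\<^sub>0 * h \<le> h" using t0 h by auto
  have M: "x \<in> closure \<Omega>" "y \<in> closure \<Omega>" using xy X by auto
  define D where "D = gd \<Omega> x y"
  have "norm (x - y) > 0" using False by simp
  then have D: "D > 0" using gd_norm[OF M] unfolding D_def by linarith
  define a where "a = t\<^sub>0 * h - 2 * \<delta>"
  have \<delta>h: "4 * \<delta> \<le> t\<^sub>0 * h" using \<delta>(2) h by (simp add: pos_divide_le_eq)
  have "y \<le> 2 * (y - 2 * x)" if "4 * x \<le> y" for x y :: real using that by simp
  from this[OF \<delta>h] have a2: "t\<^sub>0 * h \<le> 2 * a" unfolding a_def .
  then have a: "a > 0" using th by linarith
  obtain \<gamma> where g: "is_geodesic D \<gamma>" "\<gamma> 0 = x" "\<gamma> D = y" using obtain_geodesic[OF M] unfolding D_def .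
  define q where "q i = \<gamma> (min (real i * a) D)" for i :: nat
  have rng: "0 \<le> min (real i * a) D" "min (real i * a) D \<le> D" for i using a D by auto
  have qM: "q i \<in> closure \<Omega>" for i unfolding q_def by (rule geodesic_in[OF g(1) rng])
  have q_step: "norm (q i - q (Suc i)) \<le> a" for i
  proof -
    have "norm (q i - q (Suc i)) \<le> \<bar>min (real i * a) D - min (real (Suc i) * a) D\<bar>"
      unfolding q_def by (rule geodesic_norm[OF g(1) rng rng])
    also have "\<dots> \<le> a" using a by (simp add: algebra_simps min_def)
    finally show ?thesis .
  qed
  have add_hop: "ennreal (real i * (t\<^sub>0 * h)) + ennreal (t\<^sub>0 * h) = ennreal (real (Suc i) * (t\<^sub>0 * h))" for i
  proof -
    have "0 \<le> real i * (t\<^sub>0 * h)" "0 \<le> t\<^sub>0 * h" using th by auto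
    from ennreal_plus[OF this] show ?thesis by (simp add: distrib_right add.commute)
  qed
  have chain: "\<exists>z\<in>X. norm (z - q i) \<le> \<delta> \<and> graphdist \<eta> h X x z \<le> ennreal (real i * (t\<^sub>0 * h))" for i
  proof (induction i)
    case 0
    have "q 0 = x" using g(2) D by (simp add: q_def)
    then show ?case using xy(1) \<delta>(1) by (intro bexI[of _ x]) (auto simp: graphdist_refl)
  next
    case (Suc i)
    then obtain z where z: "z \<in> X" "norm (z - q i) \<le> \<delta>" "graphdist \<eta> h X x z \<le> ennreal (real i * (t\<^sub>0 * h))" by blast
    let ?w = "\<pi> (q (Suc i))"
    have w: "?w \<in> X" "norm (q (Suc i) - ?w) \<le> \<delta>" using \<pi>[OF qM] by auto
    have "norm (z - ?w) \<le> norm (z - q i) + (norm (q i - q (Suc i)) + norm (q (Suc i) - ?w))"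
      by (intro norm_diff_triangle_le[OF order_refl] norm_diff_triangle_le[OF order_refl order_refl])
    then have "norm (z - ?w) \<le> t\<^sub>0 * h" using z(2) q_step[of i] w(2) by (simp add: a_def)
    then have "graphdist \<eta> h X z ?w \<le> ennreal (t\<^sub>0 * h)" by (rule graphdist_short[OF k h z(1) w(1)])
    then have "graphdist \<eta> h X x ?w \<le> ennreal (real i * (t\<^sub>0 * h)) + ennreal (t\<^sub>0 * h)"
      using graphdist_triangle[OF xy(1) z(1), of \<eta> h ?w] z(3) by (meson add_mono order_trans)
    also have "\<dots> = ennreal (real (Suc i) * (t\<^sub>0 * h))" by (rule add_hop)
    finally show ?case using w by (intro bexI[of _ ?w]) (auto simp: norm_minus_commute)
  qed
  define N where "N = nat \<lceil>D / a\<rceil>"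
  have N: "D / a \<le> real N" "real N \<le> D / a + 1"
    using D a by (auto simp: N_def real_nat_ceiling_ge)
  have "real N > 0" using N(1) D a by (smt (verit) divide_pos_pos)
  then obtain n where n: "N = Suc n" by (cases N) auto
  obtain z where z: "z \<in> X" "norm (z - q n) \<le> \<delta>" "graphdist \<eta> h X x z \<le> ennreal (real n * (t\<^sub>0 * h))" using chain by blast
  have "q N = y" using N(1) a g(3) by (simp add: q_def min_absorb2 pos_divide_le_eq)
  then have "norm (q n - y) \<le> a" using q_step[of n] n by simp
  then have "norm (z - y) \<le> \<delta> + a" using norm_diff_triangle_le[OF z(2)] by blast
  then have "norm (z - y) \<le> t\<^sub>0 * h" using \<delta>(1) by (simp add: a_def)
  then have "graphdist \<eta> h X z y \<le> ennreal (t\<^sub>0 * h)" by (rule graphdist_short[OF k h z(1) xy(2)])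
  then have "graphdist \<eta> h X x y \<le> ennreal (real n * (t\<^sub>0 * h)) + ennreal (t\<^sub>0 * h)"
    using graphdist_triangle[OF xy(1) z(1), of \<eta> h y] z(3) by (meson add_mono order_trans)
  also have "\<dots> = ennreal (real N * (t\<^sub>0 * h))" unfolding n by (rule add_hop)
  also have "\<dots> \<le> ennreal ((1 + 4 * \<delta> / (t\<^sub>0 * h)) * D + h)"
  proof (rule ennreal_leI)
    have "real N * (t\<^sub>0 * h) \<le> (D / a + 1) * (t\<^sub>0 * h)" using N(2) th by (intro mult_right_mono) auto
    also have "\<dots> = (t\<^sub>0 * h) / a * D + t\<^sub>0 * h" by (simp add: algebra_simps)
    also have "(t\<^sub>0 * h) / a * D \<le> (1 + 4 * \<delta> / (t\<^sub>0 * h)) * D"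
    proof (rule mult_right_mono)
      have "t\<^sub>0 * h = a + 2 * \<delta>" by (simp add: a_def)
      then have "(t\<^sub>0 * h) / a = 1 + 2 * \<delta> / a" using a by (simp add: add_divide_distrib)
      also have "2 * \<delta> / a \<le> 4 * \<delta> / (t\<^sub>0 * h)"
      proof (subst frac_le_eq)
        show "a \<noteq> 0" "t\<^sub>0 * h \<noteq> 0" using a th by auto
        have "2 * \<delta> * (t\<^sub>0 * h) \<le> 2 * \<delta> * (2 * a)" using a2 \<delta> by (intro mult_left_mono) auto
        then have "2 * \<delta> * (t\<^sub>0 * h) - 4 * \<delta> * a \<le> 0" by simp
        then show "(2 * \<delta> * (t\<^sub>0 * h) - 4 * \<delta> * a) / (a * (t\<^sub>0 * h)) \<le> 0" 
          using mult_pos_pos[OF a th(1)] by (rule divide_nonpos_pos)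
      qed
      finally show "(t\<^sub>0 * h) / a \<le> 1 + 4 * \<delta> / (t\<^sub>0 * h)" by simp
    qed (use D in simp)
    finally show "real N * (t\<^sub>0 * h) \<le> (1 + 4 * \<delta> / (t\<^sub>0 * h)) * D + h" using th by linarith
  qed
  finally show ?thesis by (simp add: D_def)
qed

text \<open>The constant in \<open>chain_length\<close>.\<close>

definition excess_const :: real where
  "excess_const = (16 * A + 1) * (4 + 4 * (16 * A + 1)\<^sup>2)"

text \<open>The relative error \<open>s\<close> may be of order \<open>\<phi> h / h\<close> because the bounds for chains of hops and for geodesics see \<open>\<phi>\<close> at \<open>h\<close> only; the labels enter through \<open>\<delta>\<close> and \<open>K\<close>.\<close>

lemma approximation_problem_of_graph:
  assumes op: "open \<Omega>" and \<O>: "closed \<O>" "\<O> \<subseteq> closure \<Omega>" "\<O> \<noteq> {}"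
    and k: "kernel_assumption \<eta> t\<^sub>0" and u: "is_AMLE \<Omega> \<O> g u"
    and dom: "domain_assumption \<Omega> \<phi> r"
    and gs: "graph_setting \<Omega> \<O> g \<eta> h X L gX \<pi> \<pi>L uX M K" and MK: "M > 0" "K > 0"
    and \<delta>: "\<delta> = resolution \<Omega> \<O> (X n) (L n)"
    and sc: "h \<le> r" "\<delta> / h \<le> t\<^sub>0 / 4" and \<phi>: "\<phi> h > 0"
    and s: "excess_const * \<phi> h / (3 * h) \<le> s" "4 * \<delta> / (t\<^sub>0 * h) \<le> s"
    and \<Lambda>: "\<Lambda> = enn2real (Lip_const (geodist \<Omega>) g \<O>)"
  shows "approximation_problem \<Omega> A \<O> (X n) (L n) u (uX n) (weight \<eta> h)
    (\<lambda>x y. enn2real (graphdist \<eta> h (X n) x y)) (\<pi> n) h \<delta> s M K \<Lambda>"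
proof -
  have h: "h > 0" using gs by (simp add: graph_setting_def)
  have t0: "0 < t\<^sub>0" "t\<^sub>0 \<le> 1" using k by (auto simp: kernel_assumption_def)
  have X: "finite (X n)" "X n \<subseteq> closure \<Omega>" "L n \<noteq> {}" "L n \<subseteq> X n" using gs by (auto simp: graph_setting_def)
  have pr: "closest_point_projection (closure \<Omega>) (X n) (\<pi> n)" "closest_point_projection \<O> (L n) (\<pi>L n)"
    using gs by (auto simp: graph_setting_def)
  have data: "(SUP n. Lip_const (graphdist \<eta> h (X n)) (gX n) (L n)) \<le> ennreal M"
    "Lip_const (geodist \<Omega>) g \<O> < \<infinity>" "\<And>z. z \<in> \<O> \<Longrightarrow> \<bar>gX n (\<pi>L n z) - g z\<bar> \<le> K * \<delta>"
    using gs by (auto simp: graph_setting_def data_assumption_def \<delta>)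
  have sol: "\<And>x. x \<in> X n - L n \<Longrightarrow> Min ((\<lambda>y. eta_scaled \<eta> h (norm (x - y)) * (uX n y - uX n x)) ` X n)
     + Max ((\<lambda>y. eta_scaled \<eta> h (norm (x - y)) * (uX n y - uX n x)) ` X n) = 0"
    "\<And>x. x \<in> L n \<Longrightarrow> uX n x = gX n x"
    using gs by (auto simp: graph_setting_def solves_graph_inf_laplace_def)
  note res = resolution_bounds[OF bounded_dom X \<O> pr, folded \<delta>]
  have \<delta>h: "\<delta> \<le> h"
  proof -
    have "\<delta> / h \<le> 1" using sc(2) t0 by linarith
    then show ?thesis using h by (simp add: pos_divide_le_eq)
  qed
  have \<pi>: "\<pi> n x \<in> X n \<and> norm (x - \<pi> n x) \<le> \<delta>" if "x \<in> closure \<Omega>" for x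
    using closest_pointD(1)[OF pr(1) that] res(1)[OF that] by blast
  define Dn where "Dn x y = enn2real (graphdist \<eta> h (X n) x y)" for x y
  have upper: "graphdist \<eta> h (X n) x y \<le> ennreal ((1 + 4 * \<delta> / (t\<^sub>0 * h)) * gd \<Omega> x y + h)" if "x \<in> X n" "y \<in> X n" for x y
    by (rule graphdist_upper[OF k h X(2) \<pi> res(4) sc(2) that])
  have Dn: "graphdist \<eta> h (X n) x y = ennreal (Dn x y)" if "x \<in> X n" "y \<in> X n" for x y
    using order_le_less_trans[OF upper[OF that] ennreal_less_top] by (simp add: Dn_def)
  have Dn0: "Dn x y \<ge> 0" for x y by (simp add: Dn_def)
  have s0: "0 \<le> s" using s(2) res(4) t0 h by (meson divide_nonneg_pos mult_nonneg_nonneg mult_pos_pos order_trans zero_le_numeral)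
  have Dn_refl: "Dn x x = 0" if "x \<in> X n" for x by (simp add: Dn_def graphdist_refl)
  have Dn_nonneg: "Dn x y \<ge> 0" if "x \<in> X n" "y \<in> X n" for x y by (rule Dn0)
  have Dn_tri: "Dn x z \<le> Dn x y + Dn y z" if "x \<in> X n" "y \<in> X n" "z \<in> X n" for x y z
    using graphdist_triangle[OF that(1,2), of \<eta> h z] that Dn0 by (simp add: Dn flip: ennreal_plus)
  have Dn_sym: "Dn x y = Dn y x" if "x \<in> X n" "y \<in> X n" for x y
    using graphdist_sym[OF that, of \<eta> h] by (simp add: Dn_def)
  have Dn_hop: "Dn y z \<le> 1 / weight \<eta> h y z" if "y \<in> X n" "z \<in> X n" "weight \<eta> h y z > 0" for y z
    using graphdist_hop[OF that(1,2), of \<eta> h] that by (simp add: Dn hop_cost_pos)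
  have Dn_edge: "Dn x z \<le> Dn x y + 1 / weight \<eta> h y z"
    if "x \<in> X n" "y \<in> X n" "z \<in> X n" "weight \<eta> h y z > 0" for x y z
    using Dn_tri[OF that(1-3)] Dn_hop[OF that(2-4)] by linarith
  have bell: "\<exists>z\<in>X n. weight \<eta> h z y > 0 \<and> Dn x y = Dn x z + 1 / weight \<eta> h z y"
    if xy: "x \<in> X n" "y \<in> X n" "x \<noteq> y" for x y
  proof -
    obtain z where z: "z \<in> X n" "graphdist \<eta> h (X n) x z + hop_cost \<eta> h z y \<le> graphdist \<eta> h (X n) x y"
      using graphdist_bellman[OF X(1) xy] by blast
    have w: "weight \<eta> h z y > 0"
    proof (rule ccontr)
      assume "\<not> ?thesis"
      then have "weight \<eta> h z y = 0" using weight_nonneg[OF k h, of z y] by simp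
      then have "graphdist \<eta> h (X n) x y = top" using z(2) hop_cost_zero[of \<eta> h z y] by (simp add: top_unique)
      then show False using Dn[OF xy(1,2)] by simp
    qed
    have "ennreal (Dn x z + 1 / weight \<eta> h z y) \<le> ennreal (Dn x y)"
      using z w xy Dn0 by (simp add: Dn hop_cost_pos ennreal_plus)
    then have "Dn x z + 1 / weight \<eta> h z y \<le> Dn x y" using Dn0 by simp
    then show ?thesis using Dn_edge[OF xy(1) z(1) xy(2) w] z(1) w by (intro bexI[of _ z]) auto
  qed
  have eta_wt: "(\<lambda>y. eta_scaled \<eta> h (norm (x - y)) * (uX n y - uX n x)) = (\<lambda>y. weight \<eta> h x y * (uX n y - uX n x))" for x
    by (auto simp: weight_def)
  have eq: "Min ((\<lambda>y. weight \<eta> h x y * (uX n y - uX n x)) ` X n) + Max ((\<lambda>y. weight \<eta> h x y * (uX n y - uX n x)) ` X n) = 0"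
    if "x \<in> X n - L n" for x using sol(1)[OF that] unfolding eta_wt .
  have bal: "\<exists>z\<in>X n. weight \<eta> h x y * (uX n x - uX n y) \<le> weight \<eta> h x z * (uX n z - uX n x)"
    "\<exists>z\<in>X n. weight \<eta> h x y * (uX n y - uX n x) \<le> weight \<eta> h x z * (uX n x - uX n z)"
    if "x \<in> X n - L n" "y \<in> X n" for x y
    using balance_of_graph_equation[where wt = "weight \<eta> h" and u = "uX n" and x = x, OF X(1) that(2) eq[OF that(1)]] by auto
  have lab: "\<bar>uX n a - uX n b\<bar> \<le> M * Dn a b" if ab: "a \<in> L n" "b \<in> L n" for a b
  proof (cases "a = b")
    case False
    have abX: "a \<in> X n" "b \<in> X n" using ab X by auto
    obtain z where "z \<in> X n" "weight \<eta> h z b > 0" "Dn a b = Dn a z + 1 / weight \<eta> h z b"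
      using bell[OF abX False] by blast
    then have pos: "Dn a b > 0" using Dn0[of a z] by (simp add: add_nonneg_pos)
    have "ennreal \<bar>gX n a - gX n b\<bar> / graphdist \<eta> h (X n) a b \<le> Lip_const (graphdist \<eta> h (X n)) (gX n) (L n)"
      unfolding Lip_const_def using ab False by (intro SUP_upper2[of "(a, b)"]) auto
    also have "\<dots> \<le> (SUP n. Lip_const (graphdist \<eta> h (X n)) (gX n) (L n))" by (rule SUP_upper) simp
    also have "\<dots> \<le> ennreal M" by (rule data(1))
    finally have "ennreal (\<bar>gX n a - gX n b\<bar> / Dn a b) \<le> ennreal M" using pos by (simp add: Dn[OF abX] divide_ennreal)
    then have "\<bar>gX n a - gX n b\<bar> / Dn a b \<le> M" using MK by simp
    then show ?thesis using pos sol(2) ab by (simp add: pos_divide_le_eq)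
  qed (use MK in \<open>simp add: Dn_def\<close>)
  have v_lip: "\<bar>uX n x - uX n y\<bar> \<le> M * Dn x y" if "x \<in> X n" "y \<in> X n" for x y
  proof (rule graph_lipschitz[where wt = "weight \<eta> h" and L = "L n" and X = "X n"])
    show "0 \<le> M" using MK by simp
    show "\<exists>z\<in>X n. weight \<eta> h x y * (uX n x - uX n y) \<le> weight \<eta> h x z * (uX n z - uX n x)"
      if "x \<in> X n - L n" "y \<in> X n" for x y by (rule bal(1)[OF that])
    show "\<exists>z\<in>X n. weight \<eta> h x y * (uX n y - uX n x) \<le> weight \<eta> h x z * (uX n x - uX n z)"
      if "x \<in> X n - L n" "y \<in> X n" for x y by (rule bal(2)[OF that])
  qed (fact X(1,4) weight_nonneg[OF k h] weight_sym Dn_refl Dn_nonneg Dn_sym Dn_edge bell lab that)+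
  have am: "amle u \<O>" by (rule amle_of_is_AMLE[OF u])
  have \<Lambda>0: "\<Lambda> \<ge> 0" by (simp add: \<Lambda>)
  have ug: "u z = g z" if "z \<in> \<O>" for z using u that by (simp add: is_AMLE_def)
  have u_lip: "\<bar>u x - u y\<bar> \<le> \<Lambda> * gd \<Omega> x y" if "x \<in> closure \<Omega>" "y \<in> closure \<Omega>" for x y
  proof (rule amle_lipschitz[OF am \<O>(1,2) \<Lambda>0 _ that])
    fix a b assume ab: "a \<in> \<O>" "b \<in> \<O>"
    have "Lip_const (geodist \<Omega>) g \<O> \<le> ennreal \<Lambda>" using data(2) by (simp add: \<Lambda>)
    then have "\<bar>g a - g b\<bar> \<le> \<Lambda> * gd \<Omega> a b" using Lip_const_le_iff[OF \<O>(2) \<Lambda>0] ab by blast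
    then show "\<bar>u a - u b\<bar> \<le> \<Lambda> * gd \<Omega> a b" using ug ab by simp
  qed
  have exc: "\<exists>t\<in>{a..b::real}. gd \<Omega> p (c t) \<le> h + \<phi> h + \<kappa> \<and> h - \<kappa> \<le> norm (c t - p)"
    if "continuous_on {a..b} c" "c ` {a..b} \<subseteq> closure \<Omega>" "a \<le> b" "c a = p" "h < norm (c b - p)" "\<kappa> > 0" for p c a b \<kappa>
  proof (rule crossing_at_distance[OF op h _ that])
    fix x y assume xy: "x \<in> \<Omega>" "y \<in> \<Omega>" "norm (x - y) = h"
    have "geodist \<Omega> x y \<le> ennreal (h + \<phi> h)" using dom xy sc(1) unfolding domain_assumption_def by metis
    moreover have "x \<in> closure \<Omega>" "y \<in> closure \<Omega>" using xy closure_subset by auto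
    ultimately show "gd \<Omega> x y \<le> h + \<phi> h" using h \<phi> by (intro gd_le) auto
  qed
  have lower: "gd \<Omega> x y \<le> (1 + s) * Dn x y + 3 * A * h" if xy: "x \<in> X n" "y \<in> X n" for x y
  proof -
    have s1: "1 + s > 0" using s0 by simp
    have "ennreal ((gd \<Omega> x y - 3 * A * h) / (1 + s)) \<le> graphdist \<eta> h (X n) x y"
    proof (rule graphdist_lower[OF k h xy(1)])
      fix N p assume p: "\<And>i. i \<le> N \<Longrightarrow> p i \<in> X n" "p 0 = x" "p N = y" "\<And>i. i < N \<Longrightarrow> norm (p i - p (Suc i)) \<le> h"
      have "gd \<Omega> (p 0) (p N) \<le> (1 + (16 * A + 1) * (4 + 4 * (16 * A + 1)\<^sup>2) * \<phi> h / (3 * h)) * (\<Sum>i<N. norm (p i - p (Suc i))) + 3 * A * h"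
      proof (rule chain_length[where p = p, OF h \<phi>])
        show "\<exists>t\<in>{a..b::real}. gd \<Omega> q (c t) \<le> h + \<phi> h + \<kappa> \<and> h - \<kappa> \<le> norm (c t - q)"
          if "continuous_on {a..b} c" "c ` {a..b} \<subseteq> closure \<Omega>" "a \<le> b" "c a = q" "h < norm (c b - q)" "\<kappa> > 0"
          for q c a b \<kappa> by (rule exc[OF that])
        show "p i \<in> closure \<Omega>" if "i \<le> N" for i using p(1)[OF that] X(2) by blast
      qed (rule p(4))
      also have "(1 + (16 * A + 1) * (4 + 4 * (16 * A + 1)\<^sup>2) * \<phi> h / (3 * h)) * (\<Sum>i<N. norm (p i - p (Suc i)))
          \<le> (1 + s) * (\<Sum>i<N. norm (p i - p (Suc i)))"
        using s(1) unfolding excess_const_def by (intro mult_right_mono sum_nonneg) auto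
      finally show "(gd \<Omega> x y - 3 * A * h) / (1 + s) \<le> (\<Sum>i<N. norm (p i - p (Suc i)))"
        using s1 p(2,3) by (simp add: pos_divide_le_eq mult.commute)
    qed
    then have "(gd \<Omega> x y - 3 * A * h) / (1 + s) \<le> Dn x y" using Dn0 by (simp add: Dn[OF xy])
    then show ?thesis using s1 by (simp add: pos_divide_le_eq mult.commute)
  qed
  have Dn_le: "Dn x y \<le> (1 + s) * gd \<Omega> x y + h" if xy: "x \<in> X n" "y \<in> X n" for x y
  proof -
    have nn: "0 \<le> (1 + 4 * \<delta> / (t\<^sub>0 * h)) * gd \<Omega> x y + h" using res(4) t0 h gd_nonneg[of x y] by simp
    have "ennreal (Dn x y) \<le> ennreal ((1 + 4 * \<delta> / (t\<^sub>0 * h)) * gd \<Omega> x y + h)"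
      using upper[OF xy] by (simp add: Dn[OF xy])
    then have "Dn x y \<le> (1 + 4 * \<delta> / (t\<^sub>0 * h)) * gd \<Omega> x y + h" using nn by simp
    also have "(1 + 4 * \<delta> / (t\<^sub>0 * h)) * gd \<Omega> x y \<le> (1 + s) * gd \<Omega> x y"
      using s(2) gd_nonneg[of x y] by (intro mult_right_mono) auto
    finally show ?thesis by simp
  qed
  have ldata: "\<exists>y\<in>L n. norm (z - y) \<le> \<delta> \<and> \<bar>uX n y - u z\<bar> \<le> K * \<delta>" if z: "z \<in> \<O>" for z
  proof -
    have p: "\<pi>L n z \<in> L n" by (rule closest_pointD(1)[OF pr(2) z])
    then show ?thesis using res(2)[OF z] data(3)[OF z] sol(2)[OF p] ug[OF z] by (intro bexI[of _ "\<pi>L n z"]) auto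
  qed
  have "approximation_problem \<Omega> A \<O> (X n) (L n) u (uX n) (weight \<eta> h) Dn (\<pi> n) h \<delta> s M K \<Lambda>"
  proof (unfold_locales)
    show "\<exists>z\<in>X n. weight \<eta> h x y * (uX n x - uX n y) \<le> weight \<eta> h x z * (uX n z - uX n x)"
      if "x \<in> X n - L n" "y \<in> X n" for x y by (rule bal(1)[OF that])
    show "\<exists>z\<in>X n. weight \<eta> h x y * (uX n y - uX n x) \<le> weight \<eta> h x z * (uX n x - uX n z)"
      if "x \<in> X n - L n" "y \<in> X n" for x y by (rule bal(2)[OF that])
    show "0 \<le> M" "0 \<le> K" using MK by auto
  qed (fact am u_lip \<O> X weight_nonneg[OF k h] weight_sym weight_pos_near[OF k h] Dn_refl Dn_edge Dn_tri bell
      Dn_le lower v_lip \<pi> res(3) ldata h res(4) \<delta>h s0 \<Lambda>0)+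
  then show ?thesis unfolding Dn_def .
qed

end

text \<open>The projection fixes the vertices, and moving a point to its projection changes \<open>u\<close> by at most \<open>\<Lambda> A \<delta>\<close>.\<close>

lemma (in approximation_problem) sup_statements:
  assumes idem: "\<And>x. x \<in> X \<Longrightarrow> \<pi> x = x" and bound: "\<And>x. x \<in> closure \<Omega> \<Longrightarrow> \<bar>u x - v (\<pi> x)\<bar> \<le> b"
  shows "(SUP x\<in>X. \<bar>u x - v x\<bar>) \<le> (SUP x\<in>closure \<Omega>. \<bar>u x - v (\<pi> x)\<bar>)"
    and "(SUP x\<in>closure \<Omega>. \<bar>u x - v (\<pi> x)\<bar>) \<le> (SUP x\<in>X. \<bar>u x - v x\<bar>) + \<Lambda> * A * \<delta>"
    and "(SUP x\<in>closure \<Omega>. \<bar>u x - v (\<pi> x)\<bar>) \<le> b"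
proof -
  obtain x0 where x0: "x0 \<in> closure \<Omega>" using \<O> by blast
  have ne: "closure \<Omega> \<noteq> {}" "X \<noteq> {}" using x0 \<pi>[OF x0] by auto
  have bdd: "bdd_above ((\<lambda>x. \<bar>u x - v (\<pi> x)\<bar>) ` closure \<Omega>)" by (rule bdd_aboveI2[OF bound])
  have bddX: "bdd_above ((\<lambda>x. \<bar>u x - v x\<bar>) ` X)" using X(1) by simp
  show "(SUP x\<in>X. \<bar>u x - v x\<bar>) \<le> (SUP x\<in>closure \<Omega>. \<bar>u x - v (\<pi> x)\<bar>)"
  proof (rule cSUP_least[OF ne(2)])
    fix x assume x: "x \<in> X"
    then have "\<bar>u x - v (\<pi> x)\<bar> \<le> (SUP x\<in>closure \<Omega>. \<bar>u x - v (\<pi> x)\<bar>)" using X(2) by (intro cSUP_upper bdd) auto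
    then show "\<bar>u x - v x\<bar> \<le> (SUP x\<in>closure \<Omega>. \<bar>u x - v (\<pi> x)\<bar>)" using idem[OF x] by simp
  qed
  show "(SUP x\<in>closure \<Omega>. \<bar>u x - v (\<pi> x)\<bar>) \<le> (SUP x\<in>X. \<bar>u x - v x\<bar>) + \<Lambda> * A * \<delta>"
  proof (rule cSUP_least[OF ne(1)])
    fix x assume x: "x \<in> closure \<Omega>"
    have p: "\<pi> x \<in> X" "\<pi> x \<in> closure \<Omega>" using \<pi>[OF x] X by auto
    have "\<Lambda> * gd \<Omega> x (\<pi> x) \<le> \<Lambda> * (A * \<delta>)" using gd_\<pi>[OF x] params by (intro mult_left_mono) auto
    moreover have "\<bar>u (\<pi> x) - v (\<pi> x)\<bar> \<le> (SUP x\<in>X. \<bar>u x - v x\<bar>)" by (rule cSUP_upper[OF p(1) bddX])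
    ultimately show "\<bar>u x - v (\<pi> x)\<bar> \<le> (SUP x\<in>X. \<bar>u x - v x\<bar>) + \<Lambda> * A * \<delta>"
      using u_lip[OF x p(2)] by (simp add: mult.assoc)
  qed
  show "(SUP x\<in>closure \<Omega>. \<bar>u x - v (\<pi> x)\<bar>) \<le> b" by (rule cSUP_least[OF ne(1) bound])
qed

context finite_geodist
begin

text \<open>Both rates have the same shape: with \<open>\<epsilon> ^ j = \<phi> h / h\<close> and \<open>p = (j + 1) / (2 j + 1)\<close> the assumptions on
\<open>h\<close> and \<open>\<delta>\<close> amount to \<open>h \<le> Ch * \<epsilon> ^ (j + 1)\<close> and \<open>\<delta> \<le> Cd * \<phi> h\<close>; \<open>j = 4\<close> and \<open>j = 2\<close> give the exponents
\<open>5/9\<close> and \<open>3/5\<close>.\<close>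

lemma convergence_from_one_sided_rate:
  fixes g u :: "'a \<Rightarrow> real" and \<eta> :: "real \<Rightarrow> real" and j :: nat
  assumes op: "open \<Omega>" and \<O>: "closed \<O>" "\<O> \<subseteq> closure \<Omega>" "\<O> \<noteq> {}"
    and k: "kernel_assumption \<eta> t\<^sub>0" and u: "is_AMLE \<Omega> \<O> g u" and j: "j > 0"
    and Dm: "\<And>x y. x \<in> closure \<Omega> \<Longrightarrow> y \<in> closure \<Omega> \<Longrightarrow> gd \<Omega> x y \<le> Dm"
    and pos: "M > 0" "K > 0" "c\<^sub>1 > 0" "c\<^sub>2 > 0"
    and rate: "\<And>Cs Ch \<Lambda>. Cs \<ge> 0 \<Longrightarrow> Ch \<ge> 0 \<Longrightarrow> \<Lambda> \<ge> 0 \<Longrightarrow> \<exists>B C. \<forall>u' X L v wt Dn \<pi> h \<delta> s \<epsilon> x.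
       u' \<in> {u, \<lambda>x. - u x} \<longrightarrow> approximation_problem \<Omega> A \<O> X L u' v wt Dn \<pi> h \<delta> s M K \<Lambda> \<longrightarrow>
       \<epsilon> > 0 \<longrightarrow> s \<le> Cs * \<epsilon> ^ j \<longrightarrow> h \<le> Ch * \<epsilon> ^ Suc j \<longrightarrow> \<epsilon> * B \<le> 1 \<longrightarrow> x \<in> closure \<Omega> \<longrightarrow>
       v (\<pi> x) - u' x \<le> C * \<epsilon>"
  shows "\<exists>C>0. \<forall>\<phi> r h X L gX \<pi> \<pi>L uX n.
        domain_assumption \<Omega> \<phi> r \<longrightarrow>
        graph_setting \<Omega> \<O> g \<eta> h X L gX \<pi> \<pi>L uX M K \<longrightarrow>
        scaling_assumption \<phi> r t\<^sub>0 (resolution \<Omega> \<O> (X n) (L n)) h ((\<phi> h / h) powr (1 / real j)) \<longrightarrow>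
        h \<le> c\<^sub>1 * \<phi> h powr ((real j + 1) / (2 * real j + 1)) \<longrightarrow>
        resolution \<Omega> \<O> (X n) (L n) powr ((real j + 1) / (2 * real j + 1)) \<le> c\<^sub>2 * h \<longrightarrow>
          (SUP x\<in>X n. \<bar>u x - uX n x\<bar>) \<le> (SUP x\<in>closure \<Omega>. \<bar>u x - uX n (\<pi> n x)\<bar>) \<and>
          (SUP x\<in>closure \<Omega>. \<bar>u x - uX n (\<pi> n x)\<bar>)
            \<le> (SUP x\<in>X n. \<bar>u x - uX n x\<bar>) + C * resolution \<Omega> \<O> (X n) (L n) \<and>
          (SUP x\<in>closure \<Omega>. \<bar>u x - uX n (\<pi> n x)\<bar>) \<le> C * (\<phi> h / h) powr (1 / real j)"
proof -
  define p where "p = (real j + 1) / (2 * real j + 1)"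
  have p: "0 < p" "p < 1" using j by (auto simp: p_def field_simps)
  have p1: "1 - p = real j / (2 * real j + 1)" by (simp add: p_def field_simps)
  have p2: "p / (1 - p) = (real j + 1) / real j" unfolding p1 using j by (simp add: p_def)
  have t0: "0 < t\<^sub>0" "t\<^sub>0 \<le> 1" using k by (auto simp: kernel_assumption_def)
  define \<Lambda> where "\<Lambda> = enn2real (Lip_const (geodist \<Omega>) g \<O>)"
  have \<Lambda>0: "\<Lambda> \<ge> 0" by (simp add: \<Lambda>_def)
  define Cd where "Cd = (c\<^sub>2 * c\<^sub>1) powr (1 / p)"
  define Cs where "Cs = excess_const / 3 + 4 * Cd / t\<^sub>0"
  define Ch where "Ch = c\<^sub>1 powr (1 / (1 - p))"
  have ec: "excess_const \<ge> 0" using A1 by (simp add: excess_const_def)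
  have nn: "Cs \<ge> 0" "Ch \<ge> 0" "Cd \<ge> 0" using ec t0 by (auto simp: Cs_def Ch_def Cd_def)
  obtain B C\<^sub>0 where BC: "\<And>u' X L v wt Dn \<pi> h \<delta> s \<epsilon> x.
       u' \<in> {u, \<lambda>x. - u x} \<Longrightarrow> approximation_problem \<Omega> A \<O> X L u' v wt Dn \<pi> h \<delta> s M K \<Lambda> \<Longrightarrow>
       \<epsilon> > 0 \<Longrightarrow> s \<le> Cs * \<epsilon> ^ j \<Longrightarrow> h \<le> Ch * \<epsilon> ^ Suc j \<Longrightarrow> \<epsilon> * B \<le> 1 \<Longrightarrow> x \<in> closure \<Omega> \<Longrightarrow>
       v (\<pi> x) - u' x \<le> C\<^sub>0 * \<epsilon>"
    using rate[OF nn(1,2) \<Lambda>0] by blast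
  define G where "G = M * ((1 + Cs) * Dm + 1) + K + \<Lambda> * Dm"
  obtain x0 where x0: "x0 \<in> closure \<Omega>" using \<O> by blast
  have Dm0: "Dm \<ge> 0" using Dm[OF x0 x0] gd_nonneg[of x0 x0] by linarith
  have G0: "G \<ge> 0" using pos nn \<Lambda>0 Dm0 by (auto simp: G_def intro!: add_nonneg_nonneg mult_nonneg_nonneg)
  define C where "C = \<bar>C\<^sub>0\<bar> + G * \<bar>B\<bar> + \<Lambda> * A + 1"
  have C: "C > 0" "C\<^sub>0 \<le> C" "G * B \<le> C" "\<Lambda> * A \<le> C"
  proof -
    have "0 \<le> G * \<bar>B\<bar>" "G * B \<le> G * \<bar>B\<bar>" "0 \<le> \<Lambda> * A" using G0 \<Lambda>0 A1 by (auto intro: mult_left_mono)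
    then show "C > 0" "C\<^sub>0 \<le> C" "G * B \<le> C" "\<Lambda> * A \<le> C" unfolding C_def by linarith+
  qed
  show ?thesis
  proof (intro exI[of _ C] conjI[OF C(1)] allI impI, goal_cases)
    case (1 \<phi> r h X L gX \<pi> \<pi>L uX n)
    note dom = 1(1) and gs = 1(2) and sc = 1(3) and h_le = 1(4)[folded p_def] and \<delta>_le = 1(5)[folded p_def]
    define \<delta> where "\<delta> = resolution \<Omega> \<O> (X n) (L n)"
    define \<tau> where "\<tau> = \<phi> h / h"
    define \<epsilon> where "\<epsilon> = \<tau> powr (1 / real j)"
    have h: "h > 0" using gs by (simp add: graph_setting_def)
    have X: "finite (X n)" "X n \<subseteq> closure \<Omega>" "L n \<noteq> {}" "L n \<subseteq> X n" using gs by (auto simp: graph_setting_def)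
    have pr: "closest_point_projection (closure \<Omega>) (X n) (\<pi> n)" "closest_point_projection \<O> (L n) (\<pi>L n)"
      using gs by (auto simp: graph_setting_def)
    have \<delta>0: "\<delta> \<ge> 0" unfolding \<delta>_def by (rule resolution_bounds(4)[OF bounded_dom X \<O> pr])
    have \<phi>0: "\<phi> h \<ge> 0" using dom h by (simp add: domain_assumption_def)
    note ex = rate_exponents[OF h p pos(3,4) \<phi>0 \<delta>0 h_le \<delta>_le[folded \<delta>_def], folded Cd_def Ch_def \<tau>_def, unfolded p2]
    have \<tau>0: "\<tau> > 0" using ex(1) h by (simp add: \<tau>_def)
    have \<epsilon>0: "\<epsilon> > 0" using \<tau>0 by (simp add: \<epsilon>_def)
    have \<epsilon>j: "\<epsilon> ^ j = \<tau>"
      using \<tau>0 j by (simp add: \<epsilon>_def powr_powr flip: powr_realpow)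
    have \<epsilon>j1: "\<epsilon> ^ Suc j = \<tau> powr ((real j + 1) / real j)"
      using \<tau>0 by (simp add: \<epsilon>_def powr_powr add.commute del: power_Suc flip: powr_realpow)
    note sb = scaling_bounds[OF sc[folded \<delta>_def \<tau>_def, folded \<epsilon>_def] h ex(1) \<epsilon>0 \<delta>0 t0, folded \<tau>_def]
    have \<epsilon>1: "\<epsilon> \<le> 1" using sb(2) \<tau>0 by (simp add: \<epsilon>_def powr_le1)
    define s where "s = Cs * \<epsilon> ^ j"
    have s: "excess_const * \<phi> h / (3 * h) \<le> s" "4 * \<delta> / (t\<^sub>0 * h) \<le> s"
    proof -
      have eq: "s = excess_const * \<phi> h / (3 * h) + 4 * (Cd * \<phi> h) / (t\<^sub>0 * h)"
        unfolding s_def \<epsilon>j Cs_def \<tau>_def using h t0 by (simp add: field_simps)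
      have "0 \<le> 4 * (Cd * \<phi> h) / (t\<^sub>0 * h)" "0 \<le> excess_const * \<phi> h / (3 * h)" using nn ec \<phi>0 t0 h by auto
      moreover have "4 * \<delta> / (t\<^sub>0 * h) \<le> 4 * (Cd * \<phi> h) / (t\<^sub>0 * h)"
        using ex(2) t0 h by (intro divide_right_mono) auto
      ultimately show "excess_const * \<phi> h / (3 * h) \<le> s" "4 * \<delta> / (t\<^sub>0 * h) \<le> s" unfolding eq by linarith+
    qed
    have ap: "approximation_problem \<Omega> A \<O> (X n) (L n) u (uX n) (weight \<eta> h)
      (\<lambda>x y. enn2real (graphdist \<eta> h (X n) x y)) (\<pi> n) h \<delta> s M K \<Lambda>"
      by (rule approximation_problem_of_graph[OF op \<O> k u dom gs pos(1,2) \<delta>_def sb(1,3) ex(1) s \<Lambda>_def])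
    have h\<epsilon>: "h \<le> Ch * \<epsilon> ^ Suc j" unfolding \<epsilon>j1 by (rule ex(3))
    have bound: "\<bar>u x - uX n (\<pi> n x)\<bar> \<le> C * \<epsilon>" if x: "x \<in> closure \<Omega>" for x
    proof (cases "\<epsilon> * B \<le> 1")
      case True
      have "uX n (\<pi> n x) - u x \<le> C\<^sub>0 * \<epsilon>"
        by (rule BC[OF _ ap \<epsilon>0 _ h\<epsilon> True x]) (auto simp: s_def)
      moreover have "- uX n (\<pi> n x) - - u x \<le> C\<^sub>0 * \<epsilon>"
        by (rule BC[OF _ approximation_problem.negated[OF ap] \<epsilon>0 _ h\<epsilon> True x]) (auto simp: s_def)
      moreover have "C\<^sub>0 * \<epsilon> \<le> C * \<epsilon>" using C(2) \<epsilon>0 by (intro mult_right_mono) auto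
      ultimately show ?thesis by linarith
    next
      case False
      have "s \<le> Cs"
        unfolding s_def using mult_left_le[OF power_le_one[of \<epsilon> j] nn(1)] \<epsilon>0 \<epsilon>1 by simp
      moreover have "h \<le> 1" using sb(4) \<epsilon>1 by linarith
      ultimately have "\<bar>u x - uX n (\<pi> n x)\<bar> \<le> G"
        unfolding G_def using Dm x by (intro approximation_problem.crude_estimate[OF ap])
      also have "G \<le> G * (\<epsilon> * B)" using False G0 mult_left_mono[of 1 "\<epsilon> * B" G] by simp
      also have "\<dots> = G * B * \<epsilon>" by (simp add: mult.commute mult.left_commute)
      also have "\<dots> \<le> C * \<epsilon>" using C(3) \<epsilon>0 by (intro mult_right_mono) auto
      finally show ?thesis .
    qed
    have idem: "\<pi> n x = x" if "x \<in> X n" for x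
      using closest_pointD(2)[OF pr(1), of x x] that X(2) by auto
    note S = approximation_problem.sup_statements[OF ap idem bound]
    have "\<Lambda> * A * \<delta> \<le> C * \<delta>" using C(4) \<delta>0 by (intro mult_right_mono)
    then show ?case using S unfolding \<delta>_def[symmetric] \<tau>_def[symmetric] \<epsilon>_def[symmetric] by auto
  qed
qed

end

text \<open>A limit superior above \<open>\<alpha>\<close> is witnessed arbitrarily close to the point.\<close>

lemma local_slope_positive:
  assumes inf: "(INF x\<in>closure \<Omega>. local_slope \<Omega> u x) > 0"
  obtains \<alpha> where "\<alpha> > 0" "\<And>x e. x \<in> closure \<Omega> \<Longrightarrow> e > 0 \<Longrightarrow>
    \<exists>y\<in>closure \<Omega>. y \<noteq> x \<and> norm (y - x) < e \<and> \<alpha> * norm (y - x) \<le> \<bar>u y - u x\<bar>"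
proof -
  obtain \<alpha>' where \<alpha>': "0 < \<alpha>'" "\<alpha>' < (INF x\<in>closure \<Omega>. local_slope \<Omega> u x)" using dense[OF inf] by blast
  then obtain \<alpha> where \<alpha>: "\<alpha>' = ereal \<alpha>" by (cases \<alpha>') auto
  have \<alpha>0: "\<alpha> > 0" using \<alpha>'(1) \<alpha> by simp
  show ?thesis
  proof (rule that[OF \<alpha>0], rule ccontr)
    fix x e assume x: "x \<in> closure \<Omega>" and e: "e > 0"
      and none: "\<not> (\<exists>y\<in>closure \<Omega>. y \<noteq> x \<and> norm (y - x) < e \<and> \<alpha> * norm (y - x) \<le> \<bar>u y - u x\<bar>)"
    have "\<forall>\<^sub>F y in at x within closure \<Omega>. ereal (\<bar>u y - u x\<bar> / norm (y - x)) \<le> ereal \<alpha>"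
      unfolding eventually_at
    proof (intro exI[of _ e] conjI e ballI impI)
      fix y assume y: "y \<in> closure \<Omega>" "y \<noteq> x \<and> dist y x < e"
      then have "\<bar>u y - u x\<bar> < \<alpha> * norm (y - x)" using none by (force simp: dist_norm)
      then show "ereal (\<bar>u y - u x\<bar> / norm (y - x)) \<le> ereal \<alpha>" using y by (simp add: pos_divide_le_eq)
    qed
    then have "local_slope \<Omega> u x \<le> ereal \<alpha>" unfolding local_slope_def by (rule Limsup_bounded)
    moreover have "ereal \<alpha> < local_slope \<Omega> u x" using \<alpha>'(2) \<alpha> x by (meson INF_lower less_le_trans)
    ultimately show False by simp
  qed
qed

theorem corollary2p6:
  fixes \<Omega> \<O> :: "'a::euclidean_space set"
    and g u :: "'a \<Rightarrow> real"
    and \<eta> :: "real \<Rightarrow> real" and t\<^sub>0 :: real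
  assumes "open \<Omega>" "connected \<Omega>" "bounded \<Omega>" "\<Omega> \<noteq> {}"
    and "closed \<O>" "\<O> \<subseteq> closure \<Omega>" "\<O> \<noteq> {}"
    and "kernel_assumption \<eta> t\<^sub>0"
    and "is_AMLE \<Omega> \<O> g u"
  shows
    "(\<forall>M>0. \<forall>K>0. \<forall>c\<^sub>1>0. \<forall>c\<^sub>2>0. \<exists>C>0. \<forall>\<phi> r h X L gX \<pi> \<pi>L uX n.
        domain_assumption \<Omega> \<phi> r \<longrightarrow>
        graph_setting \<Omega> \<O> g \<eta> h X L gX \<pi> \<pi>L uX M K \<longrightarrow>
        scaling_assumption \<phi> r t\<^sub>0 (resolution \<Omega> \<O> (X n) (L n)) h ((\<phi> h / h) powr (1/4)) \<longrightarrow>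
        h \<le> c\<^sub>1 * \<phi> h powr (5/9) \<longrightarrow>
        resolution \<Omega> \<O> (X n) (L n) powr (5/9) \<le> c\<^sub>2 * h \<longrightarrow>
          (SUP x\<in>X n. \<bar>u x - uX n x\<bar>) \<le> (SUP x\<in>closure \<Omega>. \<bar>u x - uX n (\<pi> n x)\<bar>) \<and>
          (SUP x\<in>closure \<Omega>. \<bar>u x - uX n (\<pi> n x)\<bar>)
            \<le> (SUP x\<in>X n. \<bar>u x - uX n x\<bar>) + C * resolution \<Omega> \<O> (X n) (L n) \<and>
          (SUP x\<in>closure \<Omega>. \<bar>u x - uX n (\<pi> n x)\<bar>) \<le> C * (\<phi> h / h) powr (1/4))
     \<and>
     ((INF x\<in>closure \<Omega>. local_slope \<Omega> u x) > 0 \<longrightarrow>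
      (\<forall>M>0. \<forall>K>0. \<forall>c\<^sub>1>0. \<forall>c\<^sub>2>0. \<exists>C>0. \<forall>\<phi> r h X L gX \<pi> \<pi>L uX n.
        domain_assumption \<Omega> \<phi> r \<longrightarrow>
        graph_setting \<Omega> \<O> g \<eta> h X L gX \<pi> \<pi>L uX M K \<longrightarrow>
        scaling_assumption \<phi> r t\<^sub>0 (resolution \<Omega> \<O> (X n) (L n)) h ((\<phi> h / h) powr (1/2)) \<longrightarrow>
        h \<le> c\<^sub>1 * \<phi> h powr (3/5) \<longrightarrow>
        resolution \<Omega> \<O> (X n) (L n) powr (3/5) \<le> c\<^sub>2 * h \<longrightarrow>
          (SUP x\<in>X n. \<bar>u x - uX n x\<bar>) \<le> (SUP x\<in>closure \<Omega>. \<bar>u x - uX n (\<pi> n x)\<bar>) \<and>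
          (SUP x\<in>closure \<Omega>. \<bar>u x - uX n (\<pi> n x)\<bar>)
            \<le> (SUP x\<in>X n. \<bar>u x - uX n x\<bar>) + C * resolution \<Omega> \<O> (X n) (L n) \<and>
          (SUP x\<in>closure \<Omega>. \<bar>u x - uX n (\<pi> n x)\<bar>) \<le> C * (\<phi> h / h) powr (1/2)))"
proof (cases "\<exists>\<phi> r. domain_assumption \<Omega> \<phi> r")
  case False
  then show ?thesis by (auto intro!: exI[of _ "1::real"])
next
  case True
  then obtain A where "finite_geodist \<Omega> A" using finite_geodist_of_domain assms(2,3) by metis
  then interpret finite_geodist \<Omega> A .
  have cont: "continuous_on (closure \<Omega>) u" using assms(9) by (simp add: is_AMLE_def)
  obtain Q where Q: "\<And>x. x \<in> closure \<Omega> \<Longrightarrow> \<bar>u x\<bar> \<le> Q" using continuous_bounded[OF cont] by blast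
  obtain b where b: "\<And>x. x \<in> closure \<Omega> \<Longrightarrow> norm x \<le> b" using bounded_closure[OF bounded_dom] by (auto simp: bounded_iff)
  have Dm: "gd \<Omega> x y \<le> A * (2 * b)" if "x \<in> closure \<Omega>" "y \<in> closure \<Omega>" for x y
  proof -
    have "norm (x - y) \<le> 2 * b" using norm_triangle_ineq4[of x y] b[OF that(1)] b[OF that(2)] by linarith
    then have "A * norm (x - y) \<le> A * (2 * b)" using A1 by (intro mult_left_mono) auto
    then show ?thesis using gd_le_norm[OF that] by linarith
  qed
  have Q': "\<bar>u' x\<bar> \<le> Q" if "u' \<in> {u, \<lambda>x. - u x}" "x \<in> closure \<Omega>" for u' x using Q that by auto
  show ?thesis
  proof (intro conjI impI allI, goal_cases)
    case (1 M K c\<^sub>1 c\<^sub>2)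
    have "\<exists>B C. \<forall>u' X L v wt Dn \<pi> h \<delta> s \<epsilon> x.
       u' \<in> {u, \<lambda>x. - u x} \<longrightarrow> approximation_problem \<Omega> A \<O> X L u' v wt Dn \<pi> h \<delta> s M K \<Lambda> \<longrightarrow>
       \<epsilon> > 0 \<longrightarrow> s \<le> Cs * \<epsilon> ^ 4 \<longrightarrow> h \<le> Ch * \<epsilon> ^ Suc 4 \<longrightarrow> \<epsilon> * B \<le> 1 \<longrightarrow> x \<in> closure \<Omega> \<longrightarrow>
       v (\<pi> x) - u' x \<le> C * \<epsilon>" if nn: "0 \<le> Cs" "0 \<le> Ch" for Cs Ch \<Lambda>
    proof (intro exI allI impI)
      fix u' X L v wt Dn \<pi> h \<delta> s \<epsilon> x
      assume u': "u' \<in> {u, \<lambda>x. - u x}" and ap: "approximation_problem \<Omega> A \<O> X L u' v wt Dn \<pi> h \<delta> s M K \<Lambda>"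
        and r: "\<epsilon> > 0" "s \<le> Cs * \<epsilon> ^ 4" "h \<le> Ch * \<epsilon> ^ Suc 4" and x: "x \<in> closure \<Omega>"
        and sm: "\<epsilon> * (1 + 20 * A * Ch + 20 * Cs + 4 * (2 * M * (4 * Cs + 14 * A * Ch) + 1) * (2 * Q + 2 * (A * (2 * b) + 1))) \<le> 1"
      have h5: "h \<le> Ch * \<epsilon> ^ 5" using r(3) by (simp add: eval_nat_numeral)
      show "v (\<pi> x) - u' x \<le> (2 * (A * (2 * b) + 1) + (K + 7 * M + 4 * \<Lambda>) +
          2 * (2 * M * (4 * Cs + 14 * A * Ch) + 1) * (2 * Q + 2 * (A * (2 * b) + 1))\<^sup>2) * \<epsilon>"
        by (rule approximation_problem.patched_rate[OF ap r(1) nn r(2) h5 Dm Q'[OF u'] refl refl sm x])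
    qed
    then show ?case
      using convergence_from_one_sided_rate[OF assms(1,5,6,7,8,9), of 4 "A * (2 * b)" M K c\<^sub>1 c\<^sub>2] Dm 1 by simp
  next
    case (2 M K c\<^sub>1 c\<^sub>2)
    obtain \<alpha> where \<alpha>: "\<alpha> > 0" "\<And>x e. x \<in> closure \<Omega> \<Longrightarrow> e > 0 \<Longrightarrow>
      \<exists>y\<in>closure \<Omega>. y \<noteq> x \<and> norm (y - x) < e \<and> \<alpha> * norm (y - x) \<le> \<bar>u y - u x\<bar>"
      using local_slope_positive[OF 2(1)] by blast
    have slope: "\<exists>y\<in>closure \<Omega>. y \<noteq> x \<and> gd \<Omega> x y < e \<and> \<alpha> / A * gd \<Omega> x y \<le> \<bar>u' y - u' x\<bar>"
      if u': "u' \<in> {u, \<lambda>x. - u x}" and x: "x \<in> closure \<Omega>" and e: "e > 0" for u' x e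
    proof -
      have "e / A > 0" using e A1 by simp
      then obtain y where y: "y \<in> closure \<Omega>" "y \<noteq> x" "norm (y - x) < e / A" "\<alpha> * norm (y - x) \<le> \<bar>u y - u x\<bar>"
        using \<alpha>(2)[OF x] by blast
      have le: "gd \<Omega> x y \<le> A * norm (y - x)" using gd_le_norm[OF x y(1)] by (simp add: norm_minus_commute)
      also have "\<dots> < e" using y(3) A1 by (simp add: pos_less_divide_eq mult.commute)
      finally have "gd \<Omega> x y < e" .
      moreover have "\<alpha> / A * gd \<Omega> x y \<le> \<alpha> / A * (A * norm (y - x))" using le \<alpha>(1) A1 by (intro mult_left_mono) auto
      then have "\<alpha> / A * gd \<Omega> x y \<le> \<bar>u y - u x\<bar>" using y(4) A1 by simp
      moreover have "\<bar>u' y - u' x\<bar> = \<bar>u y - u x\<bar>" using u' by (auto simp: abs_minus_commute)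
      ultimately show ?thesis using y(1,2) by (intro bexI[of _ y]) auto
    qed
    have \<alpha>A: "\<alpha> / A > 0" using \<alpha>(1) A1 by simp
    have "\<exists>B C. \<forall>u' X L v wt Dn \<pi> h \<delta> s \<epsilon> x.
       u' \<in> {u, \<lambda>x. - u x} \<longrightarrow> approximation_problem \<Omega> A \<O> X L u' v wt Dn \<pi> h \<delta> s M K \<Lambda> \<longrightarrow>
       \<epsilon> > 0 \<longrightarrow> s \<le> Cs * \<epsilon> ^ 2 \<longrightarrow> h \<le> Ch * \<epsilon> ^ Suc 2 \<longrightarrow> \<epsilon> * B \<le> 1 \<longrightarrow> x \<in> closure \<Omega> \<longrightarrow>
       v (\<pi> x) - u' x \<le> C * \<epsilon>" if nn: "0 \<le> Cs" "0 \<le> Ch" for Cs Ch \<Lambda>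
    proof (intro exI allI impI)
      fix u' X L v wt Dn \<pi> h \<delta> s \<epsilon> x
      assume u': "u' \<in> {u, \<lambda>x. - u x}" and ap: "approximation_problem \<Omega> A \<O> X L u' v wt Dn \<pi> h \<delta> s M K \<Lambda>"
        and r: "\<epsilon> > 0" "s \<le> Cs * \<epsilon> ^ 2" "h \<le> Ch * \<epsilon> ^ Suc 2" and x: "x \<in> closure \<Omega>"
        and sm: "\<epsilon> * (1 + 20 * A * Ch + 20 * Cs + 4 * ((2 * M * (4 * Cs + 14 * A * Ch) + 1) / (\<alpha> / A)\<^sup>2) * (2 * Q)) \<le> 1"
      have h3: "h \<le> Ch * \<epsilon> ^ 3" using r(3) by (simp add: eval_nat_numeral)
      show "v (\<pi> x) - u' x \<le> ((K + 7 * M + 4 * \<Lambda>) +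
          2 * ((2 * M * (4 * Cs + 14 * A * Ch) + 1) / (\<alpha> / A)\<^sup>2) * (2 * Q)\<^sup>2) * \<epsilon>"
        by (rule approximation_problem.sloped_rate[OF ap r(1) nn r(2) h3 \<alpha>A slope[OF u'] Q'[OF u'] refl sm x])
    qed
    then show ?case
      using convergence_from_one_sided_rate[OF assms(1,5,6,7,8,9), of 2 "A * (2 * b)" M K c\<^sub>1 c\<^sub>2] Dm 2 by simp
  qed
qed

end
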